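(* Let $T>0$, $0<\alpha<\frac12$, and $g\in W_T^{1-\alpha,\infty}(0,T;\mathbb R^m)$. Assume that $\sigma$ satisfies (H1) with $\beta>\alpha>1-\mu$. For $f:[0,T]\to\mathbb R^d$ put $G^{(\sigma)}_t(f)=\int_0^t\sigma(t,s,f(s))\,dg_s$. 1. If $f\in W_0^{\alpha,\infty}(0,T;\mathbb R^d)$, then $G^{(\sigma)}(f)\in C^{1-\alpha}(0,T;\mathbb R^d)\subseteq W_0^{\alpha,\infty}(0,T;\mathbb R^d)$. Moreover, for all $\lambda\ge1$, $$\|G^{(\sigma)}(f)\|_{1-\alpha}\le\Lambda_\alpha(g)\,d^{(3)}(1+\|f\|_{\alpha,\infty}),\qquad \|G^{(\sigma)}(f)\|_{\alpha,\lambda}\le\frac{\Lambda_\alpha(g)\,d^{(4)}}{\lambda^{1-2\alpha}}(1+\|f\|_{\alpha,\lambda}),$$ where the constants $d^{(3)},d^{(4)}$ depend only on $\alpha,\beta,\mu,K,T$ and $N$. 2. If $f,h\in W_0^{\alpha,\infty}(0,T;\mathbb R^d)$ satisfy $\|f\|_\infty\le N$, $\|h\|_\infty\le N$, then for all $\lambda\ge1$ $$\|G^{(\sigma)}(f)-G^{(\sigma)}(h)\|_{\alpha,\lambda}\le\frac{\Lambda_\alpha(g)\,d'_N}{\lambda^{1-2\alpha}}\big(1+\Delta(f)+\Delta(h)\big)\|f-h\|_{\alpha,\lambda},$$ where $\Delta(f)=\sup_{u\in[0,T]}\int_0^u\frac{|f(u)-f(s)|^\delta}{(u-s)^{\alpha+1}}ds$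 and the constant $d'_N$ depends only on $\alpha,\beta,\mu,N,K$ and $T$.
   Context: Norms and spaces. $\|f\|_\infty=\sup_{s\in[0,T]}|f(s)|$. $W_0^{\alpha,\infty}(0,T;\mathbb R^d)$: measurable $f:[0,T]\to\mathbb R^d$ with $\|f\|_{\alpha,\infty}:=\sup_{t\in[0,T]}\big(|f(t)|+\int_0^t\frac{|f(t)-f(s)|}{(t-s)^{\alpha+1}}ds\big)<\infty$. For $\lambda\ge1$, $\|f\|_{\alpha,\lambda}:=\sup_{t\in[0,T]}e^{-\lambda t}\big(|f(t)|+\int_0^t\frac{|f(t)-f(s)|}{(t-s)^{\alpha+1}}ds\big)$. For $0<\kappa\le1$, $C^\kappa(0,T;\mathbb R^d)$: functions $f:[0,T]\to\mathbb R^d$ with $\|f\|_\kappa:=\|f\|_\infty+\sup_{0\le s<t\le T}\frac{|f(t)-f(s)|}{(t-s)^\kappa}<\infty$. $W_T^{1-\alpha,\infty}(0,T;\mathbb R^m)$: measurable $g:[0,T]\to\mathbb R^m$ with $\sup_{0<s<t<T}\big(\frac{|g(t)-g(s)|}{(t-s)^{1-\alpha}}+\int_s^t\frac{|g(y)-g(s)|}{(y-s)^{2-\alpha}}dy\big)<\infty$. Integral. With $$(D^\alpha_{0+}f)(x)=\frac1{\Gamma(1-\alpha)}\Big(\frac{f(x)}{x^\alpha}+\alpha\int_0^x\frac{f(x)-f(y)}{(x-y)^{\alpha+1}}dy\Big),$$ $$(\widetilde D^{1-\alpha}_{t-}g_{t-})(x)=\frac1{\Gamma(\alpha)}\Big(\frac{g(x)-g(t-)}{(t-x)^{1-\alpha}}+(1-\alpha)\int_x^t\frac{g(x)-g(y)}{(y-x)^{2-\alpha}}dy\Big),$$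 put $\Lambda_\alpha(g):=\frac1{\Gamma(1-\alpha)}\sup_{0<s<t<T}|(\widetilde D^{1-\alpha}_{t-}g_{t-})(s)|<\infty$. For measurable $f$ with $\int_0^T\frac{|f(s)|}{s^\alpha}ds+\int_0^T\int_0^s\frac{|f(s)-f(y)|}{(s-y)^{\alpha+1}}dy\,ds<\infty$, the (Zähle) generalized Stieltjes integral is $\int_0^t f\,dg:=-\int_0^t(D^\alpha_{0+}f)(x)(\widetilde D^{1-\alpha}_{t-}g_{t-})(x)\,dx$, with matrix-valued $f$ acting on $\mathbb R^m$-valued $g$ componentwise ($\big(\int f\,dg\big)_i=\sum_j\int f_{ij}\,dg^j$). (H1) $\sigma:[0,T]^2\times\mathbb R^d\to\mathbb R^{d\times m}$ is measurable, the derivatives $\partial_x\sigma(t,s,x)$, $\partial_t\sigma(t,s,x)$, $\partial^2_{x,t}\sigma(t,s,x)$ exist, and there are constants $0<\beta,\mu,\delta\le1$, $K>0$ and, for every $N\ge0$, $K_N>0$ such that (all times in $[0,T]$, $i=1,\dots,d$): 1. $|\sigma(t,s,x)-\sigma(t,s,y)|+|\partial_t\sigma(t,s,x)-\partial_t\sigma(t,s,y)|\le K|x-y|$ for all $x,y\in\mathbb R^d$; 2. $|\partial_{x_i}\sigma(t,s,x)-\partial_{x_i}\sigma(t,s,y)|+|\partial^2_{x_i,t}\sigma(t,s,x)-\partial^2_{x_i,t}\sigma(t,s,y)|\le K_N|x-y|^\delta$ for all $|x|,|y|\le N$; 3. $|\sigma(t_1,s,x)-\sigma(t_2,s,x)|+|\partial_{x_i}\sigma(t_1,s,x)-\partial_{x_i}\sigma(t_2,s,x)|\le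 K|t_1-t_2|^\mu$ for all $x\in\mathbb R^d$; 4. $|\sigma(t,s_1,x)-\sigma(t,s_2,x)|+|\partial_t\sigma(t,s_1,x)-\partial_t\sigma(t,s_2,x)|\le K|s_1-s_2|^\beta$ for all $x\in\mathbb R^d$; 5. $|\partial^2_{x_i,t}\sigma(t,s_1,x)-\partial^2_{x_i,t}\sigma(t,s_2,x)|+|\partial_{x_i}\sigma(t,s_1,x)-\partial_{x_i}\sigma(t,s_2,x)|\le K|s_1-s_2|^\beta$ for all $x\in\mathbb R^d$.
   Formalization: The constants d^(3), d^(4) may also depend on an upper bound for |σ(0,0,0)|, and d'_N also on the family (K_N) from (H1); as literally stated (depending only on α, β, μ, K, T, N) the claims fail, e.g. for constant σ. *)

theory Defs
  imports "HOL-Analysis.Analysis"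
begin

text \<open>
  Functions on \<open>[0,T]\<close> are total functions on the reals of which only the values on \<open>[0,T]\<close>
  are used. Suprema and integrals of nonnegative quantities are taken in the extended
  nonnegative reals, so that they may be infinite. The norm of a matrix is the Frobenius norm.
  "Measurable" means Borel measurable on the domain; for the spaces \<open>W0\<close> and \<open>WT\<close> below this
  is no restriction, since finiteness of the norms forces continuity on the half-open interval
  \<open>(0,T]\<close>, respectively on the open interval \<open>(0,T)\<close>.
\<close>

definition sup_norm :: "real \<Rightarrow> (real \<Rightarrow> 'a::real_normed_vector) \<Rightarrow> ennreal" where
  "sup_norm T f = (SUP s\<in>{0..T}. ennreal (norm (f s)))"

definition alpha_norm :: "real \<Rightarrow> real \<Rightarrow> (real \<Rightarrow> 'a::real_normed_vector) \<Rightarrow> ennreal" where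
  "alpha_norm T \<alpha> f = (SUP t\<in>{0..T}. ennreal (norm (f t))
     + (\<integral>\<^sup>+s\<in>{0<..<t}. ennreal (norm (f t - f s) / (t - s) powr (\<alpha> + 1)) \<partial>lborel))"

definition alpha_lambda_norm ::
    "real \<Rightarrow> real \<Rightarrow> real \<Rightarrow> (real \<Rightarrow> 'a::real_normed_vector) \<Rightarrow> ennreal" where
  "alpha_lambda_norm T \<alpha> l f = (SUP t\<in>{0..T}. ennreal (exp (- l * t)) * (ennreal (norm (f t))
     + (\<integral>\<^sup>+s\<in>{0<..<t}. ennreal (norm (f t - f s) / (t - s) powr (\<alpha> + 1)) \<partial>lborel)))"

definition holder_norm :: "real \<Rightarrow> real \<Rightarrow> (real \<Rightarrow> 'a::real_normed_vector) \<Rightarrow> ennreal" where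
  "holder_norm T \<kappa> f = sup_norm T f
     + (SUP (s, t)\<in>{(s, t). 0 \<le> s \<and> s < t \<and> t \<le> T}.
          ennreal (norm (f t - f s) / (t - s) powr \<kappa>))"

definition W0 :: "real \<Rightarrow> real \<Rightarrow> (real \<Rightarrow> 'a::real_normed_vector) set" where
  "W0 T \<alpha> = {f. f \<in> borel_measurable (restrict_space borel {0..T}) \<and> alpha_norm T \<alpha> f < \<infinity>}"

definition holder_space :: "real \<Rightarrow> real \<Rightarrow> (real \<Rightarrow> 'a::real_normed_vector) set" where
  "holder_space T \<kappa> = {f. holder_norm T \<kappa> f < \<infinity>}"

text \<open>\<open>WT T \<alpha>\<close> is the space with upper indices \<open>1 - \<alpha>\<close> and \<open>\<infinity>\<close>.\<close>

definition WT :: "real \<Rightarrow> real \<Rightarrow> (real \<Rightarrow> 'a::real_normed_vector) set" where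
  "WT T \<alpha> = {g. g \<in> borel_measurable (restrict_space borel {0..T}) \<and>
     (SUP (s, t)\<in>{(s, t). 0 < s \<and> s < t \<and> t < T}.
        ennreal (norm (g t - g s) / (t - s) powr (1 - \<alpha>))
        + (\<integral>\<^sup>+y\<in>{s<..<t}. ennreal (norm (g y - g s) / (y - s) powr (2 - \<alpha>)) \<partial>lborel)) < \<infinity>}"

definition Delta :: "real \<Rightarrow> real \<Rightarrow> real \<Rightarrow> (real \<Rightarrow> 'a::real_normed_vector) \<Rightarrow> ennreal" where
  "Delta T \<alpha> \<delta> f = (SUP u\<in>{0..T}.
     (\<integral>\<^sup>+s\<in>{0<..<u}. ennreal (norm (f u - f s) powr \<delta> / (u - s) powr (\<alpha> + 1)) \<partial>lborel))"

text \<open>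
  The fractional derivatives of order \<open>\<alpha>\<close> from the left at \<open>0\<close>, and of order \<open>1 - \<alpha>\<close> from the
  right at \<open>t\<close>; in the latter \<open>Lim (at_left t) g\<close> is \<open>g(t-)\<close>.
\<close>

definition frac_deriv_0 ::
    "real \<Rightarrow> (real \<Rightarrow> 'a::{banach, second_countable_topology}) \<Rightarrow> real \<Rightarrow> 'a" where
  "frac_deriv_0 \<alpha> f x = (1 / Gamma (1 - \<alpha>)) *\<^sub>R (f x /\<^sub>R x powr \<alpha>
     + \<alpha> *\<^sub>R (LINT y:{0<..<x}|lborel. (f x - f y) /\<^sub>R (x - y) powr (\<alpha> + 1)))"

definition frac_deriv_t ::
    "real \<Rightarrow> real \<Rightarrow> (real \<Rightarrow> 'a::{banach, second_countable_topology}) \<Rightarrow> real \<Rightarrow> 'a" where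
  "frac_deriv_t \<alpha> t g x = (1 / Gamma \<alpha>) *\<^sub>R ((g x - Lim (at_left t) g) /\<^sub>R (t - x) powr (1 - \<alpha>)
     + (1 - \<alpha>) *\<^sub>R (LINT y:{x<..<t}|lborel. (g x - g y) /\<^sub>R (y - x) powr (2 - \<alpha>)))"

definition Lambda ::
    "real \<Rightarrow> real \<Rightarrow> (real \<Rightarrow> 'a::{banach, second_countable_topology}) \<Rightarrow> ennreal" where
  "Lambda T \<alpha> g = ennreal (1 / Gamma (1 - \<alpha>)) *
     (SUP (s, t)\<in>{(s, t). 0 < s \<and> s < t \<and> t < T}. ennreal (norm (frac_deriv_t \<alpha> t g s)))"

text \<open>The class of integrands for which the generalized Stieltjes integral is defined.\<close>

definition stieltjes_integrand :: "real \<Rightarrow> real \<Rightarrow> (real \<Rightarrow> 'a::real_normed_vector) \<Rightarrow> bool" where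
  "stieltjes_integrand T \<alpha> f \<longleftrightarrow> f \<in> borel_measurable (restrict_space borel {0..T}) \<and>
     (\<integral>\<^sup>+s\<in>{0<..<T}. ennreal (norm (f s) / s powr \<alpha>) \<partial>lborel)
     + (\<integral>\<^sup>+s\<in>{0<..<T}. (\<integral>\<^sup>+y\<in>{0<..<s}.
          ennreal (norm (f s - f y) / (s - y) powr (\<alpha> + 1)) \<partial>lborel) \<partial>lborel) < \<infinity>"

definition stieltjes_integral ::
    "real \<Rightarrow> real \<Rightarrow> (real \<Rightarrow> real) \<Rightarrow> (real \<Rightarrow> real) \<Rightarrow> real" where
  "stieltjes_integral \<alpha> t f g =
     - (LINT x:{0<..<t}|lborel. frac_deriv_0 \<alpha> f x * frac_deriv_t \<alpha> t g x)"

definition stieltjes_integral_mat ::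
    "real \<Rightarrow> real \<Rightarrow> (real \<Rightarrow> real^'m^'d) \<Rightarrow> (real \<Rightarrow> real^'m) \<Rightarrow> real^'d" where
  "stieltjes_integral_mat \<alpha> t f g =
     (\<chi> i. \<Sum>j\<in>UNIV. stieltjes_integral \<alpha> t (\<lambda>s. f s $ i $ j) (\<lambda>s. g s $ j))"

definition G_op ::
    "real \<Rightarrow> (real \<Rightarrow> real^'m) \<Rightarrow> (real \<Rightarrow> real \<Rightarrow> real^'d \<Rightarrow> real^'m^'d)
      \<Rightarrow> (real \<Rightarrow> real^'d) \<Rightarrow> real \<Rightarrow> real^'d" where
  "G_op \<alpha> g \<sigma> f t = stieltjes_integral_mat \<alpha> t (\<lambda>s. \<sigma> t s (f s)) g"

text \<open>
  Hypothesis (H1) with its constants. The functions \<open>\<sigma>t\<close>, \<open>\<sigma>x i\<close> and \<open>\<sigma>xt i\<close> are the derivatives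
  of \<open>\<sigma>\<close> with respect to \<open>t\<close> (one-sided at \<open>0\<close> and \<open>T\<close>), to \<open>x\<^sub>i\<close>, and first to \<open>t\<close> and then to
  \<open>x\<^sub>i\<close>; they are uniquely determined by \<open>\<sigma>\<close> on \<open>[0,T]\<close> when \<open>T > 0\<close>. Under the estimates below,
  the mixed derivative taken in the other order exists as well and is the same.
\<close>

definition H1 ::
    "real \<Rightarrow> real \<Rightarrow> real \<Rightarrow> real \<Rightarrow> real \<Rightarrow> (real \<Rightarrow> real)
      \<Rightarrow> (real \<Rightarrow> real \<Rightarrow> real^'d \<Rightarrow> real^'m^'d) \<Rightarrow> bool" where
  "H1 T \<beta> \<mu> \<delta> K KN \<sigma> \<longleftrightarrow>
     0 < \<beta> \<and> \<beta> \<le> 1 \<and> 0 < \<mu> \<and> \<mu> \<le> 1 \<and> 0 < \<delta> \<and> \<delta> \<le> 1 \<and> 0 < K \<and> (\<forall>N\<ge>0. 0 < KN N) \<and>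
     (\<lambda>(t, s, x). \<sigma> t s x) \<in> borel_measurable (restrict_space borel ({0..T} \<times> {0..T} \<times> UNIV)) \<and>
     (\<exists>\<sigma>t \<sigma>x \<sigma>xt.
       (\<forall>t\<in>{0..T}. \<forall>s\<in>{0..T}. \<forall>x.
          ((\<lambda>r. \<sigma> r s x) has_vector_derivative \<sigma>t t s x) (at t within {0..T}) \<and>
          (\<forall>i. ((\<lambda>r. \<sigma> t s (x + r *\<^sub>R axis i 1)) has_vector_derivative \<sigma>x i t s x) (at 0)) \<and>
          (\<forall>i. ((\<lambda>r. \<sigma>t t s (x + r *\<^sub>R axis i 1)) has_vector_derivative \<sigma>xt i t s x) (at 0))) \<and>
       (\<forall>t\<in>{0..T}. \<forall>s\<in>{0..T}. \<forall>x y.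
          norm (\<sigma> t s x - \<sigma> t s y) + norm (\<sigma>t t s x - \<sigma>t t s y) \<le> K * norm (x - y)) \<and>
       (\<forall>N\<ge>0. \<forall>t\<in>{0..T}. \<forall>s\<in>{0..T}. \<forall>x y. \<forall>i. norm x \<le> N \<longrightarrow> norm y \<le> N \<longrightarrow>
          norm (\<sigma>x i t s x - \<sigma>x i t s y) + norm (\<sigma>xt i t s x - \<sigma>xt i t s y)
            \<le> KN N * norm (x - y) powr \<delta>) \<and>
       (\<forall>t1\<in>{0..T}. \<forall>t2\<in>{0..T}. \<forall>s\<in>{0..T}. \<forall>x. \<forall>i.
          norm (\<sigma> t1 s x - \<sigma> t2 s x) + norm (\<sigma>x i t1 s x - \<sigma>x i t2 s x)
            \<le> K * \<bar>t1 - t2\<bar> powr \<mu>) \<and>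
       (\<forall>t\<in>{0..T}. \<forall>s1\<in>{0..T}. \<forall>s2\<in>{0..T}. \<forall>x.
          norm (\<sigma> t s1 x - \<sigma> t s2 x) + norm (\<sigma>t t s1 x - \<sigma>t t s2 x)
            \<le> K * \<bar>s1 - s2\<bar> powr \<beta>) \<and>
       (\<forall>t\<in>{0..T}. \<forall>s1\<in>{0..T}. \<forall>s2\<in>{0..T}. \<forall>x. \<forall>i.
          norm (\<sigma>xt i t s1 x - \<sigma>xt i t s2 x) + norm (\<sigma>x i t s1 x - \<sigma>x i t s2 x)
            \<le> K * \<bar>s1 - s2\<bar> powr \<beta>))"

end

theory Submission
  imports Defs
begin

text \<open>
  Write \<open>D_t\<close> for the fractional derivative of order \<open>1 - \<alpha>\<close> of \<open>g\<close> from the right at \<open>t\<close>, \<open>D\<close> for that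
  of order \<open>\<alpha>\<close> from the left at \<open>0\<close>, and let \<open>F_t = \<sigma>(t, \<cdot>, f)\<close>. For \<open>s < t\<close> one has, without any
  additivity property of the Zaehle integral,

  \<open>\<integral>\<^sub>0\<^sup>t F_t dg - \<integral>\<^sub>0\<^sup>s F_s dg = - \<integral>\<^sub>s\<^sup>t D F_t D_t - \<integral>\<^sub>0\<^sup>s D F_t (D_t - D_s) - \<integral>\<^sub>0\<^sup>s D (F_t - F_s) D_s\<close>.

  To the left of \<open>s\<close>, the function \<open>D_t - D_s\<close> involves only the increments of \<open>g\<close> from \<open>s\<close> on. Inverting the
  fractional derivative shows that \<open>g\<close> is Hoelder continuous of order \<open>1 - \<alpha>\<close> with a constant controlled by
  \<open>\<Lambda>\<close>, whence \<open>\<bar>D_t - D_s\<bar>(x) \<le> L (t - s)\<^sup>1\<^sup>-\<^sup>\<alpha> (s - x)\<^sup>\<alpha>\<^sup>-\<^sup>1\<close>, which is integrable in \<open>x\<close>. As \<open>\<mu> > 1 - \<alpha>\<close>,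
  also \<open>F_t - F_s\<close> is of order \<open>(t - s)\<^sup>1\<^sup>-\<^sup>\<alpha>\<close>. All norms of the integral are then bounded by explicit integrals
  of power functions, with the factor \<open>exp (\<lambda> x)\<close> for the weighted norms; the power
  \<open>\<lambda>\<^sup>2\<^sup>\<alpha>\<^sup>-\<^sup>1\<close> is the size of \<open>\<integral>\<^sub>0\<^sup>t exp (- \<lambda> (t - x)) x\<^sup>-\<^sup>\<alpha> (t - x)\<^sup>-\<^sup>\<alpha> dx\<close>.
\<close>

subsection \<open>Integrals of power functions\<close>

text \<open>The estimates have to be linear in \<Lambda>, whereas membership in \<open>WT\<close>
  yields another constant \<open>C\<close>. So \<open>C\<close> may serve for integrability and
  limits only, and every quantitative bound on \<open>g\<close> has to be recovered from the bound
  \<open>L\<close> on its fractional derivative; this is why that derivative is inverted. As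
  \<open>L\<close> is uniform, the integrand matters only through the pointwise majorant
  \<open>frac_var\<close> of its derivative. Both parts of the proposition thus become one estimate
  for a family \<open>F t\<close> whose \<open>frac_var\<close> is at most \<open>weight\<close>
  times a number \<open>S\<close>: a multiple of one plus the norm of \<open>f\<close> in the first
  part, of \<open>1 + Delta f + Delta h\<close> times the norm of \<open>f - h\<close> in the
  second. For the latter, differences of the coefficient are compared at four points, with
  derivatives in \<open>x\<close> that are only locally Hoelder. Two features of the spaces need
  care: \<open>WT\<close> leaves the values of \<open>g\<close> at \<open>0\<close> and
  \<open>T\<close> arbitrary, so \<open>g\<close> is replaced by a representative, and
  \<open>Delta\<close> may be infinite, so bounds live in the extended reals.\<close>

abbreviation borel_on :: "real \<Rightarrow> (real \<Rightarrow> 'a::topological_space) set" where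
  "borel_on T \<equiv> borel_measurable (restrict_space borel {0..T})"

abbreviation lborel2 :: "(real \<times> real) measure" where
  "lborel2 \<equiv> lborel \<Otimes>\<^sub>M lborel"

text \<open>The integrands below may be singular at an end point, so the antiderivative is only
  asked to have one-sided limits there; nonnegativity turns the existence of these limits into
  integrability. Exact identities use the Bochner value, majorants the extended nonnegative
  one.\<close>

lemma FTC_open_interval:
  fixes f F :: "real \<Rightarrow> real"
  assumes ab: "a < b"
    and F: "\<And>x. a < x \<Longrightarrow> x < b \<Longrightarrow> (F has_real_derivative f x) (at x)"
    and cont: "\<And>x. a < x \<Longrightarrow> x < b \<Longrightarrow> isCont f x"
    and nonneg: "\<And>x. a < x \<Longrightarrow> x < b \<Longrightarrow> 0 \<le> f x"
    and A: "(F \<longlongrightarrow> A) (at_right a)" and B: "(F \<longlongrightarrow> B) (at_left b)"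
  shows "set_integrable lborel {a<..<b} f"
    and "(LINT x:{a<..<b}|lborel. f x) = B - A"
    and "(\<integral>\<^sup>+x\<in>{a<..<b}. ennreal (f x) \<partial>lborel) = ennreal (B - A)"
proof -
  have *: "set_integrable lborel (einterval (ereal a) (ereal b)) f"
    "(LBINT x=ereal a..ereal b. f x) = B - A"
    by (rule interval_integral_FTC_nonneg[where F = F and f = f and A = A and B = B];
        use assms in \<open>auto simp: ereal_tendsto_simps\<close>)+
  show 1: "set_integrable lborel {a<..<b} f"
    using *(1) by simp
  show 2: "(LINT x:{a<..<b}|lborel. f x) = B - A"
    using *(2) ab by (simp add: interval_lebesgue_integral_def)
  have "(\<integral>\<^sup>+x\<in>{a<..<b}. ennreal (f x) \<partial>lborel)
      = (\<integral>\<^sup>+x. ennreal (indicator {a<..<b} x * f x) \<partial>lborel)"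
    by (intro nn_integral_cong) (auto simp: indicator_def)
  also have "\<dots> = ennreal (LINT x:{a<..<b}|lborel. f x)"
    using 1 nonneg unfolding set_lebesgue_integral_def set_integrable_def real_scaleR_def
    by (intro nn_integral_eq_integral) (auto simp: indicator_def)
  finally show "(\<integral>\<^sup>+x\<in>{a<..<b}. ennreal (f x) \<partial>lborel) = ennreal (B - A)"
    using 2 by simp
qed

lemma integral_powr_left:
  fixes a b p :: real
  assumes "a < b" "0 < p"
  shows "set_integrable lborel {a<..<b} (\<lambda>x. (x - a) powr (p - 1))"
    and "(LINT x:{a<..<b}|lborel. (x - a) powr (p - 1)) = (b - a) powr p / p"
    and "(\<integral>\<^sup>+x\<in>{a<..<b}. ennreal ((x - a) powr (p - 1)) \<partial>lborel) = ennreal ((b - a) powr p / p)"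
proof -
  have A: "((\<lambda>x. (x - a) powr p / p) \<longlongrightarrow> 0) (at_right a)"
    using assms by (auto intro!: tendsto_eq_intros eventually_at_right_less simp: eventually_at_filter)
  have B: "((\<lambda>x. (x - a) powr p / p) \<longlongrightarrow> (b - a) powr p / p) (at_left b)"
    using assms by (auto intro!: tendsto_intros)
  have D: "((\<lambda>x. (x - a) powr p / p) has_real_derivative (x - a) powr (p - 1)) (at x)" if "a < x" for x
    using that assms by (auto intro!: derivative_eq_intros)
  have C: "isCont (\<lambda>x. (x - a) powr (p - 1)) x" if "a < x" for x
    using that by (auto intro!: continuous_intros)
  show "set_integrable lborel {a<..<b} (\<lambda>x. (x - a) powr (p - 1))"
    and "(LINT x:{a<..<b}|lborel. (x - a) powr (p - 1)) = (b - a) powr p / p"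
    and "(\<integral>\<^sup>+x\<in>{a<..<b}. ennreal ((x - a) powr (p - 1)) \<partial>lborel) = ennreal ((b - a) powr p / p)"
    using FTC_open_interval[OF assms(1) D C _ A B] by auto
qed

lemma integral_powr_right:
  fixes a b p :: real
  assumes "a < b" "0 < p"
  shows "set_integrable lborel {a<..<b} (\<lambda>x. (b - x) powr (p - 1))"
    and "(LINT x:{a<..<b}|lborel. (b - x) powr (p - 1)) = (b - a) powr p / p"
    and "(\<integral>\<^sup>+x\<in>{a<..<b}. ennreal ((b - x) powr (p - 1)) \<partial>lborel) = ennreal ((b - a) powr p / p)"
proof -
  have B: "((\<lambda>x. - ((b - x) powr p / p)) \<longlongrightarrow> 0) (at_left b)"
    using assms by (auto intro!: tendsto_eq_intros simp: eventually_at_filter)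
  have A: "((\<lambda>x. - ((b - x) powr p / p)) \<longlongrightarrow> - ((b - a) powr p / p)) (at_right a)"
    using assms by (auto intro!: tendsto_intros)
  have D: "((\<lambda>x. - ((b - x) powr p / p)) has_real_derivative (b - x) powr (p - 1)) (at x)" if "x < b" for x
    using that assms by (auto intro!: derivative_eq_intros)
  have C: "isCont (\<lambda>x. (b - x) powr (p - 1)) x" if "x < b" for x
    using that by (auto intro!: continuous_intros)
  show "set_integrable lborel {a<..<b} (\<lambda>x. (b - x) powr (p - 1))"
    and "(LINT x:{a<..<b}|lborel. (b - x) powr (p - 1)) = (b - a) powr p / p"
    and "(\<integral>\<^sup>+x\<in>{a<..<b}. ennreal ((b - x) powr (p - 1)) \<partial>lborel) = ennreal ((b - a) powr p / p)"
    using FTC_open_interval[OF assms(1) D C _ A B] by auto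
qed

text \<open>The exponent \<open>p - 2\<close> is below \<open>-1\<close>, but the singularity
  \<open>x\<close> lies strictly to the left of the interval.\<close>

lemma integral_powr_shift:
  fixes a b x p :: real
  assumes "x < a" "a < b" "p < 1"
  shows "set_integrable lborel {a<..<b} (\<lambda>y. (y - x) powr (p - 2))"
    and "(LINT y:{a<..<b}|lborel. (y - x) powr (p - 2))
      = ((a - x) powr (p - 1) - (b - x) powr (p - 1)) / (1 - p)"
    and "(\<integral>\<^sup>+y\<in>{a<..<b}. ennreal ((y - x) powr (p - 2)) \<partial>lborel)
      = ennreal (((a - x) powr (p - 1) - (b - x) powr (p - 1)) / (1 - p))"
proof -
  let ?F = "\<lambda>y. - ((y - x) powr (p - 1) / (1 - p))"
  have B: "(?F \<longlongrightarrow> ?F b) (at_left b)" and A: "(?F \<longlongrightarrow> ?F a) (at_right a)"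
    using assms by (auto intro!: tendsto_intros)
  have D: "(?F has_real_derivative (y - x) powr (p - 2)) (at y)" if "a < y" for y
  proof -
    have "((\<lambda>y. (y - x) powr (p - 1)) has_real_derivative (p - 1) * (y - x) powr (p - 2)) (at y)"
      using that assms by (auto intro!: derivative_eq_intros)
    moreover have "- ((p - 1) * (y - x) powr (p - 2) / (1 - p)) = (y - x) powr (p - 2)"
      using assms by (simp add: field_simps)
    ultimately show ?thesis
      using DERIV_minus[OF DERIV_cdivide[of "\<lambda>y. (y - x) powr (p - 1)" _ y UNIV "1 - p"]] by metis
  qed
  have C: "isCont (\<lambda>y. (y - x) powr (p - 2)) y" if "a < y" for y
    using that assms by (auto intro!: continuous_intros)
  have eq: "?F b - ?F a = ((a - x) powr (p - 1) - (b - x) powr (p - 1)) / (1 - p)"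
    by (simp add: diff_divide_distrib)
  show "set_integrable lborel {a<..<b} (\<lambda>y. (y - x) powr (p - 2))"
    and "(LINT y:{a<..<b}|lborel. (y - x) powr (p - 2))
      = ((a - x) powr (p - 1) - (b - x) powr (p - 1)) / (1 - p)"
    and "(\<integral>\<^sup>+y\<in>{a<..<b}. ennreal ((y - x) powr (p - 2)) \<partial>lborel)
      = ennreal (((a - x) powr (p - 1) - (b - x) powr (p - 1)) / (1 - p))"
    using FTC_open_interval[OF assms(2) D C _ A B] unfolding eq by auto
qed

lemma nn_integral_powr_tail:
  fixes t x p :: real
  assumes "0 \<le> x" "x < t" "0 < p"
  shows "(\<integral>\<^sup>+s\<in>{0<..<x}. ennreal ((t - s) powr (- p - 1)) \<partial>lborel) \<le> ennreal ((t - x) powr (- p) / p)"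
proof (cases "x = 0")
  case False
  with assms have x: "0 < x" by simp
  let ?F = "\<lambda>s. (t - s) powr (- p) / p"
  have B: "(?F \<longlongrightarrow> ?F x) (at_left x)" and A: "(?F \<longlongrightarrow> ?F 0) (at_right 0)"
    using assms by (auto intro!: tendsto_eq_intros)
  have D: "(?F has_real_derivative (t - s) powr (- p - 1)) (at s)" if "s < x" for s
    using that assms by (auto intro!: derivative_eq_intros)
  have C: "isCont (\<lambda>s. (t - s) powr (- p - 1)) s" if "s < x" for s
    using that assms by (auto intro!: continuous_intros)
  have "(\<integral>\<^sup>+s\<in>{0<..<x}. ennreal ((t - s) powr (- p - 1)) \<partial>lborel) = ennreal (?F x - ?F 0)"
    using FTC_open_interval(3)[OF x D C _ A B] by auto
  also have "\<dots> \<le> ennreal ((t - x) powr (- p) / p)"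
    using assms by (intro ennreal_leI) auto
  finally show ?thesis .
qed (use assms in simp)

text \<open>The exponents add up to \<open>-2\<close>: with \<open>u = (x - s) / (Y - x)\<close> the
  integrand becomes \<open>u powr (- \<alpha>) / (Y - s)\<close>, so the antiderivative is
  elementary. The lemma is meant for \<open>Y = z + e\<close>, the kernel shifted by
  \<open>e > 0\<close>.\<close>

lemma integral_powr_regularised:
  fixes s z Y \<alpha> :: real
  assumes "s < z" "z < Y" "0 < \<alpha>" "\<alpha> < 1"
  shows "set_integrable lborel {s<..<z} (\<lambda>x. (x - s) powr (- \<alpha>) * (Y - x) powr (\<alpha> - 2))"
    and "(LINT x:{s<..<z}|lborel. (x - s) powr (- \<alpha>) * (Y - x) powr (\<alpha> - 2))
      = (z - s) powr (1 - \<alpha>) * (Y - z) powr (\<alpha> - 1) / ((1 - \<alpha>) * (Y - s))"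
proof -
  let ?F = "\<lambda>x. (x - s) powr (1 - \<alpha>) * (Y - x) powr (\<alpha> - 1) / ((1 - \<alpha>) * (Y - s))"
  have A: "(?F \<longlongrightarrow> 0) (at_right s)"
    using assms by (auto intro!: tendsto_eq_intros simp: eventually_at_filter)
  have B: "(?F \<longlongrightarrow> ?F z) (at_left z)"
    using assms by (auto intro!: tendsto_intros)
  have D: "(?F has_real_derivative (x - s) powr (- \<alpha>) * (Y - x) powr (\<alpha> - 2)) (at x)"
    if "s < x" "x < z" for x
  proof -
    have 1: "(x - s) powr (1 - \<alpha>) = (x - s) * (x - s) powr (- \<alpha>)"
      using that powr_mult_base[of "x - s" "- \<alpha>"] by simp
    have 2: "(Y - x) powr (\<alpha> - 1) = (Y - x) * (Y - x) powr (\<alpha> - 2)"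
      using that assms powr_mult_base[of "Y - x" "\<alpha> - 2"] by simp
    define P Q where "P = (x - s) powr (- \<alpha>)" and "Q = (Y - x) powr (\<alpha> - 2)"
    have "((1 - \<alpha>) * P * ((Y - x) * Q) + (x - s) * P * (- (\<alpha> - 1) * Q)) / ((1 - \<alpha>) * (Y - s))
        = ((1 - \<alpha>) * (Y - s) * (P * Q)) / ((1 - \<alpha>) * (Y - s))"
      by (rule arg_cong[where f = "\<lambda>u. u / _"]) (simp add: algebra_simps)
    also have "\<dots> = P * Q" using assms by simp
    finally have eq: "((1 - \<alpha>) * P * ((Y - x) * Q) + (x - s) * P * (- (\<alpha> - 1) * Q)) / ((1 - \<alpha>) * (Y - s)) = P * Q" .
    have "(?F has_real_derivative ((1 - \<alpha>) * (x - s) powr (- \<alpha>) * (Y - x) powr (\<alpha> - 1) +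
        (x - s) powr (1 - \<alpha>) * (- (\<alpha> - 1) * (Y - x) powr (\<alpha> - 2))) / ((1 - \<alpha>) * (Y - s))) (at x)"
      using that assms by (auto intro!: derivative_eq_intros) (simp add: algebra_simps)
    then show ?thesis unfolding 1 2 P_def[symmetric] Q_def[symmetric] eq .
  qed
  have C: "isCont (\<lambda>x. (x - s) powr (- \<alpha>) * (Y - x) powr (\<alpha> - 2)) x" if "s < x" "x < z" for x
    using that assms by (auto intro!: continuous_intros)
  show "set_integrable lborel {s<..<z} (\<lambda>x. (x - s) powr (- \<alpha>) * (Y - x) powr (\<alpha> - 2))"
    and "(LINT x:{s<..<z}|lborel. (x - s) powr (- \<alpha>) * (Y - x) powr (\<alpha> - 2)) = ?F z"
    using FTC_open_interval[OF assms(1) D C _ A B] by auto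
qed

lemma ennreal_mult_add_mult:
  "0 \<le> u \<Longrightarrow> 0 \<le> v \<Longrightarrow> 0 \<le> w \<Longrightarrow> 0 \<le> z
    \<Longrightarrow> ennreal (u * v + w * z) = ennreal u * ennreal v + ennreal w * ennreal z"
  by (simp add: ennreal_mult)

text \<open>A crude Beta integral. On the half next to one end, the factor singular at the other end
  is at most its value at the half-length \<open>H\<close>, both exponents being nonpositive; the
  remaining factor is integrated exactly over the whole interval. The factor 2 bounds
  \<open>2 powr (1 - r)\<close>.\<close>

lemma nn_integral_beta_le:
  fixes a b p q :: real
  assumes "a \<le> b" "0 < p" "p \<le> 1" "0 < q" "q \<le> 1"
  shows "(\<integral>\<^sup>+s\<in>{a<..<b}. ennreal ((s - a) powr (p - 1) * (b - s) powr (q - 1)) \<partial>lborel)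
    \<le> ennreal (2 * (1 / p + 1 / q) * (b - a) powr (p + q - 1))"
proof (cases "a < b")
  case True
  define H where "H = (b - a) / 2"
  have H: "0 < H" using True by (simp add: H_def)
  have half: "H powr (r - 1) \<le> 2 * (b - a) powr (r - 1)" if "0 < r" "r \<le> 1" for r
  proof -
    have "H powr (r - 1) = 2 powr (1 - r) * (b - a) powr (r - 1)"
      using True by (simp add: H_def powr_divide powr_diff)
    also have "2 powr (1 - r) \<le> 2 powr 1" by (rule powr_mono) (use that in auto)
    finally show ?thesis by (simp add: mult_right_mono)
  qed
  have pt: "(s - a) powr (p - 1) * (b - s) powr (q - 1)
      \<le> H powr (q - 1) * (s - a) powr (p - 1) + H powr (p - 1) * (b - s) powr (q - 1)"
    if s: "a < s" "s < b" for s
  proof (cases "H \<le> b - s")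
    case True
    have "(b - s) powr (q - 1) \<le> H powr (q - 1)"
      by (rule powr_mono2') (use True H assms in auto)
    then have "(s - a) powr (p - 1) * (b - s) powr (q - 1) \<le> (s - a) powr (p - 1) * H powr (q - 1)"
      by (intro mult_left_mono) auto
    then show ?thesis by (simp add: mult.commute add_increasing2)
  next
    case False
    have "H \<le> s - a" using False by (simp add: H_def field_simps)
    then have "(s - a) powr (p - 1) \<le> H powr (p - 1)"
      by (intro powr_mono2') (use H assms in auto)
    then have "(s - a) powr (p - 1) * (b - s) powr (q - 1) \<le> H powr (p - 1) * (b - s) powr (q - 1)"
      by (intro mult_right_mono) auto
    then show ?thesis by (simp add: mult.commute add_increasing)
  qed
  have "(\<integral>\<^sup>+s\<in>{a<..<b}. ennreal ((s - a) powr (p - 1) * (b - s) powr (q - 1)) \<partial>lborel)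
      \<le> (\<integral>\<^sup>+s. ennreal (H powr (q - 1)) * (ennreal ((s - a) powr (p - 1)) * indicator {a<..<b} s)
          + ennreal (H powr (p - 1)) * (ennreal ((b - s) powr (q - 1)) * indicator {a<..<b} s) \<partial>lborel)"
    by (intro nn_integral_mono)
       (auto simp: indicator_def ennreal_plus[symmetric] ennreal_mult[symmetric] simp del: ennreal_plus
         intro!: ennreal_leI pt)
  also have "\<dots> = ennreal (H powr (q - 1)) * ennreal ((b - a) powr p / p)
      + ennreal (H powr (p - 1)) * ennreal ((b - a) powr q / q)"
    by (subst nn_integral_add, simp, simp, subst nn_integral_cmult, simp, subst nn_integral_cmult, simp)
       (simp add: integral_powr_left(3)[OF True] integral_powr_right(3)[OF True] assms)
  also have "\<dots> = ennreal (H powr (q - 1) * ((b - a) powr p / p) + H powr (p - 1) * ((b - a) powr q / q))"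
    using assms by (intro ennreal_mult_add_mult[symmetric]) auto
  also have "\<dots> \<le> ennreal (2 * (1 / p + 1 / q) * (b - a) powr (p + q - 1))"
  proof (rule ennreal_leI)
    have "H powr (q - 1) * ((b - a) powr p / p) + H powr (p - 1) * ((b - a) powr q / q)
      \<le> (2 * (b - a) powr (q - 1)) * ((b - a) powr p / p) + (2 * (b - a) powr (p - 1)) * ((b - a) powr q / q)"
      using assms half by (intro add_mono mult_right_mono) auto
    also have "\<dots> = 2 / p * ((b - a) powr (q - 1) * (b - a) powr p) + 2 / q * ((b - a) powr (p - 1) * (b - a) powr q)"
      by simp
    also have "\<dots> = 2 * (1 / p + 1 / q) * (b - a) powr (p + q - 1)"
      by (simp add: powr_add[symmetric] algebra_simps)
    finally show "H powr (q - 1) * ((b - a) powr p / p) + H powr (p - 1) * ((b - a) powr q / q)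
      \<le> 2 * (1 / p + 1 / q) * (b - a) powr (p + q - 1)" .
  qed
  finally show ?thesis .
qed (use assms in simp)

text \<open>The product of the two powers is at most the sum of their squares, which leaves
  \<open>u powr (- 2 * \<alpha>)\<close> with \<open>u = x\<close> or \<open>u = t - x\<close>. Cut
  at \<open>u = 1 / l\<close>: below, the exponential is dropped and the power, integrable as
  \<alpha> < 1/2, contributes \<open>l powr (2 * \<alpha> - 1) / (1 - 2 * \<alpha>)\<close>; above,
  the power is at most \<open>l powr (2 * \<alpha>)\<close> and the exponential integrates to at
  most \<open>1 / l\<close>.\<close>

lemma nn_integral_exp_kernel_le:
  fixes l t \<alpha> :: real
  assumes l: "1 \<le> l" and \<alpha>: "0 < \<alpha>" "\<alpha> < 1 / 2"
  shows "(\<integral>\<^sup>+x\<in>{0<..<t}. ennreal (exp (- l * (t - x)) * x powr (- \<alpha>) * (t - x) powr (- \<alpha>)) \<partial>lborel)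
    \<le> ennreal (2 * (1 + 1 / (1 - 2 * \<alpha>)) * l powr (2 * \<alpha> - 1))"
proof (cases "0 < t")
  case True
  let ?i = "\<lambda>x. ennreal (x powr ((1 - 2 * \<alpha>) - 1)) * indicator {0<..<1 / l} x"
  let ?j = "\<lambda>x. ennreal ((t - x) powr ((1 - 2 * \<alpha>) - 1)) * indicator {t - 1 / l<..<t} x"
  let ?k = "\<lambda>x. ennreal (exp (- l * (t - x))) * indicator {0<..<t} x"
  have l0: "0 < l" using l by simp
  have *: "exp (- l * (t - x)) * u powr (- 2 * \<alpha>)
      \<le> u powr (- 2 * \<alpha>) * indicator {0<..<1 / l} u + l powr (2 * \<alpha>) * exp (- l * (t - x))"
    if "0 < u" "x < t" for u x
  proof (cases "u < 1 / l")
    case True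
    have "exp (- l * (t - x)) \<le> 1" using l0 that by simp
    then have "exp (- l * (t - x)) * u powr (- 2 * \<alpha>) \<le> 1 * u powr (- 2 * \<alpha>)"
      by (intro mult_right_mono) auto
    then show ?thesis using True that by (simp add: add_increasing2)
  next
    case False
    have "u powr (- 2 * \<alpha>) \<le> (1 / l) powr (- 2 * \<alpha>)"
      by (rule powr_mono2') (use False l0 that \<alpha> in auto)
    also have "\<dots> = l powr (2 * \<alpha>)"
      proof -
      have "(1 / l) powr (- 2 * \<alpha>) = 1 / l powr (- 2 * \<alpha>)"
        using l0 by (simp add: powr_divide)
      also have "\<dots> = l powr (- (- 2 * \<alpha>))" by (simp only: powr_minus_divide)
      finally show ?thesis by simp
    qed
    finally have "exp (- l * (t - x)) * u powr (- 2 * \<alpha>) \<le> exp (- l * (t - x)) * l powr (2 * \<alpha>)"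
      by (intro mult_left_mono) auto
    then show ?thesis using False by (simp add: mult.commute)
  qed
  have pt: "ennreal (exp (- l * (t - x)) * x powr (- \<alpha>) * (t - x) powr (- \<alpha>)) * indicator {0<..<t} x
      \<le> ?i x + ?j x + ennreal (2 * l powr (2 * \<alpha>)) * ?k x" for x
  proof (cases "x \<in> {0<..<t}")
    case x: True
    have "x powr (- \<alpha>) * (t - x) powr (- \<alpha>) \<le> (x powr (- \<alpha>))\<^sup>2 + ((t - x) powr (- \<alpha>))\<^sup>2"
      using sum_squares_bound[of "x powr (- \<alpha>)" "(t - x) powr (- \<alpha>)"]
        mult_nonneg_nonneg[OF powr_ge_zero powr_ge_zero, of x "- \<alpha>" "t - x" "- \<alpha>"]
      by linarith
    also have "\<dots> = x powr (- 2 * \<alpha>) + (t - x) powr (- 2 * \<alpha>)"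
      by (simp add: power2_eq_square powr_add[symmetric])
    finally have "exp (- l * (t - x)) * (x powr (- \<alpha>) * (t - x) powr (- \<alpha>))
        \<le> exp (- l * (t - x)) * (x powr (- 2 * \<alpha>) + (t - x) powr (- 2 * \<alpha>))"
      by (intro mult_left_mono) auto
    also have "\<dots> \<le> x powr (- 2 * \<alpha>) * indicator {0<..<1 / l} x
        + (t - x) powr (- 2 * \<alpha>) * indicator {0<..<1 / l} (t - x) + 2 * l powr (2 * \<alpha>) * exp (- l * (t - x))"
      using *[of x x] *[of "t - x" x] x by (simp add: algebra_simps)
    finally have "ennreal (exp (- l * (t - x)) * x powr (- \<alpha>) * (t - x) powr (- \<alpha>))
      \<le> ennreal (x powr (- 2 * \<alpha>) * indicator {0<..<1 / l} x
        + (t - x) powr (- 2 * \<alpha>) * indicator {0<..<1 / l} (t - x) + 2 * l powr (2 * \<alpha>) * exp (- l * (t - x)))"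
      by (intro ennreal_leI) (simp add: mult.assoc)
    also have "\<dots> = ?i x + ?j x + ennreal (2 * l powr (2 * \<alpha>)) * ?k x"
      using x l0 by (subst ennreal_plus, simp, simp, subst ennreal_plus)
        (auto simp: ennreal_mult indicator_def mult.assoc)
    finally show ?thesis using x by simp
  qed simp
  have inv: "(1 / l) powr (1 - 2 * \<alpha>) = l powr (2 * \<alpha> - 1)"
  proof -
    have "(1 / l) powr (1 - 2 * \<alpha>) = 1 / l powr (1 - 2 * \<alpha>)"
      using l0 by (simp add: powr_divide)
    also have "\<dots> = l powr (- (1 - 2 * \<alpha>))" by (simp only: powr_minus_divide)
    finally show ?thesis by simp
  qed
  have I: "(\<integral>\<^sup>+x. ?i x \<partial>lborel) = ennreal (l powr (2 * \<alpha> - 1) / (1 - 2 * \<alpha>))"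
    using integral_powr_left(3)[of 0 "1 / l" "1 - 2 * \<alpha>"] l0 \<alpha> inv
    by simp
  have J: "(\<integral>\<^sup>+x. ?j x \<partial>lborel) = ennreal (l powr (2 * \<alpha> - 1) / (1 - 2 * \<alpha>))"
    using integral_powr_right(3)[of "t - 1 / l" t "1 - 2 * \<alpha>"] l0 \<alpha> inv
    by simp
  have K: "(\<integral>\<^sup>+x. ?k x \<partial>lborel) \<le> ennreal (1 / l)"
  proof -
    let ?F = "\<lambda>x. exp (- l * (t - x)) / l"
    have B: "(?F \<longlongrightarrow> ?F t) (at_left t)" and A: "(?F \<longlongrightarrow> ?F 0) (at_right 0)"
      using l0 by (auto intro!: tendsto_eq_intros)
    have D: "(?F has_real_derivative exp (- l * (t - x))) (at x)" for x
      using l0 by (auto intro!: derivative_eq_intros)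
    have C: "isCont (\<lambda>x. exp (- l * (t - x))) x" for x
      by (auto intro!: continuous_intros)
    have "(\<integral>\<^sup>+x. ?k x \<partial>lborel) = ennreal (?F t - ?F 0)"
      using FTC_open_interval(3)[OF True D C _ A B] by auto
    also have "\<dots> \<le> ennreal (1 / l)" using l0 by (intro ennreal_leI) auto
    finally show ?thesis .
  qed
  have "(\<integral>\<^sup>+x\<in>{0<..<t}. ennreal (exp (- l * (t - x)) * x powr (- \<alpha>) * (t - x) powr (- \<alpha>)) \<partial>lborel)
      \<le> (\<integral>\<^sup>+x. ?i x + ?j x + ennreal (2 * l powr (2 * \<alpha>)) * ?k x \<partial>lborel)"
    by (intro nn_integral_mono pt)
  also have "\<dots> = (\<integral>\<^sup>+x. ?i x \<partial>lborel) + (\<integral>\<^sup>+x. ?j x \<partial>lborel) + ennreal (2 * l powr (2 * \<alpha>)) * (\<integral>\<^sup>+x. ?k x \<partial>lborel)"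
    by (simp add: nn_integral_add nn_integral_cmult)
  also have "\<dots> \<le> ennreal (l powr (2 * \<alpha> - 1) / (1 - 2 * \<alpha>)) + ennreal (l powr (2 * \<alpha> - 1) / (1 - 2 * \<alpha>))
      + ennreal (2 * l powr (2 * \<alpha>)) * ennreal (1 / l)"
    unfolding I J by (intro add_left_mono mult_left_mono K) auto
  also have "\<dots> = ennreal (l powr (2 * \<alpha> - 1) / (1 - 2 * \<alpha>) + l powr (2 * \<alpha> - 1) / (1 - 2 * \<alpha>)
      + 2 * l powr (2 * \<alpha>) * (1 / l))"
  proof -
    have "ennreal a + ennreal a + ennreal b * ennreal c = ennreal (a + a + b * c)"
      if "0 \<le> a" "0 \<le> b" "0 \<le> c" for a b c
      using that by (simp only: ennreal_plus ennreal_mult add_nonneg_nonneg mult_nonneg_nonneg)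
    then show ?thesis using l0 \<alpha> by simp
  qed
  also have "l powr (2 * \<alpha> - 1) / (1 - 2 * \<alpha>) + l powr (2 * \<alpha> - 1) / (1 - 2 * \<alpha>)
      + 2 * l powr (2 * \<alpha>) * (1 / l) = 2 * (1 + 1 / (1 - 2 * \<alpha>)) * l powr (2 * \<alpha> - 1)"
  proof -
    have "l powr (2 * \<alpha>) * (1 / l) = l powr (2 * \<alpha> - 1)"
      using l0 by (simp add: powr_diff)
    then show ?thesis by (simp add: algebra_simps)
  qed
  finally show ?thesis .
qed simp

subsection \<open>Fractional derivatives of the integrator\<close>

text \<open>\<open>Gamma \<alpha>\<close> times the fractional derivative from the right at
  \<open>t\<close>, with \<open>g t\<close> in place of the left limit.\<close>

definition frac_kernel :: "real \<Rightarrow> (real \<Rightarrow> real) \<Rightarrow> real \<Rightarrow> real \<Rightarrow> real" where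
  "frac_kernel \<alpha> g t x = (g x - g t) * (t - x) powr (\<alpha> - 1)
     + (1 - \<alpha>) * (LINT y:{x<..<t}|lborel. (g x - g y) * (y - x) powr (\<alpha> - 2))"

text \<open>The constants play different roles: \<open>C\<close> secures integrability and
  convergence, while \<open>L\<close>, the bound on the fractional derivative, is the one that
  appears in the resulting estimates. The end point \<open>t = T\<close> is included, although the
  supremum in \<Lambda> runs over \<open>t < T\<close>.\<close>

locale frac_integrator =
  fixes T \<alpha> C L :: real and g :: "real \<Rightarrow> real"
  assumes alpha: "0 < \<alpha>" "\<alpha> < 1 / 2"
    and C_nonneg: "0 \<le> C"
    and g_measurable [measurable]: "g \<in> borel_measurable borel"
    and g_holder: "\<And>s t. 0 < s \<Longrightarrow> s < t \<Longrightarrow> t \<le> T \<Longrightarrow> \<bar>g t - g s\<bar> \<le> C * (t - s) powr (1 - \<alpha>)"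
    and g_var: "\<And>s t. 0 < s \<Longrightarrow> s < t \<Longrightarrow> t \<le> T \<Longrightarrow>
      (\<integral>\<^sup>+y\<in>{s<..<t}. ennreal (\<bar>g s - g y\<bar> * (y - s) powr (\<alpha> - 2)) \<partial>lborel) \<le> ennreal C"
    and kernel_bound: "\<And>s t. 0 < s \<Longrightarrow> s < t \<Longrightarrow> t \<le> T \<Longrightarrow> \<bar>frac_kernel \<alpha> g t s\<bar> \<le> L"
begin

lemma g_var_integrable:
  assumes "0 < s" "s < t" "t \<le> T"
  shows "set_integrable lborel {s<..<t} (\<lambda>y. (g s - g y) * (y - s) powr (\<alpha> - 2))"
  unfolding set_integrable_def
proof (rule integrableI_bounded)
  have "(\<integral>\<^sup>+y. ennreal (norm (indicator {s<..<t} y *\<^sub>R ((g s - g y) * (y - s) powr (\<alpha> - 2)))) \<partial>lborel)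
      = (\<integral>\<^sup>+y\<in>{s<..<t}. ennreal (\<bar>g s - g y\<bar> * (y - s) powr (\<alpha> - 2)) \<partial>lborel)"
    by (intro nn_integral_cong) (auto simp: indicator_def abs_mult)
  also have "\<dots> \<le> ennreal C" by (rule g_var[OF assms])
  finally show "(\<integral>\<^sup>+y. ennreal (norm (indicator {s<..<t} y *\<^sub>R ((g s - g y) * (y - s) powr (\<alpha> - 2)))) \<partial>lborel) < \<infinity>"
    by (rule le_less_trans) simp
qed measurable

text \<open>
  The aim of this context is the inversion formula for the fractional derivative. The kernel
  \<open>(z - x) powr (\<alpha> - 2)\<close> is not integrable near the diagonal, so that the two terms of \<open>h x - h z\<close>
  can be separated only after shifting its argument by \<open>e > 0\<close>. For the shifted kernel both inner
  integrals have closed forms, and their leading parts cancel as \<open>e\<close> tends to \<open>0\<close>.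
\<close>

context
  fixes s t :: real
  assumes st: "0 < s" "s < t" "t \<le> T"
begin

abbreviation (input) "h x \<equiv> g x - g s"
abbreviation (input) "phi x \<equiv> (x - s) powr (- \<alpha>)"
abbreviation (input) "eps n \<equiv> inverse (real (Suc n))"
abbreviation (input) "ker e \<equiv> (\<lambda>(x, z). (if s < x \<and> x < z \<and> z < t then 1 else 0)
   * (phi x * (h x - h z) * (z - x + e) powr (\<alpha> - 2)))"

lemma h_bound: "s < x \<Longrightarrow> x < t \<Longrightarrow> \<bar>h x\<bar> \<le> C * (x - s) powr (1 - \<alpha>)"
  using g_holder[of s x] st by simp

lemma h_bound': "s < x \<Longrightarrow> x < t \<Longrightarrow> \<bar>h x\<bar> \<le> C * (t - s) powr (1 - \<alpha>)"
  using C_nonneg alpha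
  by (intro order_trans[OF h_bound] mult_left_mono powr_mono2) auto

lemma nn_integral_phi: "(\<integral>\<^sup>+x\<in>{s<..<t}. ennreal (phi x) \<partial>lborel) = ennreal ((t - s) powr (1 - \<alpha>) / (1 - \<alpha>))"
  using integral_powr_left(3)[of s t "1 - \<alpha>"] st alpha by simp

lemma phi_integrable: "integrable lborel (\<lambda>x. indicator {s<..<t} x * phi x)"
  using integral_powr_left(1)[of s t "1 - \<alpha>"] st alpha by (simp add: set_integrable_def)

lemma ker_measurable [measurable]: "ker e \<in> borel_measurable (lborel2)"
  by measurable

text \<open>With \<open>z\<close> innermost, \<open>g_var\<close> bounds the inner integral by
  \<open>C\<close> for every \<open>x\<close>, despite the singularity on the diagonal; the
  integrable factor \<open>phi\<close> remains.\<close>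

lemma ker0_integrable: "integrable (lborel2) (ker 0)"
proof (rule integrableI_bounded)
  have "(\<integral>\<^sup>+p. ennreal (norm (ker 0 p)) \<partial>(lborel2))
      = (\<integral>\<^sup>+x. \<integral>\<^sup>+z. ennreal (norm (ker 0 (x, z))) \<partial>lborel \<partial>lborel)"
    by (subst lborel.nn_integral_fst[symmetric]) (simp_all add: case_prod_beta)
  also have "\<dots> \<le> (\<integral>\<^sup>+x. ennreal C * (ennreal (phi x) * indicator {s<..<t} x) \<partial>lborel)"
  proof (rule nn_integral_mono)
    fix x :: real
    show "(\<integral>\<^sup>+z. ennreal (norm (ker 0 (x, z))) \<partial>lborel) \<le> ennreal C * (ennreal (phi x) * indicator {s<..<t} x)"
    proof (cases "s < x \<and> x < t")
      case True
      have "(\<integral>\<^sup>+z. ennreal (norm (ker 0 (x, z))) \<partial>lborel)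
          = (\<integral>\<^sup>+z. ennreal (phi x) * (ennreal (\<bar>g x - g z\<bar> * (z - x) powr (\<alpha> - 2)) * indicator {x<..<t} z) \<partial>lborel)"
        using True by (intro nn_integral_cong) (auto simp: indicator_def abs_mult ennreal_mult mult.assoc)
      also have "\<dots> = ennreal (phi x) * (\<integral>\<^sup>+z\<in>{x<..<t}. ennreal (\<bar>g x - g z\<bar> * (z - x) powr (\<alpha> - 2)) \<partial>lborel)"
        by (rule nn_integral_cmult) measurable
      also have "\<dots> \<le> ennreal (phi x) * ennreal C"
        using True st by (intro mult_left_mono g_var) auto
      finally show ?thesis using True by (simp add: mult.commute)
    next
      case False
      then have "ker 0 (x, z) = 0" for z by auto
      then show ?thesis by (simp only:) simp
    qed
  qed
  also have "\<dots> = ennreal C * ennreal ((t - s) powr (1 - \<alpha>) / (1 - \<alpha>))"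
    by (subst nn_integral_cmult, measurable) (simp add: nn_integral_phi)
  also have "\<dots> < \<infinity>" by (simp add: ennreal_mult_less_top)
  finally show "(\<integral>\<^sup>+p. ennreal (norm (ker 0 p)) \<partial>(lborel2)) < \<infinity>" .
qed measurable

text \<open>The shift enlarges the base of a negative power, so \<open>ker 0\<close> itself
  dominates.\<close>

lemma ker_tendsto:
  "(\<lambda>n. integral\<^sup>L (lborel2) (ker (eps n))) \<longlonglongrightarrow> integral\<^sup>L (lborel2) (ker 0)"
proof (rule integral_dominated_convergence[where w = "\<lambda>p. norm (ker 0 p)"])
  show "integrable (lborel2) (\<lambda>p. norm (ker 0 p))"
    using ker0_integrable by (rule integrable_norm)
  show "AE p in lborel2. (\<lambda>n. ker (eps n) p) \<longlonglongrightarrow> ker 0 p"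
  proof (rule AE_I2)
    fix p :: "real \<times> real"
    obtain x z where p: "p = (x, z)" by (cases p)
    show "(\<lambda>n. ker (eps n) p) \<longlonglongrightarrow> ker 0 p"
    proof (cases "x < z")
      case True
      have "(\<lambda>n. (z - x + eps n) powr (\<alpha> - 2)) \<longlonglongrightarrow> (z - x + 0) powr (\<alpha> - 2)"
        using True by (intro tendsto_powr tendsto_add tendsto_const LIMSEQ_inverse_real_of_nat) auto
      then show ?thesis unfolding p prod.case by (intro tendsto_mult tendsto_const)
    qed (simp add: p)
  qed
  fix n
  show "AE p in lborel2. norm (ker (eps n) p) \<le> norm (ker 0 p)"
  proof (rule AE_I2)
    fix p :: "real \<times> real"
    obtain x z where p: "p = (x, z)" by (cases p)
    show "norm (ker (eps n) p) \<le> norm (ker 0 p)"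
    proof (cases "x < z")
      case True
      have "(z - x + eps n) powr (\<alpha> - 2) \<le> (z - x + 0) powr (\<alpha> - 2)"
        using True alpha by (intro powr_mono2') auto
      then show ?thesis unfolding p prod.case by (auto simp: abs_mult intro!: mult_left_mono)
    qed (simp add: p)
  qed
qed measurable

text \<open>For \<open>e > 0\<close> the kernel is bounded by \<open>e powr (\<alpha> - 2)\<close>,
  and so each of the two terms of \<open>h x - h z\<close> is integrable on its own. The constant
  blows up as \<open>e\<close> tends to \<open>0\<close>, which is harmless: it only licenses Fubini
  for fixed \<open>e\<close>.\<close>

lemma ker_part_integrable:
  assumes e: "0 < e" and k: "k = (\<lambda>x z. h x) \<or> k = (\<lambda>x z. h z)"
  shows "integrable (lborel2) (\<lambda>(x, z). (if s < x \<and> x < z \<and> z < t then 1 else 0)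
     * (phi x * k x z * (z - x + e) powr (\<alpha> - 2)))" (is "integrable _ ?f")
proof (rule integrableI_bounded)
  define c where "c = C * (t - s) powr (1 - \<alpha>) * e powr (\<alpha> - 2)"
  have c: "0 \<le> c" using C_nonneg by (simp add: c_def)
  have [measurable]: "(\<lambda>p. k (fst p) (snd p)) \<in> borel_measurable (lborel2)"
    using k by (elim disjE) simp_all
  show m: "?f \<in> borel_measurable (lborel2)"
    unfolding case_prod_beta by measurable
  have le: "ennreal (norm (?f (x, z))) \<le> ennreal c * (ennreal (phi x) * indicator {s<..<t} x) * indicator {s<..<t} z" for x z
  proof (cases "s < x \<and> x < z \<and> z < t")
    case True
    have "\<bar>k x z\<bar> \<le> C * (t - s) powr (1 - \<alpha>)"
      using k h_bound'[of x] h_bound'[of z] True by auto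
    moreover have "(z - x + e) powr (\<alpha> - 2) \<le> e powr (\<alpha> - 2)"
      using True alpha e by (intro powr_mono2') auto
    ultimately have "\<bar>k x z\<bar> * (z - x + e) powr (\<alpha> - 2) \<le> c"
      unfolding c_def using C_nonneg by (intro mult_mono) auto
    then have "phi x * (\<bar>k x z\<bar> * (z - x + e) powr (\<alpha> - 2)) \<le> phi x * c"
      by (intro mult_left_mono) auto
    then have "norm (?f (x, z)) \<le> c * phi x"
      using True by (simp add: abs_mult mult_ac)
    then show ?thesis using True c by (simp add: ennreal_mult[symmetric] ennreal_leI)
  qed (auto simp: indicator_def)
  have "(\<integral>\<^sup>+p. ennreal (norm (?f p)) \<partial>(lborel2))
      = (\<integral>\<^sup>+x. \<integral>\<^sup>+z. ennreal (norm (?f (x, z))) \<partial>lborel \<partial>lborel)"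
    using m by (subst lborel.nn_integral_fst[symmetric]) simp_all
  also have "\<dots> \<le> (\<integral>\<^sup>+x. \<integral>\<^sup>+z. ennreal c * (ennreal (phi x) * indicator {s<..<t} x) * indicator {s<..<t} z \<partial>lborel \<partial>lborel)"
    by (intro nn_integral_mono le)
  also have "\<dots> = ennreal c * ennreal ((t - s) powr (1 - \<alpha>) / (1 - \<alpha>)) * ennreal (t - s)"
    using st by (simp add: nn_integral_cmult nn_integral_multc nn_integral_phi)
  also have "\<dots> < \<infinity>" by (simp add: ennreal_mult_less_top)
  finally show "(\<integral>\<^sup>+p. ennreal (norm (?f p)) \<partial>(lborel2)) < \<infinity>" .
qed

text \<open>The term with \<open>h x\<close> is integrated in \<open>z\<close> first, the term with
  \<open>h z\<close> in \<open>x\<close> first, so that each time \<open>h\<close> comes out of the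
  inner integral. Both results contain \<open>e powr (\<alpha> - 1)\<close>, multiplied by
  \<open>1\<close> and by \<open>(x - s) / (x - s + e)\<close>; the difference is
  \<open>e powr \<alpha> / (x - s + e)\<close>.\<close>

lemma ker_integral:
  assumes e: "0 < e"
  shows "(1 - \<alpha>) * integral\<^sup>L (lborel2) (ker e)
    = (LINT x:{s<..<t}|lborel. h x * phi x * (e powr \<alpha> / (x - s + e)) - h x * phi x * (t - x + e) powr (\<alpha> - 1))"
proof -
  let ?A = "\<lambda>(x, z). (if s < x \<and> x < z \<and> z < t then 1 else 0) * (phi x * h x * (z - x + e) powr (\<alpha> - 2))"
  let ?B = "\<lambda>(x, z). (if s < x \<and> x < z \<and> z < t then 1 else 0) * (phi x * h z * (z - x + e) powr (\<alpha> - 2))"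
  let ?a = "\<lambda>x. indicator {s<..<t} x * (phi x * h x * ((e powr (\<alpha> - 1) - (t - x + e) powr (\<alpha> - 1)) / (1 - \<alpha>)))"
  let ?b = "\<lambda>z. indicator {s<..<t} z * (h z * ((z - s) powr (1 - \<alpha>) * e powr (\<alpha> - 1) / ((1 - \<alpha>) * (z - s + e))))"
  have A: "integrable (lborel2) ?A" and B: "integrable (lborel2) ?B"
    using ker_part_integrable[OF e, of "\<lambda>x z. h x"] ker_part_integrable[OF e, of "\<lambda>x z. h z"] by simp_all
  have a: "(\<integral>z. ?A (x, z) \<partial>lborel) = ?a x" for x
  proof (cases "s < x \<and> x < t")
    case True
    have "(\<integral>z. ?A (x, z) \<partial>lborel) = (\<integral>z. (phi x * h x) * (indicator {x<..<t} z * (z - (x - e)) powr (\<alpha> - 2)) \<partial>lborel)"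
      using True by (intro Bochner_Integration.integral_cong) (auto simp: indicator_def algebra_simps)
    also have "\<dots> = phi x * h x * (LINT z:{x<..<t}|lborel. (z - (x - e)) powr (\<alpha> - 2))"
      by (simp add: set_lebesgue_integral_def)
    also have "\<dots> = ?a x"
      using True integral_powr_shift(2)[of "x - e" x t \<alpha>] e alpha by (simp add: algebra_simps)
    finally show ?thesis .
  next
    case False
    then have "?A (x, z) = 0" for z by auto
    then show ?thesis using False by (simp only:) simp
  qed
  have b: "(\<integral>x. ?B (x, z) \<partial>lborel) = ?b z" for z
  proof (cases "s < z \<and> z < t")
    case True
    have "(\<integral>x. ?B (x, z) \<partial>lborel) = (\<integral>x. h z * (indicator {s<..<z} x * (phi x * (z + e - x) powr (\<alpha> - 2))) \<partial>lborel)"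
      using True by (intro Bochner_Integration.integral_cong) (auto simp: indicator_def algebra_simps)
    also have "\<dots> = h z * (LINT x:{s<..<z}|lborel. phi x * (z + e - x) powr (\<alpha> - 2))"
      by (simp add: set_lebesgue_integral_def)
    also have "\<dots> = ?b z"
      using True integral_powr_regularised(2)[of s z "z + e" \<alpha>] e alpha by (simp add: algebra_simps)
    finally show ?thesis .
  next
    case False
    then have "?B (x, z) = 0" for x by auto
    then show ?thesis using False by (simp only:) simp
  qed
  have ia: "integrable lborel ?a" using lborel_pair.integrable_fst'[OF A] by (simp only: a)
  have ib: "integrable lborel ?b" using lborel_pair.integrable_snd[OF B] by (simp only: b[unfolded prod.case])
  have "integral\<^sup>L (lborel2) (ker e) = integral\<^sup>L (lborel2) (\<lambda>p. ?A p - ?B p)"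
    by (intro Bochner_Integration.integral_cong) (auto simp: algebra_simps)
  also have "\<dots> = integral\<^sup>L (lborel2) ?A - integral\<^sup>L (lborel2) ?B"
    by (rule Bochner_Integration.integral_diff[OF A B])
  also have "integral\<^sup>L (lborel2) ?A = (\<integral>x. ?a x \<partial>lborel)"
    using lborel_pair.integral_fst'[OF A] by (simp only: a)
  also have "integral\<^sup>L (lborel2) ?B = (\<integral>z. ?b z \<partial>lborel)"
    using lborel_pair.integral_snd[OF B] by (simp only: b[unfolded prod.case])
  also have "(\<integral>x. ?a x \<partial>lborel) - (\<integral>z. ?b z \<partial>lborel) = (\<integral>x. ?a x - ?b x \<partial>lborel)"
    by (rule Bochner_Integration.integral_diff[OF ia ib, symmetric])
  finally have "(1 - \<alpha>) * integral\<^sup>L (lborel2) (ker e) = (1 - \<alpha>) * (\<integral>x. ?a x - ?b x \<partial>lborel)"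
    by (rule arg_cong)
  also have "\<dots> = (\<integral>x. (1 - \<alpha>) * (?a x - ?b x) \<partial>lborel)"
    by (rule Bochner_Integration.integral_mult_right_zero[symmetric])
  also have "\<dots> = (LINT x:{s<..<t}|lborel. h x * phi x * (e powr \<alpha> / (x - s + e)) - h x * phi x * (t - x + e) powr (\<alpha> - 1))"
    unfolding set_lebesgue_integral_def
  proof (intro Bochner_Integration.integral_cong refl)
    fix x
    show "(1 - \<alpha>) * (?a x - ?b x) = indicator {s<..<t} x *\<^sub>R
      (h x * phi x * (e powr \<alpha> / (x - s + e)) - h x * phi x * (t - x + e) powr (\<alpha> - 1))"
    proof (cases "s < x \<and> x < t")
      case True
      define P where "P = phi x"
      define E where "E = e powr (\<alpha> - 1)"
      have P: "(x - s) powr (1 - \<alpha>) = (x - s) * P"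
        using True powr_mult_base[of "x - s" "- \<alpha>"] by (simp add: P_def)
      have E: "e powr \<alpha> = e * E"
        using e powr_mult_base[of e "\<alpha> - 1"] by (simp add: E_def)
      have "0 < x - s + e" "1 - \<alpha> \<noteq> 0" using True e alpha by auto
      then have "(1 - \<alpha>) * (P * h x * ((E - (t - x + e) powr (\<alpha> - 1)) / (1 - \<alpha>))
          - h x * ((x - s) * P * E / ((1 - \<alpha>) * (x - s + e))))
        = h x * P * (e * E / (x - s + e)) - h x * P * (t - x + e) powr (\<alpha> - 1)"
        by (simp add: divide_simps) (simp add: algebra_simps)
      then show ?thesis using True unfolding P E P_def[symmetric] E_def[symmetric] by simp
    qed simp
  qed
  finally show ?thesis .
qed

lemma h_phi_bound: "s < x \<Longrightarrow> x < t \<Longrightarrow> \<bar>h x * phi x\<bar> \<le> C * (x - s) powr (1 - 2 * \<alpha>)"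
proof -
  assume x: "s < x" "x < t"
  have "\<bar>h x * phi x\<bar> \<le> C * (x - s) powr (1 - \<alpha>) * phi x"
    unfolding abs_mult using h_bound[OF x] by (simp add: mult_right_mono)
  also have "\<dots> = C * (x - s) powr (1 - 2 * \<alpha>)"
    by (simp add: powr_add[symmetric])
  finally show ?thesis .
qed

text \<open>The remainder \<open>e powr \<alpha> / (x - s + e)\<close> tends to \<open>0\<close> and
  is at most \<open>1 / (x - s)\<close>. As \<open>h\<close> vanishes at \<open>s\<close> to order
  \<open>1 - \<alpha>\<close>, the product with \<open>h x * phi x\<close> is dominated by
  \<open>C * (x - s) powr (- 2 * \<alpha>)\<close>, integrable because \<alpha> < 1/2.\<close>

lemma ker_limit:
  "(1 - \<alpha>) * integral\<^sup>L (lborel2) (ker 0) = - (LINT x:{s<..<t}|lborel. h x * phi x * (t - x) powr (\<alpha> - 1))"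
proof -
  let ?f = "\<lambda>n x. indicator {s<..<t} x *\<^sub>R (h x * phi x * (eps n powr \<alpha> / (x - s + eps n)) - h x * phi x * (t - x + eps n) powr (\<alpha> - 1))"
  let ?g = "\<lambda>x. indicator {s<..<t} x *\<^sub>R (- (h x * phi x * (t - x) powr (\<alpha> - 1)))"
  let ?w = "\<lambda>x. C * (indicator {s<..<t} x * (x - s) powr (- 2 * \<alpha>))
    + C * (t - s) powr (1 - 2 * \<alpha>) * (indicator {s<..<t} x * (t - x) powr (\<alpha> - 1))"
  have "(\<lambda>n. integral\<^sup>L lborel (?f n)) \<longlonglongrightarrow> integral\<^sup>L lborel ?g"
  proof (rule integral_dominated_convergence[where w = ?w])
    show "integrable lborel ?w"
      using integral_powr_left(1)[of s t "1 - 2 * \<alpha>"] integral_powr_right(1)[of s t \<alpha>] st alpha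
      by (auto simp: set_integrable_def intro!: Bochner_Integration.integrable_add)
    show "AE x in lborel. (\<lambda>n. ?f n x) \<longlonglongrightarrow> ?g x"
    proof (rule AE_I2)
      fix x
      show "(\<lambda>n. ?f n x) \<longlonglongrightarrow> ?g x"
      proof (cases "s < x \<and> x < t")
        case True
        have 1: "(\<lambda>n. (t - x + eps n) powr (\<alpha> - 1)) \<longlonglongrightarrow> (t - x + 0) powr (\<alpha> - 1)"
          using True by (intro tendsto_powr tendsto_add tendsto_const LIMSEQ_inverse_real_of_nat) auto
        have "(\<lambda>n. eps n powr \<alpha>) \<longlonglongrightarrow> 0 powr \<alpha>"
          using alpha by (intro tendsto_powr2 LIMSEQ_inverse_real_of_nat tendsto_const) auto
        note pw = this
        have 2: "(\<lambda>n. eps n powr \<alpha> / (x - s + eps n)) \<longlonglongrightarrow> 0 powr \<alpha> / (x - s + 0)"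
          by (rule tendsto_divide[OF pw tendsto_add[OF tendsto_const LIMSEQ_inverse_real_of_nat]]) (use True in auto)
        have "(\<lambda>n. ?f n x) \<longlonglongrightarrow> indicator {s<..<t} x *\<^sub>R (h x * phi x * (0 powr \<alpha> / (x - s + 0)) - h x * phi x * (t - x + 0) powr (\<alpha> - 1))"
          by (intro tendsto_scaleR tendsto_diff tendsto_mult tendsto_const 1 2)
        then show ?thesis by simp
      qed simp
    qed
    fix n
    show "AE x in lborel. norm (?f n x) \<le> ?w x"
    proof (rule AE_I2)
      fix x
      show "norm (?f n x) \<le> ?w x"
      proof (cases "s < x \<and> x < t")
        case True
        have e: "0 < eps n" "eps n \<le> 1" by (auto simp: inverse_le_1_iff)
        have hp: "\<bar>h x * phi x\<bar> \<le> C * (x - s) powr (1 - 2 * \<alpha>)" using h_phi_bound True by simp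
        have "eps n powr \<alpha> \<le> 1" using powr_le1[of \<alpha> "eps n"] e alpha by simp
        then have "eps n powr \<alpha> / (x - s + eps n) \<le> 1 / (x - s)"
          using True e by (intro frac_le) auto
        then have "\<bar>h x * phi x\<bar> * (eps n powr \<alpha> / (x - s + eps n)) \<le> C * (x - s) powr (1 - 2 * \<alpha>) * (1 / (x - s))"
          using hp e True C_nonneg by (intro mult_mono) auto
        also have "\<dots> = C * (x - s) powr (- 2 * \<alpha>)"
          using True by (simp add: powr_diff powr_minus divide_simps)
        finally have 1: "\<bar>h x * phi x\<bar> * (eps n powr \<alpha> / (x - s + eps n)) \<le> C * (x - s) powr (- 2 * \<alpha>)" .
        have "C * (x - s) powr (1 - 2 * \<alpha>) \<le> C * (t - s) powr (1 - 2 * \<alpha>)"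
          using True C_nonneg alpha by (intro mult_left_mono powr_mono2) auto
        then have hp': "\<bar>h x * phi x\<bar> \<le> C * (t - s) powr (1 - 2 * \<alpha>)"
          using hp by linarith
        have "(t - x + eps n) powr (\<alpha> - 1) \<le> (t - x) powr (\<alpha> - 1)"
          using True e alpha by (intro powr_mono2') auto
        then have 2: "\<bar>h x * phi x\<bar> * (t - x + eps n) powr (\<alpha> - 1) \<le> C * (t - s) powr (1 - 2 * \<alpha>) * (t - x) powr (\<alpha> - 1)"
          using hp' C_nonneg by (intro mult_mono) auto
        have "norm (h x * phi x * (eps n powr \<alpha> / (x - s + eps n)) - h x * phi x * (t - x + eps n) powr (\<alpha> - 1))
          \<le> \<bar>h x * phi x\<bar> * (eps n powr \<alpha> / (x - s + eps n)) + \<bar>h x * phi x\<bar> * (t - x + eps n) powr (\<alpha> - 1)"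
          using True e by (intro order_trans[OF norm_triangle_ineq4]) (simp add: abs_mult)
        then show ?thesis using 1 2 True by simp
      qed simp
    qed
  qed measurable
  moreover have "integral\<^sup>L lborel (?f n) = (1 - \<alpha>) * integral\<^sup>L (lborel2) (ker (eps n))" for n
    using ker_integral[of "eps n"] unfolding set_lebesgue_integral_def by simp
  ultimately have "(\<lambda>n. (1 - \<alpha>) * integral\<^sup>L (lborel2) (ker (eps n))) \<longlonglongrightarrow> integral\<^sup>L lborel ?g"
    by simp
  moreover have "(\<lambda>n. (1 - \<alpha>) * integral\<^sup>L (lborel2) (ker (eps n)))
      \<longlonglongrightarrow> (1 - \<alpha>) * integral\<^sup>L (lborel2) (ker 0)"
    by (intro tendsto_mult tendsto_const ker_tendsto)
  ultimately have "(1 - \<alpha>) * integral\<^sup>L (lborel2) (ker 0) = integral\<^sup>L lborel ?g"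
    using LIMSEQ_unique by blast
  also have "\<dots> = - (LINT x:{s<..<t}|lborel. h x * phi x * (t - x) powr (\<alpha> - 1))"
    by (simp add: set_lebesgue_integral_def)
  finally show ?thesis .
qed

lemma beta_integrable: "integrable lborel (\<lambda>x. indicator {s<..<t} x * (phi x * (t - x) powr (\<alpha> - 1)))"
proof (rule integrableI_bounded)
  have "(\<integral>\<^sup>+x. ennreal (norm (indicator {s<..<t} x * (phi x * (t - x) powr (\<alpha> - 1)))) \<partial>lborel)
      = (\<integral>\<^sup>+x\<in>{s<..<t}. ennreal ((x - s) powr ((1 - \<alpha>) - 1) * (t - x) powr (\<alpha> - 1)) \<partial>lborel)"
    by (intro nn_integral_cong) (auto simp: indicator_def)
  also have "\<dots> < \<infinity>"
    by (rule le_less_trans[OF nn_integral_beta_le]) (use st alpha in auto)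
  finally show "(\<integral>\<^sup>+x. ennreal (norm (indicator {s<..<t} x * (phi x * (t - x) powr (\<alpha> - 1)))) \<partial>lborel) < \<infinity>" .
qed measurable

text \<open>A lower bound replaces the exact value of this Beta integral: \<open>phi\<close> is at
  least its value at \<open>t\<close>, and the other factor integrates to
  \<open>(t - s) powr \<alpha> / \<alpha>\<close>.\<close>

lemma beta_ge: "1 / \<alpha> \<le> (\<integral>x. indicator {s<..<t} x * (phi x * (t - x) powr (\<alpha> - 1)) \<partial>lborel)"
proof -
  have "(t - s) powr (- \<alpha>) * (t - s) powr \<alpha> = 1"
    using st by (simp add: powr_add[symmetric])
  then have "1 / \<alpha> = (t - s) powr (- \<alpha>) * (LINT x:{s<..<t}|lborel. (t - x) powr (\<alpha> - 1))"
    using integral_powr_right(2)[of s t \<alpha>] st alpha by simp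
  also have "\<dots> = (\<integral>x. (t - s) powr (- \<alpha>) * (indicator {s<..<t} x * (t - x) powr (\<alpha> - 1)) \<partial>lborel)"
    by (simp add: set_lebesgue_integral_def)
  also have "\<dots> \<le> (\<integral>x. indicator {s<..<t} x * (phi x * (t - x) powr (\<alpha> - 1)) \<partial>lborel)"
  proof (intro integral_mono beta_integrable)
    show "integrable lborel (\<lambda>x. (t - s) powr (- \<alpha>) * (indicator {s<..<t} x * (t - x) powr (\<alpha> - 1)))"
      using integral_powr_right(1)[of s t \<alpha>] st alpha by (simp add: set_integrable_def)
    fix x
    have "(t - s) powr (- \<alpha>) \<le> phi x" if "s < x" "x < t"
      using that alpha by (intro powr_mono2') auto
    then show "(t - s) powr (- \<alpha>) * (indicator {s<..<t} x * (t - x) powr (\<alpha> - 1)) \<le> indicator {s<..<t} x * (phi x * (t - x) powr (\<alpha> - 1))"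
      by (auto simp: indicator_def intro!: mult_right_mono)
  qed
  finally show ?thesis .
qed

text \<open>Write \<open>g x - g t = h x - h t\<close> in the boundary term of the kernel. The part
  with \<open>h x\<close> is cancelled by the integral term, which is what \<open>ker_limit\<close>
  computes; only \<open>h t\<close> times a Beta integral survives.\<close>

lemma fractional_inversion:
  "(LINT x:{s<..<t}|lborel. phi x * frac_kernel \<alpha> g t x)
    = - (h t * (\<integral>x. indicator {s<..<t} x * (phi x * (t - x) powr (\<alpha> - 1)) \<partial>lborel))"
proof -
  let ?J = "\<lambda>x. \<integral>z. ker 0 (x, z) \<partial>lborel"
  let ?b = "\<lambda>x. indicator {s<..<t} x * (phi x * (t - x) powr (\<alpha> - 1))"
  let ?q = "\<lambda>x. indicator {s<..<t} x *\<^sub>R (h x * phi x * (t - x) powr (\<alpha> - 1))"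
  have J: "integrable lborel ?J" by (rule lborel_pair.integrable_fst'[OF ker0_integrable])
  have q: "integrable lborel ?q"
  proof (rule Bochner_Integration.integrable_bound[OF integrable_mult_right[OF beta_integrable, of "C * (t - s) powr (1 - \<alpha>)"]])
    show "AE x in lborel. norm (?q x) \<le> norm (C * (t - s) powr (1 - \<alpha>) * ?b x)"
      using h_bound' C_nonneg
      by (intro AE_I2) (auto simp: indicator_def abs_mult mult.assoc[symmetric] intro!: mult_right_mono)
  qed measurable
  have J_eq: "?J x = indicator {s<..<t} x * (phi x * (LINT y:{x<..<t}|lborel. (g x - g y) * (y - x) powr (\<alpha> - 2)))" for x
  proof (cases "s < x \<and> x < t")
    case True
    have "?J x = (\<integral>z. phi x * (indicator {x<..<t} z *\<^sub>R ((g x - g z) * (z - x) powr (\<alpha> - 2))) \<partial>lborel)"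
      using True by (intro Bochner_Integration.integral_cong) (auto simp: indicator_def)
    also have "\<dots> = phi x * (LINT y:{x<..<t}|lborel. (g x - g y) * (y - x) powr (\<alpha> - 2))"
      unfolding set_lebesgue_integral_def by (rule Bochner_Integration.integral_mult_right_zero)
    finally show ?thesis using True by simp
  next
    case False
    then have "ker 0 (x, z) = 0" for z by auto
    then show ?thesis using False by (simp only:) simp
  qed
  have "(LINT x:{s<..<t}|lborel. phi x * frac_kernel \<alpha> g t x)
      = (\<integral>x. ?q x - h t * ?b x + (1 - \<alpha>) * ?J x \<partial>lborel)"
    unfolding set_lebesgue_integral_def[of _ "{s<..<t}"]
    by (intro Bochner_Integration.integral_cong refl, subst J_eq)
       (auto simp: indicator_def frac_kernel_def algebra_simps)
  also have "\<dots> = (\<integral>x. ?q x \<partial>lborel) - h t * (\<integral>x. ?b x \<partial>lborel) + (1 - \<alpha>) * (\<integral>x. ?J x \<partial>lborel)"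
    using q J beta_integrable by simp
  also have "(\<integral>x. ?J x \<partial>lborel) = integral\<^sup>L (lborel2) (ker 0)"
    by (rule lborel_pair.integral_fst'[OF ker0_integrable])
  also note ker_limit
  finally show ?thesis by (simp add: set_lebesgue_integral_def)
qed

end

section \<open>Increments of the integrator and of its fractional derivative, bounded by
  \<open>L\<close>\<close>

lemma L_nonneg: "0 < s \<Longrightarrow> s < t \<Longrightarrow> t \<le> T \<Longrightarrow> 0 \<le> L"
  using kernel_bound[of s t] by linarith

lemma frac_kernel_measurable [measurable]: "frac_kernel \<alpha> g t \<in> borel_measurable borel"
  unfolding frac_kernel_def set_lebesgue_integral_def indicator_def greaterThanLessThan_iff
  by measurable

text \<open>In contrast to \<open>g_holder\<close>, the constant is now the bound on the fractional derivative.\<close>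

lemma g_holder_L:
  assumes st: "0 < s" "s < t" "t \<le> T"
  shows "\<bar>g t - g s\<bar> \<le> L * (t - s) powr (1 - \<alpha>)"
proof -
  let ?p = "\<lambda>x. (x - s) powr (- \<alpha>)"
  let ?B = "\<integral>x. indicator {s<..<t} x * (?p x * (t - x) powr (\<alpha> - 1)) \<partial>lborel"
  have B: "1 / \<alpha> \<le> ?B" by (rule beta_ge[OF st])
  have "\<bar>g t - g s\<bar> * (1 / \<alpha>) \<le> \<bar>g t - g s\<bar> * ?B"
    using B by (intro mult_left_mono) auto
  also have "\<dots> = \<bar>LINT x:{s<..<t}|lborel. ?p x * frac_kernel \<alpha> g t x\<bar>"
    using B alpha by (subst fractional_inversion[OF st]) (simp add: abs_mult)
  also have "\<dots> \<le> (\<integral>x. L * (indicator {s<..<t} x * ?p x) \<partial>lborel)"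
    unfolding set_lebesgue_integral_def
  proof (rule integral_abs_bound_integral)
    have *: "norm (indicator {s<..<t} x *\<^sub>R (?p x * frac_kernel \<alpha> g t x)) \<le> L * (indicator {s<..<t} x * ?p x)" for x
      using kernel_bound[of x t] st
      by (auto simp: indicator_def abs_mult mult.commute[of L] intro!: mult_left_mono)
    show i: "integrable lborel (\<lambda>x. L * (indicator {s<..<t} x * ?p x))"
      using phi_integrable[OF st] by simp
    show "integrable lborel (\<lambda>x. indicator {s<..<t} x *\<^sub>R (?p x * frac_kernel \<alpha> g t x))"
      using * by (intro Bochner_Integration.integrable_bound[OF i]) (auto intro: order_trans[OF _ abs_ge_self])
    show "\<bar>indicator {s<..<t} x *\<^sub>R (?p x * frac_kernel \<alpha> g t x)\<bar> \<le> L * (indicator {s<..<t} x * ?p x)" for x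
      using * by simp
  qed
  also have "\<dots> = L * ((t - s) powr (1 - \<alpha>) / (1 - \<alpha>))"
    using integral_powr_left(2)[of s t "1 - \<alpha>"] st alpha by (simp add: set_lebesgue_integral_def)
  finally have "\<bar>g t - g s\<bar> \<le> \<alpha> / (1 - \<alpha>) * (L * (t - s) powr (1 - \<alpha>))"
    using alpha by (simp add: field_simps)
  \<comment> \<open>The lower bound for the Beta integral and the integral of
    \<open>(x - s) powr (- \<alpha>)\<close> leave the factor
    \<open>\<alpha> / (1 - \<alpha>)\<close>, which is at most \<open>1\<close> since \<alpha> <
    1/2.\<close>
  also have "\<dots> \<le> 1 * (L * (t - s) powr (1 - \<alpha>))"
    using alpha L_nonneg[OF st] by (intro mult_right_mono) auto
  finally show ?thesis by simp
qed

text \<open>On \<open>(s,t)\<close> write \<open>g x - g y = (g x - g s) + (g s - g y)\<close>. The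
  first part is integrated in closed form and cancels all dependence on \<open>g x\<close>, leaving
  a boundary term with \<open>g s - g t\<close> and an integral of \<open>g s - g y\<close>.
  Bounding both by the Hoelder constant \<open>L\<close> produces
  \<open>(t - x) powr (\<alpha> - 1)\<close> plus
  \<open>(s - x) powr (\<alpha> - 1) - (t - x) powr (\<alpha> - 1)\<close>, so the bound comes out
  with the constant \<open>L\<close> itself.\<close>

lemma frac_kernel_diff:
  assumes x: "0 < x" "x < s" and st: "s < t" "t \<le> T"
  shows "\<bar>frac_kernel \<alpha> g t x - frac_kernel \<alpha> g s x\<bar> \<le> L * (t - s) powr (1 - \<alpha>) * (s - x) powr (\<alpha> - 1)"
proof -
  let ?f = "\<lambda>y. (g x - g y) * (y - x) powr (\<alpha> - 2)"
  let ?k = "\<lambda>y. (y - x) powr (\<alpha> - 2)"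
  let ?r = "\<lambda>y. (g s - g y) * (y - x) powr (\<alpha> - 2)"
  have f: "set_integrable lborel {x<..<t} ?f"
    using g_var_integrable x st by simp
  have fs: "set_integrable lborel {s<..<t} ?f"
    by (rule set_integrable_subset[OF f]) (use x in auto)
  have k: "set_integrable lborel {s<..<t} ?k"
    using integral_powr_shift(1)[of x s t \<alpha>] x st alpha by simp
  have r: "set_integrable lborel {s<..<t} ?r"
  proof -
    have "set_integrable lborel {s<..<t} (\<lambda>y. ?f y - (g x - g s) * ?k y)"
      using fs k by (intro set_integral_diff(1)) auto
    also have "(\<lambda>y. ?f y - (g x - g s) * ?k y) = ?r" by (simp add: algebra_simps)
    finally show ?thesis .
  qed
  have split: "(LINT y:{x<..<t}|lborel. ?f y) = (LINT y:{x<..<s}|lborel. ?f y) + (LINT y:{s<..<t}|lborel. ?f y)"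
  proof -
    have "(LINT y:{x<..<t}|lborel. ?f y) = (LINT y:{x<..<s} \<union> {s<..<t}|lborel. ?f y)"
      unfolding set_lebesgue_integral_def
    proof (rule integral_cong_AE)
      show "AE y in lborel. indicator {x<..<t} y *\<^sub>R ?f y = indicator ({x<..<s} \<union> {s<..<t}) y *\<^sub>R ?f y"
        using AE_lborel_singleton[of s] by eventually_elim (use x st in \<open>auto simp: indicator_def\<close>)
    qed measurable
    also have "\<dots> = (LINT y:{x<..<s}|lborel. ?f y) + (LINT y:{s<..<t}|lborel. ?f y)"
      by (rule set_integral_Un[OF _ set_integrable_subset[OF f] fs]) (use x st in auto)
    finally show ?thesis .
  qed
  have fr: "(LINT y:{s<..<t}|lborel. ?f y) = (g x - g s) * (LINT y:{s<..<t}|lborel. ?k y) + (LINT y:{s<..<t}|lborel. ?r y)"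
  proof -
    have "(LINT y:{s<..<t}|lborel. ?f y) = (LINT y:{s<..<t}|lborel. (g x - g s) * ?k y + ?r y)"
      by (simp add: algebra_simps)
    also have "\<dots> = (LINT y:{s<..<t}|lborel. (g x - g s) * ?k y) + (LINT y:{s<..<t}|lborel. ?r y)"
      using k r by (intro set_integral_add(2)) auto
    finally show ?thesis by simp
  qed
  have kv: "(LINT y:{s<..<t}|lborel. ?k y) = ((s - x) powr (\<alpha> - 1) - (t - x) powr (\<alpha> - 1)) / (1 - \<alpha>)"
    using integral_powr_shift(2)[of x s t \<alpha>] x st alpha by simp
  have "frac_kernel \<alpha> g t x - frac_kernel \<alpha> g s x
      = (g s - g t) * (t - x) powr (\<alpha> - 1) + (1 - \<alpha>) * (LINT y:{s<..<t}|lborel. ?r y)"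
    unfolding frac_kernel_def split fr kv using alpha by (simp add: field_simps)
  also have "\<bar>\<dots>\<bar> \<le> \<bar>g s - g t\<bar> * (t - x) powr (\<alpha> - 1) + (1 - \<alpha>) * \<bar>LINT y:{s<..<t}|lborel. ?r y\<bar>"
    using alpha by (intro order_trans[OF abs_triangle_ineq]) (simp add: abs_mult)
  also have "\<dots> \<le> L * (t - s) powr (1 - \<alpha>) * (t - x) powr (\<alpha> - 1)
      + (1 - \<alpha>) * (L * (t - s) powr (1 - \<alpha>) * (LINT y:{s<..<t}|lborel. ?k y))"
  proof (intro add_mono mult_right_mono mult_left_mono)
    show "\<bar>g s - g t\<bar> \<le> L * (t - s) powr (1 - \<alpha>)"
      using g_holder_L[of s t] x st by (simp add: abs_minus_commute)
    have b: "\<bar>?r y\<bar> \<le> L * (t - s) powr (1 - \<alpha>) * ?k y" if y: "s < y" "y < t" for y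
    proof -
      have "\<bar>g y - g s\<bar> \<le> L * (y - s) powr (1 - \<alpha>)"
        using g_holder_L[of s y] x y st by simp
      also have "\<dots> \<le> L * (t - s) powr (1 - \<alpha>)"
        using y alpha L_nonneg[of s t] x st by (intro mult_left_mono powr_mono2) auto
      finally show ?thesis by (simp add: abs_mult abs_minus_commute mult_right_mono)
    qed
    show "\<bar>LINT y:{s<..<t}|lborel. ?r y\<bar> \<le> L * (t - s) powr (1 - \<alpha>) * (LINT y:{s<..<t}|lborel. ?k y)"
      unfolding set_lebesgue_integral_def
        Bochner_Integration.integral_mult_right_zero[symmetric]
    proof (rule integral_abs_bound_integral)
      show "\<bar>indicator {s<..<t} y *\<^sub>R ?r y\<bar> \<le> L * (t - s) powr (1 - \<alpha>) * indicator {s<..<t} y *\<^sub>R ?k y" for y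
        using b by (auto simp: indicator_def)
    qed (use r k in \<open>auto simp: set_integrable_def\<close>)
  qed (use alpha in auto)
  also have "\<dots> = L * (t - s) powr (1 - \<alpha>) * (s - x) powr (\<alpha> - 1)"
  proof -
    have "(1 - \<alpha>) * (c * (d / (1 - \<alpha>))) = c * d" for c d
      using alpha by simp
    then show ?thesis unfolding kv by (simp only:) (simp add: algebra_simps)
  qed
  finally show ?thesis .
qed

end

subsection \<open>Fractional derivatives of the integrand\<close>

abbreviation frac_int :: "real \<Rightarrow> (real \<Rightarrow> 'a::real_normed_vector) \<Rightarrow> real \<Rightarrow> ennreal" where
  "frac_int \<alpha> F x \<equiv> \<integral>\<^sup>+y\<in>{0<..<x}. ennreal (norm (F x - F y) / (x - y) powr (\<alpha> + 1)) \<partial>lborel"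

text \<open>Up to \<open>Gamma (1 - \<alpha>)\<close>, a pointwise majorant of the fractional
  derivative from the left at \<open>0\<close>.\<close>

definition frac_var :: "real \<Rightarrow> (real \<Rightarrow> 'a::real_normed_vector) \<Rightarrow> real \<Rightarrow> ennreal" where
  "frac_var \<alpha> F x = ennreal (norm (F x) * x powr (- \<alpha>))
     + frac_int \<alpha> F x"

text \<open>A qualitative condition: the singularity \<open>x powr (- \<alpha>)\<close> at
  \<open>0\<close> is integrable and stays so after multiplication by the bounded kernel of
  \<open>g\<close>. The constant \<open>c\<close> enters no estimate.\<close>

definition frac_dominated :: "real \<Rightarrow> real \<Rightarrow> (real \<Rightarrow> 'a::real_normed_vector) \<Rightarrow> bool" where
  "frac_dominated T \<alpha> F \<longleftrightarrow> (\<exists>c\<ge>0. \<forall>x. 0 < x \<longrightarrow> x < T \<longrightarrow> frac_var \<alpha> F x \<le> ennreal (c * x powr (- \<alpha>)))"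

lemma frac_dominatedI:
  "0 \<le> c \<Longrightarrow> (\<And>x. 0 < x \<Longrightarrow> x < T \<Longrightarrow> frac_var \<alpha> F x \<le> ennreal (c * x powr (- \<alpha>))) \<Longrightarrow> frac_dominated T \<alpha> F"
  by (auto simp: frac_dominated_def)

lemma frac_dominatedE:
  assumes "frac_dominated T \<alpha> F"
  obtains c where "0 \<le> c" "\<And>x. 0 < x \<Longrightarrow> x < T \<Longrightarrow> frac_var \<alpha> F x \<le> ennreal (c * x powr (- \<alpha>))"
  using assms by (auto simp: frac_dominated_def)

lemma frac_dominated_finite: "frac_dominated T \<alpha> F \<Longrightarrow> 0 < x \<Longrightarrow> x < T \<Longrightarrow> frac_var \<alpha> F x < \<infinity>"
  by (auto simp: frac_dominated_def intro: le_less_trans[OF _ ennreal_less_top])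

text \<open>The exponential is what a bound in the norm with parameter \<open>l\<close> leaves at
  the point \<open>x\<close>; the power is the singularity of \<open>frac_var\<close> at
  \<open>0\<close>.\<close>

abbreviation weight :: "real \<Rightarrow> real \<Rightarrow> real \<Rightarrow> real" where
  "weight \<alpha> l x \<equiv> x powr (- \<alpha>) * exp (l * x)"

abbreviation frac_pairing :: "real \<Rightarrow> (real \<Rightarrow> real) \<Rightarrow> (real \<Rightarrow> real) \<Rightarrow> real \<Rightarrow> real" where
  "frac_pairing \<alpha> F g t \<equiv> LINT x:{0<..<t}|lborel. frac_deriv_0 \<alpha> F x * frac_kernel \<alpha> g t x"

text \<open>
  Up to constants, this is the integrand in the estimate of the increment of the integral between
  \<open>s\<close> and \<open>t\<close>. The part on \<open>(s,t)\<close> comes from \<open>D F_t D_t\<close>; on \<open>(0,s)\<close>, the summand \<open>1\<close> comes from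
  \<open>D (F_t - F_s) D_s\<close> and the other one from \<open>D F_t (D_t - D_s)\<close>.
\<close>

definition increment_kernel :: "real \<Rightarrow> real \<Rightarrow> real \<Rightarrow> real \<Rightarrow> real \<Rightarrow> real" where
  "increment_kernel \<alpha> l s t x =
     (if s < x \<and> x < t then x powr (- \<alpha>) * exp (l * x)
      else if 0 < x \<and> x < s then (t - s) powr (1 - \<alpha>) * (1 + (s - x) powr (\<alpha> - 1)) * (x powr (- \<alpha>) * exp (l * x))
      else 0)"

abbreviation kernel_mass :: "real \<Rightarrow> real \<Rightarrow> real \<Rightarrow> real \<Rightarrow> ennreal" where
  "kernel_mass \<alpha> l s t \<equiv> \<integral>\<^sup>+x. ennreal (increment_kernel \<alpha> l s t x) \<partial>lborel"

text \<open>No integrability is assumed: a divergent Bochner integral has the default value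
  \<open>0\<close>.\<close>

lemma ennreal_norm_set_integral_le:
  fixes f :: "'a \<Rightarrow> 'b::{banach, second_countable_topology}"
  shows "ennreal (norm (LINT x:A|M. f x)) \<le> (\<integral>\<^sup>+x\<in>A. ennreal (norm (f x)) \<partial>M)"
proof (cases "set_integrable M A f")
  case True
  have "ennreal (norm (LINT x:A|M. f x)) \<le> (\<integral>\<^sup>+x. ennreal (norm (indicator A x *\<^sub>R f x)) \<partial>M)"
    using True unfolding set_lebesgue_integral_def set_integrable_def
    by (rule integral_norm_bound_ennreal)
  also have "\<dots> = (\<integral>\<^sup>+x\<in>A. ennreal (norm (f x)) \<partial>M)"
    by (intro nn_integral_cong) (auto simp: indicator_def)
  finally show ?thesis .
next
  case False
  then have "(LINT x:A|M. f x) = 0"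
    unfolding set_lebesgue_integral_def set_integrable_def by (rule not_integrable_integral_eq)
  then show ?thesis by simp
qed

lemma frac_deriv_0_measurable:
  fixes F :: "real \<Rightarrow> real"
  assumes [measurable]: "F \<in> borel_measurable borel"
  shows "frac_deriv_0 \<alpha> F \<in> borel_measurable borel"
  unfolding frac_deriv_0_def set_lebesgue_integral_def indicator_def greaterThanLessThan_iff
  by measurable

lemma frac_deriv_0_le:
  fixes F :: "real \<Rightarrow> real"
  assumes "0 < \<alpha>" "\<alpha> < 1"
  shows "ennreal \<bar>frac_deriv_0 \<alpha> F x\<bar> \<le> ennreal (1 / Gamma (1 - \<alpha>)) * frac_var \<alpha> F x"
proof -
  let ?I = "LINT y:{0<..<x}|lborel. (F x - F y) /\<^sub>R (x - y) powr (\<alpha> + 1)"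
  have G: "0 < Gamma (1 - \<alpha>)" using assms by (intro Gamma_real_pos) simp
  have "\<bar>F x /\<^sub>R x powr \<alpha> + \<alpha> *\<^sub>R ?I\<bar> \<le> \<bar>F x\<bar> * x powr (- \<alpha>) + \<alpha> * \<bar>?I\<bar>"
    using assms by (intro order_trans[OF abs_triangle_ineq]) (simp add: abs_mult powr_minus)
  also have "\<dots> \<le> \<bar>F x\<bar> * x powr (- \<alpha>) + 1 * \<bar>?I\<bar>"
    using assms by (intro add_left_mono mult_right_mono) auto
  finally have "\<bar>frac_deriv_0 \<alpha> F x\<bar> \<le> 1 / Gamma (1 - \<alpha>) * (\<bar>F x\<bar> * x powr (- \<alpha>) + \<bar>?I\<bar>)"
    using G unfolding frac_deriv_0_def by (simp add: abs_mult divide_right_mono)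
  then have "ennreal \<bar>frac_deriv_0 \<alpha> F x\<bar> \<le> ennreal (1 / Gamma (1 - \<alpha>) * (\<bar>F x\<bar> * x powr (- \<alpha>) + \<bar>?I\<bar>))"
    by (rule ennreal_leI)
  also have "\<dots> = ennreal (1 / Gamma (1 - \<alpha>)) * (ennreal (\<bar>F x\<bar> * x powr (- \<alpha>)) + ennreal (norm ?I))"
  proof -
    have distrib: "ennreal (a * (b + c)) = ennreal a * (ennreal b + ennreal c)" if "0 \<le> a" "0 \<le> b" "0 \<le> c" for a b c
      using that by (simp add: ennreal_mult)
    show ?thesis unfolding real_norm_def by (rule distrib) (use G in auto)
  qed
  also have "\<dots> \<le> ennreal (1 / Gamma (1 - \<alpha>)) * frac_var \<alpha> F x"
  proof (intro mult_left_mono)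
    have "ennreal (norm ?I) \<le> (\<integral>\<^sup>+y\<in>{0<..<x}. ennreal (norm ((F x - F y) /\<^sub>R (x - y) powr (\<alpha> + 1))) \<partial>lborel)"
      by (rule ennreal_norm_set_integral_le)
    also have "\<dots> = frac_int \<alpha> F x"
      by (simp add: abs_mult divide_inverse mult.commute)
    finally show "ennreal (\<bar>F x\<bar> * x powr (- \<alpha>)) + ennreal (norm ?I) \<le> frac_var \<alpha> F x"
      unfolding frac_var_def by (intro add_mono) auto
  qed simp
  finally show ?thesis .
qed

lemma frac_var_integrable:
  fixes F :: "real \<Rightarrow> real"
  assumes [measurable]: "F \<in> borel_measurable borel" and fin: "frac_var \<alpha> F x < \<infinity>"
  shows "set_integrable lborel {0<..<x} (\<lambda>y. (F x - F y) /\<^sub>R (x - y) powr (\<alpha> + 1))"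
  unfolding set_integrable_def
proof (rule integrableI_bounded)
  have "(\<integral>\<^sup>+y. ennreal (norm (indicator {0<..<x} y *\<^sub>R ((F x - F y) /\<^sub>R (x - y) powr (\<alpha> + 1)))) \<partial>lborel)
      = frac_int \<alpha> F x"
    by (intro nn_integral_cong) (auto simp: indicator_def abs_mult divide_inverse mult.commute)
  also have "\<dots> \<le> frac_var \<alpha> F x" unfolding frac_var_def by simp
  finally show "(\<integral>\<^sup>+y. ennreal (norm (indicator {0<..<x} y *\<^sub>R ((F x - F y) /\<^sub>R (x - y) powr (\<alpha> + 1)))) \<partial>lborel) < \<infinity>"
    using fin by (rule le_less_trans)
qed measurable

text \<open>Finiteness of \<open>frac_var\<close> makes the inner integrals genuine; the default
  value of a divergent one would break additivity.\<close>

lemma frac_deriv_0_diff: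
  fixes F G :: "real \<Rightarrow> real"
  assumes "F \<in> borel_measurable borel" "G \<in> borel_measurable borel"
    and "frac_var \<alpha> F x < \<infinity>" "frac_var \<alpha> G x < \<infinity>"
  shows "frac_deriv_0 \<alpha> (\<lambda>y. F y - G y) x = frac_deriv_0 \<alpha> F x - frac_deriv_0 \<alpha> G x"
proof -
  let ?k = "\<lambda>F y. (F x - F y) /\<^sub>R (x - y) powr (\<alpha> + 1) :: real"
  have "(LINT y:{0<..<x}|lborel. (F x - G x - (F y - G y)) /\<^sub>R (x - y) powr (\<alpha> + 1)) = (LINT y:{0<..<x}|lborel. ?k F y - ?k G y)"
    by (simp add: algebra_simps)
  also have "\<dots> = (LINT y:{0<..<x}|lborel. ?k F y) - (LINT y:{0<..<x}|lborel. ?k G y)"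
    using assms by (intro set_integral_diff(2) frac_var_integrable)
  finally have eq: "(LINT y:{0<..<x}|lborel. (F x - G x - (F y - G y)) /\<^sub>R (x - y) powr (\<alpha> + 1))
    = (LINT y:{0<..<x}|lborel. ?k F y) - (LINT y:{0<..<x}|lborel. ?k G y)" .
  show ?thesis
    unfolding frac_deriv_0_def eq
    by (simp only: scaleR_right_diff_distrib scaleR_right_distrib)
qed

section \<open>Pairing of the fractional derivatives of integrand and integrator\<close>

context frac_integrator
begin

lemma fractional_product_integrable:
  fixes F :: "real \<Rightarrow> real"
  assumes [measurable]: "F \<in> borel_measurable borel" and t: "0 < t" "t \<le> T"
    and dom: "frac_dominated T \<alpha> F"
  shows "set_integrable lborel {0<..<t} (\<lambda>x. frac_deriv_0 \<alpha> F x * frac_kernel \<alpha> g t x)"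
proof -
  obtain c where c: "0 \<le> c"
    and fin: "\<And>x. 0 < x \<Longrightarrow> x < T \<Longrightarrow> frac_var \<alpha> F x \<le> ennreal (c * x powr (- \<alpha>))"
    using dom by (rule frac_dominatedE) (rule that)
  let ?f = "\<lambda>x. indicator {0<..<t} x *\<^sub>R (frac_deriv_0 \<alpha> F x * frac_kernel \<alpha> g t x)"
  let ?b = "\<lambda>x. (1 / Gamma (1 - \<alpha>) * c * L) * (indicator {0<..<t} x * (x - 0) powr ((1 - \<alpha>) - 1))"
  have [measurable]: "frac_deriv_0 \<alpha> F \<in> borel_measurable borel"
    by (rule frac_deriv_0_measurable) measurable
  have G: "0 < Gamma (1 - \<alpha>)" using alpha by (intro Gamma_real_pos) simp
  have bound: "integrable lborel ?b"
    using integral_powr_left(1)[of 0 t "1 - \<alpha>"] t alpha by (simp add: set_integrable_def)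
  have "norm (?f x) \<le> norm (?b x)" for x
    proof (cases "0 < x \<and> x < t")
      case True
      have "ennreal \<bar>frac_deriv_0 \<alpha> F x\<bar> \<le> ennreal (1 / Gamma (1 - \<alpha>)) * ennreal (c * x powr (- \<alpha>))"
        using True alpha by (intro order_trans[OF frac_deriv_0_le] mult_left_mono fin) (use t in auto)
      then have "\<bar>frac_deriv_0 \<alpha> F x\<bar> \<le> 1 / Gamma (1 - \<alpha>) * (c * x powr (- \<alpha>))"
        using G c by (simp add: ennreal_mult[symmetric] ennreal_le_iff del: times_divide_eq_left)
      moreover have "\<bar>frac_kernel \<alpha> g t x\<bar> \<le> L"
        using kernel_bound True t by simp
      ultimately have "\<bar>frac_deriv_0 \<alpha> F x\<bar> * \<bar>frac_kernel \<alpha> g t x\<bar> \<le> 1 / Gamma (1 - \<alpha>) * (c * x powr (- \<alpha>)) * L"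
        using G c by (intro mult_mono) auto
      also have "\<dots> = (1 / Gamma (1 - \<alpha>) * c * L) * x powr (- \<alpha>)" by simp
      finally have "\<bar>frac_deriv_0 \<alpha> F x\<bar> * \<bar>frac_kernel \<alpha> g t x\<bar> \<le> (1 / Gamma (1 - \<alpha>) * c * L) * x powr (- \<alpha>)" .
      moreover have "0 \<le> L" using L_nonneg[of x t] True t by simp
      ultimately show ?thesis using True G c by (simp add: abs_mult)
    qed simp
  then show ?thesis
    unfolding set_integrable_def
    by (intro Bochner_Integration.integrable_bound[OF bound] AE_I2) measurable
qed

text \<open>Domination makes both pairings genuine integrals, so that their difference is a single
  integral which can be bounded pointwise; \<open>S\<close> may be infinite and gives no
  integrability. For \<open>s = 0\<close> the second pairing is over the empty set.\<close>

lemma fractional_product_increment: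
  fixes F1 F2 :: "real \<Rightarrow> real" and S :: ennreal
  assumes m [measurable]: "F1 \<in> borel_measurable borel" "F2 \<in> borel_measurable borel"
    and st: "0 \<le> s" "s < t" "t \<le> T"
    and dom: "frac_dominated T \<alpha> F1" "frac_dominated T \<alpha> F2"
    and F2: "\<And>x. 0 < x \<Longrightarrow> x < T \<Longrightarrow> frac_var \<alpha> F2 x \<le> ennreal (weight \<alpha> l x) * S"
    and F21: "\<And>x. 0 < x \<Longrightarrow> x < T \<Longrightarrow> frac_var \<alpha> (\<lambda>y. F2 y - F1 y) x
      \<le> ennreal ((t - s) powr (1 - \<alpha>) * weight \<alpha> l x) * S"
  shows "ennreal \<bar>frac_pairing \<alpha> F2 g t - frac_pairing \<alpha> F1 g s\<bar>
    \<le> ennreal (L / Gamma (1 - \<alpha>)) * S * kernel_mass \<alpha> l s t"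
proof -
  let ?D = "frac_deriv_0 \<alpha>" and ?k = "frac_kernel \<alpha> g" and ?w = "weight \<alpha> l"
  have G: "0 < Gamma (1 - \<alpha>)" using alpha by (intro Gamma_real_pos) simp
  have L: "0 \<le> L" using L_nonneg[of "t / 2" t] st by simp
  have [measurable]: "?D F1 \<in> borel_measurable borel" "?D F2 \<in> borel_measurable borel"
    by (rule frac_deriv_0_measurable, measurable)+
  have i2: "set_integrable lborel {0<..<t} (\<lambda>x. ?D F2 x * ?k t x)"
    using st by (intro fractional_product_integrable m dom) auto
  have i1: "set_integrable lborel {0<..<s} (\<lambda>x. ?D F1 x * ?k s x)"
    using st by (cases "s = 0") (auto intro!: fractional_product_integrable m dom)
  let ?h = "\<lambda>x. indicator {0<..<t} x *\<^sub>R (?D F2 x * ?k t x) - indicator {0<..<s} x *\<^sub>R (?D F1 x * ?k s x)"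
  have "(LINT x:{0<..<t}|lborel. ?D F2 x * ?k t x) - (LINT x:{0<..<s}|lborel. ?D F1 x * ?k s x)
      = (\<integral>x. ?h x \<partial>lborel)" (is "?l = ?r")
    using i1 i2 unfolding set_lebesgue_integral_def set_integrable_def
    by (rule Bochner_Integration.integral_diff[symmetric, rotated])
  then have "ennreal \<bar>?l\<bar> = ennreal \<bar>?r\<bar>" by (rule arg_cong)
  also have "\<dots> \<le> (\<integral>\<^sup>+x. ennreal (norm (?h x)) \<partial>lborel)"
    unfolding real_norm_def[symmetric]
    by (rule integral_norm_bound_ennreal) (use i1 i2 in \<open>simp add: set_integrable_def\<close>)
  also have "\<dots> \<le> (\<integral>\<^sup>+x. ennreal (L / Gamma (1 - \<alpha>)) * S * ennreal (increment_kernel \<alpha> l s t x) \<partial>lborel)"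
  proof (rule nn_integral_mono_AE)
    \<comment> \<open>One bound for the three products that occur: \<open>p\<close> is the factor in
      the bound of the integrand, \<open>r\<close> the factor in the bound of the kernel relative to
      \<open>L\<close>.\<close>
    have b: "ennreal (\<bar>?D F x\<bar> * q) \<le> ennreal (L / Gamma (1 - \<alpha>)) * S * ennreal (r * p * ?w x)"
      if "frac_var \<alpha> F x \<le> ennreal (p * ?w x) * S" "0 \<le> q" "q \<le> L * r" "0 \<le> r" "0 \<le> p" for F x q p r
    proof -
      have "ennreal (\<bar>?D F x\<bar> * q) = ennreal \<bar>?D F x\<bar> * ennreal q"
        using that by (simp add: ennreal_mult)
      also have "\<dots> \<le> (ennreal (1 / Gamma (1 - \<alpha>)) * (ennreal (p * ?w x) * S)) * ennreal (L * r)"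
        using that alpha
        by (intro mult_mono ennreal_leI order_trans[OF frac_deriv_0_le] mult_left_mono) auto
      also have "\<dots> = (ennreal (1 / Gamma (1 - \<alpha>)) * ennreal (p * ?w x) * ennreal (L * r)) * S"
        by (simp add: mult_ac)
      also have "ennreal (1 / Gamma (1 - \<alpha>)) * ennreal (p * ?w x) * ennreal (L * r)
          = ennreal (L / Gamma (1 - \<alpha>)) * ennreal (r * p * ?w x)"
        using that G L by (simp add: ennreal_mult[symmetric] mult_ac)
      finally show ?thesis by (simp add: mult_ac)
    qed
    show "AE x in lborel. ennreal (norm (?h x)) \<le> ennreal (L / Gamma (1 - \<alpha>)) * S * ennreal (increment_kernel \<alpha> l s t x)"
      using AE_lborel_singleton[of s]
    proof eventually_elim
      fix x assume "x \<noteq> s"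
      then consider "s < x" "x < t" | "0 < x" "x < s" | "x \<le> 0 \<or> t \<le> x" by linarith
      then show "ennreal (norm (?h x)) \<le> ennreal (L / Gamma (1 - \<alpha>)) * S * ennreal (increment_kernel \<alpha> l s t x)"
      proof cases
        case 1
        have "ennreal (\<bar>?D F2 x\<bar> * \<bar>?k t x\<bar>) \<le> ennreal (L / Gamma (1 - \<alpha>)) * S * ennreal (1 * 1 * ?w x)"
          using 1 st F2[of x] kernel_bound[of x t] by (intro b) auto
        then show ?thesis using 1 st by (simp add: increment_kernel_def abs_mult)
      next
        case 2
        have d: "?D (\<lambda>y. F2 y - F1 y) x = ?D F2 x - ?D F1 x"
          using 2 st by (intro frac_deriv_0_diff m frac_dominated_finite[OF dom(1)] frac_dominated_finite[OF dom(2)]) auto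
        have "?h x = ?D F2 x * (?k t x - ?k s x) + ?D (\<lambda>y. F2 y - F1 y) x * ?k s x"
          unfolding d using 2 st by (simp add: algebra_simps)
        then have "norm (?h x) \<le> \<bar>?D F2 x\<bar> * \<bar>?k t x - ?k s x\<bar> + \<bar>?D (\<lambda>y. F2 y - F1 y) x\<bar> * \<bar>?k s x\<bar>"
          by (simp add: abs_triangle_ineq flip: abs_mult)
        then have "ennreal (norm (?h x)) \<le> ennreal (\<bar>?D F2 x\<bar> * \<bar>?k t x - ?k s x\<bar>) + ennreal (\<bar>?D (\<lambda>y. F2 y - F1 y) x\<bar> * \<bar>?k s x\<bar>)"
          by (simp add: ennreal_leI flip: ennreal_plus)
        also have "\<dots> \<le> ennreal (L / Gamma (1 - \<alpha>)) * S * ennreal (((t - s) powr (1 - \<alpha>) * (s - x) powr (\<alpha> - 1)) * 1 * ?w x)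
            + ennreal (L / Gamma (1 - \<alpha>)) * S * ennreal (1 * (t - s) powr (1 - \<alpha>) * ?w x)"
          using 2 st F2[of x] F21[of x] kernel_bound[of x s] frac_kernel_diff[of x s t]
          by (intro add_mono b) (auto simp: mult.assoc)
        also have "\<dots> = ennreal (L / Gamma (1 - \<alpha>)) * S * ennreal (increment_kernel \<alpha> l s t x)"
          using 2 st
          by (simp add: increment_kernel_def distrib_left[symmetric] ennreal_plus[symmetric] del: ennreal_plus)
             (simp add: algebra_simps)
        finally show ?thesis .
      next
        case 3
        then show ?thesis using st by auto
      qed
    qed
  qed
  also have "\<dots> = ennreal (L / Gamma (1 - \<alpha>)) * S * kernel_mass \<alpha> l s t"
    by (rule nn_integral_cmult) (simp add: increment_kernel_def)
  finally show ?thesis .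
qed

end

subsection \<open>Integrals of the increment kernel\<close>

text \<open>In units of \<open>(t - s) powr (1 - \<alpha>)\<close>, the summands bound the integral
  of the kernel over \<open>(s,t)\<close> and the integrals over \<open>(0,s)\<close> of its two
  terms.\<close>

definition increment_const :: "real \<Rightarrow> real \<Rightarrow> real" where
  "increment_const T \<alpha> = 1 / (1 - \<alpha>) + T powr (1 - \<alpha>) / (1 - \<alpha>) + 2 * (1 / (1 - \<alpha>) + 1 / \<alpha>)"

text \<open>The power of \<open>T\<close> accounts for the supremum norm, a value being an increment
  from \<open>0\<close>, and the \<open>1\<close> for the difference quotient.\<close>

definition holder_const :: "real \<Rightarrow> real \<Rightarrow> real" where
  "holder_const T \<alpha> = increment_const T \<alpha> * (T powr (1 - \<alpha>) + 1)"

lemma increment_const_pos: "0 < T \<Longrightarrow> 0 < \<alpha> \<Longrightarrow> \<alpha> < 1 / 2 \<Longrightarrow> 0 < increment_const T \<alpha>"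
  unfolding increment_const_def by (intro add_pos_pos mult_pos_pos divide_pos_pos) auto

lemma holder_const_pos: "0 < T \<Longrightarrow> 0 < \<alpha> \<Longrightarrow> \<alpha> < 1 / 2 \<Longrightarrow> 0 < holder_const T \<alpha>"
  unfolding holder_const_def by (intro mult_pos_pos increment_const_pos add_nonneg_pos) auto

text \<open>On \<open>(s,t)\<close> the weight is replaced by the larger
  \<open>(x - s) powr (- \<alpha>)\<close> to gain the power of \<open>t - s\<close>. On
  \<open>(0,s)\<close> that power is already a factor, and the Beta integral with exponents
  \<open>- \<alpha>\<close> and \<open>\<alpha> - 1\<close> is scale invariant, hence bounded
  uniformly in \<open>s\<close>.\<close>

lemma nn_integral_increment_kernel_0_le:
  fixes \<alpha> s t T :: real
  assumes \<alpha>: "0 < \<alpha>" "\<alpha> < 1 / 2" and st: "0 \<le> s" "s < t" "t \<le> T"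
  shows "kernel_mass \<alpha> 0 s t
    \<le> ennreal (increment_const T \<alpha> * (t - s) powr (1 - \<alpha>))"
proof -
  let ?a = "\<lambda>x. ennreal ((x - s) powr ((1 - \<alpha>) - 1)) * indicator {s<..<t} x"
  let ?b = "\<lambda>x. ennreal ((x - 0) powr ((1 - \<alpha>) - 1)) * indicator {0<..<s} x"
  let ?c = "\<lambda>x. ennreal ((x - 0) powr ((1 - \<alpha>) - 1) * (s - x) powr (\<alpha> - 1)) * indicator {0<..<s} x"
  let ?d = "(t - s) powr (1 - \<alpha>)"
  have pt: "ennreal (increment_kernel \<alpha> 0 s t x) \<le> ?a x + ennreal ?d * (?b x + ?c x)" for x
  proof -
    consider "s < x" "x < t" | "0 < x" "x < s" | "\<not> (s < x \<and> x < t)" "\<not> (0 < x \<and> x < s)" by blast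
    then show ?thesis
    proof cases
      case 1
      have "x powr (- \<alpha>) \<le> (x - s) powr (- \<alpha>)" using 1 st \<alpha> by (intro powr_mono2') auto
      then show ?thesis using 1 by (simp add: increment_kernel_def ennreal_leI)
    next
      case 2
      have "ennreal (u * (1 + v) * w) = ennreal u * (ennreal w + ennreal (w * v))" if "0 \<le> u" "0 \<le> v" "0 \<le> w" for u v w
        using that by (simp add: ennreal_mult algebra_simps)
      then show ?thesis using 2 by (simp add: increment_kernel_def)
    qed (auto simp: increment_kernel_def)
  qed
  have a: "(\<integral>\<^sup>+x. ?a x \<partial>lborel) = ennreal (?d / (1 - \<alpha>))"
    using integral_powr_left(3)[of s t "1 - \<alpha>"] st \<alpha> by simp
  have b: "(\<integral>\<^sup>+x. ?b x \<partial>lborel) \<le> ennreal (T powr (1 - \<alpha>) / (1 - \<alpha>))"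
  proof (cases "0 < s")
    case True
    have "(\<integral>\<^sup>+x. ?b x \<partial>lborel) = ennreal (s powr (1 - \<alpha>) / (1 - \<alpha>))"
      using integral_powr_left(3)[of 0 s "1 - \<alpha>"] True \<alpha> by simp
    also have "\<dots> \<le> ennreal (T powr (1 - \<alpha>) / (1 - \<alpha>))"
      using st \<alpha> by (intro ennreal_leI divide_right_mono powr_mono2) auto
    finally show ?thesis .
  qed (use st in simp)
  have c: "(\<integral>\<^sup>+x. ?c x \<partial>lborel) \<le> ennreal (2 * (1 / (1 - \<alpha>) + 1 / \<alpha>))"
  proof -
    have "(\<integral>\<^sup>+x. ?c x \<partial>lborel) \<le> ennreal (2 * (1 / (1 - \<alpha>) + 1 / \<alpha>) * (s - 0) powr (1 - \<alpha> + \<alpha> - 1))"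
      using st \<alpha> by (intro nn_integral_beta_le) auto
    also have "\<dots> \<le> ennreal (2 * (1 / (1 - \<alpha>) + 1 / \<alpha>) * 1)"
      using \<alpha> by (intro ennreal_leI mult_left_mono) auto
    finally show ?thesis by simp
  qed
  have "kernel_mass \<alpha> 0 s t \<le> (\<integral>\<^sup>+x. ?a x + ennreal ?d * (?b x + ?c x) \<partial>lborel)"
    by (intro nn_integral_mono pt)
  also have "\<dots> = (\<integral>\<^sup>+x. ?a x \<partial>lborel) + ennreal ?d * ((\<integral>\<^sup>+x. ?b x \<partial>lborel) + (\<integral>\<^sup>+x. ?c x \<partial>lborel))"
    by (simp add: nn_integral_add nn_integral_cmult)
  also have "\<dots> \<le> ennreal (?d / (1 - \<alpha>)) + ennreal ?d * (ennreal (T powr (1 - \<alpha>) / (1 - \<alpha>)) + ennreal (2 * (1 / (1 - \<alpha>) + 1 / \<alpha>)))"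
    unfolding a by (intro add_mono mult_left_mono b c) auto
  also have "\<dots> = ennreal (?d / (1 - \<alpha>) + ?d * (T powr (1 - \<alpha>) / (1 - \<alpha>) + 2 * (1 / (1 - \<alpha>) + 1 / \<alpha>)))"
  proof -
    have "ennreal p + ennreal q * (ennreal u + ennreal v) = ennreal (p + q * (u + v))"
      if "0 \<le> p" "0 \<le> q" "0 \<le> u" "0 \<le> v" for p q u v
      using that by (simp add: ennreal_mult)
    then show ?thesis using \<alpha> by (simp del: ennreal_plus)
  qed
  also have "?d / (1 - \<alpha>) + ?d * (T powr (1 - \<alpha>) / (1 - \<alpha>) + 2 * (1 / (1 - \<alpha>) + 1 / \<alpha>))
    = increment_const T \<alpha> * ?d"
    by (simp add: increment_const_def algebra_simps)
  finally show ?thesis .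
qed

text \<open>In the first factor, \<open>T powr \<alpha>\<close> comes from the value at
  \<open>t\<close> and the other summands from the integral of the increments; the second factor is
  the constant of \<open>nn_integral_exp_kernel_le\<close>.\<close>

definition exp_const :: "real \<Rightarrow> real \<Rightarrow> real" where
  "exp_const T \<alpha> = (T powr \<alpha> + 1 / \<alpha> + T powr (1 - \<alpha>) / (1 - 2 * \<alpha>) + 2 * (1 / \<alpha> + 1 / (1 - 2 * \<alpha>)))
     * (2 * (1 + 1 / (1 - 2 * \<alpha>)))"

lemma exp_const_pos: "0 < T \<Longrightarrow> 0 < \<alpha> \<Longrightarrow> \<alpha> < 1 / 2 \<Longrightarrow> 0 < exp_const T \<alpha>"
  unfolding exp_const_def by (intro mult_pos_pos add_pos_pos) auto

text \<open>Everything is reduced to multiples of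
  \<open>weight \<alpha> l x * (t - x) powr (- \<alpha>)\<close> by integrating in \<open>s\<close>
  before \<open>x\<close>. The range \<open>s < x\<close> contributes the integral of
  \<open>(t - s) powr (- \<alpha> - 1)\<close>, which stops short of \<open>t\<close>. For
  \<open>x < s\<close> the factor \<open>(t - s) powr (1 - \<alpha>)\<close> of the kernel softens
  this to \<open>(t - s) powr (- 2 * \<alpha>)\<close>, integrable alone and against
  \<open>(s - x) powr (\<alpha> - 1)\<close>.\<close>

lemma nn_integral_increment_kernel_exp_le:
  fixes \<alpha> t T l :: real
  assumes \<alpha>: "0 < \<alpha>" "\<alpha> < 1 / 2" and t: "0 \<le> t" "t \<le> T" and l: "1 \<le> l"
  shows "ennreal (exp (- l * t)) * (kernel_mass \<alpha> l 0 t
      + (\<integral>\<^sup>+s\<in>{0<..<t}. ennreal (1 / (t - s) powr (\<alpha> + 1)) * kernel_mass \<alpha> l s t \<partial>lborel))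
    \<le> ennreal (exp_const T \<alpha> * l powr (2 * \<alpha> - 1))"
proof -
  let ?w = "weight \<alpha> l"
  let ?u = "\<lambda>x. ennreal (x powr (- \<alpha>) * exp (l * x) * (t - x) powr (- \<alpha>)) * indicator {0<..<t} x"
  define c2 where "c2 = 1 / \<alpha> + T powr (1 - \<alpha>) / (1 - 2 * \<alpha>) + 2 * (1 / \<alpha> + 1 / (1 - 2 * \<alpha>))"
  have c2: "0 \<le> c2" using \<alpha> by (simp add: c2_def)
  \<comment> \<open>Milder powers of \<open>t - x\<close> are traded for powers of \<open>T\<close>:
    \<open>p = 0\<close> for the value at \<open>t\<close>, \<open>p = 2 * \<alpha> - 1\<close> for
    the integral of \<open>(t - s) powr (- 2 * \<alpha>)\<close>.\<close>
  have up: "(t - x) powr (- p) \<le> T powr (\<alpha> - p) * (t - x) powr (- \<alpha>)" if "0 < x" "x < t" "p \<le> \<alpha>" for x p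
  proof -
    have "(t - x) powr (- p) = (t - x) powr (\<alpha> - p) * (t - x) powr (- \<alpha>)"
      by (simp add: powr_add[symmetric])
    also have "\<dots> \<le> T powr (\<alpha> - p) * (t - x) powr (- \<alpha>)"
      using that t by (intro mult_right_mono powr_mono2) auto
    finally show ?thesis .
  qed
  have first: "kernel_mass \<alpha> l 0 t \<le> ennreal (T powr \<alpha>) * (\<integral>\<^sup>+x. ?u x \<partial>lborel)"
  proof -
    have "ennreal (increment_kernel \<alpha> l 0 t x) \<le> ennreal (T powr \<alpha>) * ?u x" for x
    proof (cases "0 < x \<and> x < t")
      case True
      have "?w x * 1 \<le> ?w x * (T powr \<alpha> * (t - x) powr (- \<alpha>))"
        using up[of x 0] True \<alpha> by (intro mult_left_mono) auto
      then show ?thesis using True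
        by (simp add: increment_kernel_def ennreal_mult[symmetric] ennreal_leI mult_ac)
    qed (auto simp: increment_kernel_def)
    then have "kernel_mass \<alpha> l 0 t \<le> (\<integral>\<^sup>+x. ennreal (T powr \<alpha>) * ?u x \<partial>lborel)"
      by (intro nn_integral_mono)
    then show ?thesis by (simp add: nn_integral_cmult)
  qed
  have second: "(\<integral>\<^sup>+s\<in>{0<..<t}. ennreal (1 / (t - s) powr (\<alpha> + 1)) * kernel_mass \<alpha> l s t \<partial>lborel)
      \<le> ennreal c2 * (\<integral>\<^sup>+x. ?u x \<partial>lborel)"
  proof -
    let ?K = "\<lambda>s x. ennreal (1 / (t - s) powr (\<alpha> + 1)) * indicator {0<..<t} s * ennreal (increment_kernel \<alpha> l s t x)"
    have [measurable]: "(\<lambda>p. increment_kernel \<alpha> l (snd p) t (fst p)) \<in> borel_measurable (lborel2)"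
      unfolding increment_kernel_def by measurable
    have "(\<integral>\<^sup>+s\<in>{0<..<t}. ennreal (1 / (t - s) powr (\<alpha> + 1)) * kernel_mass \<alpha> l s t \<partial>lborel)
      = (\<integral>\<^sup>+s. \<integral>\<^sup>+x. ?K s x \<partial>lborel \<partial>lborel)"
      by (intro nn_integral_cong, subst nn_integral_cmult) (auto simp: mult_ac increment_kernel_def)
    also have "\<dots> = (\<integral>\<^sup>+x. \<integral>\<^sup>+s. ?K s x \<partial>lborel \<partial>lborel)"
      by (rule lborel_pair.Fubini') (simp add: case_prod_beta)
    also have "\<dots> \<le> (\<integral>\<^sup>+x. ennreal c2 * ?u x \<partial>lborel)"
    proof (rule nn_integral_mono)
      fix x
      show "(\<integral>\<^sup>+s. ?K s x \<partial>lborel) \<le> ennreal c2 * ?u x"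
      proof (cases "0 < x \<and> x < t")
        case False
        then have "?K s x = 0" for s by (auto simp: increment_kernel_def indicator_def)
        then show ?thesis by (simp only:) simp
      next
        case True
        let ?a = "\<lambda>s. ennreal ((t - s) powr (- \<alpha> - 1)) * indicator {0<..<x} s"
        let ?b = "\<lambda>s. ennreal ((t - s) powr ((1 - 2 * \<alpha>) - 1)) * indicator {x<..<t} s"
        let ?c = "\<lambda>s. ennreal ((s - x) powr (\<alpha> - 1) * (t - s) powr ((1 - 2 * \<alpha>) - 1)) * indicator {x<..<t} s"
        have "?K s x \<le> ennreal (?w x) * (?a s + (?b s + ?c s))" for s
        proof -
          consider "0 < s" "s < x" | "x < s" "s < t" | "s = x" | "\<not> (0 < s \<and> s < t)" by linarith
          then show ?thesis
          proof cases
            case 1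
            have "1 / (t - s) powr (\<alpha> + 1) = (t - s) powr (- \<alpha> - 1)"
              using powr_minus_divide[of "t - s" "\<alpha> + 1"] minus_add_distrib[of \<alpha> 1] by (metis diff_conv_add_uminus)
            then show ?thesis using 1 True by (simp add: increment_kernel_def mult.commute)
          next
            case 2
            have "1 / (t - s) powr (\<alpha> + 1) * (t - s) powr (1 - \<alpha>) = (t - s) powr (- (\<alpha> + 1)) * (t - s) powr (1 - \<alpha>)"
              by (simp only: powr_minus_divide)
            also have "\<dots> = (t - s) powr (- 2 * \<alpha>)"
              by (simp add: powr_add[symmetric])
            finally have e: "1 / (t - s) powr (\<alpha> + 1) * (t - s) powr (1 - \<alpha>) = (t - s) powr (- 2 * \<alpha>)" .
            have "ennreal (1 / (t - s) powr (\<alpha> + 1)) * ennreal ((t - s) powr (1 - \<alpha>) * (1 + (s - x) powr (\<alpha> - 1)) * ?w x)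
              = ennreal ((1 / (t - s) powr (\<alpha> + 1) * (t - s) powr (1 - \<alpha>)) * (1 + (s - x) powr (\<alpha> - 1)) * ?w x)"
              by (subst ennreal_mult[symmetric]) (auto simp: mult_ac)
            also have "\<dots> = ennreal (?w x) * (ennreal ((t - s) powr (- 2 * \<alpha>)) + ennreal ((s - x) powr (\<alpha> - 1) * (t - s) powr (- 2 * \<alpha>)))"
            proof -
              have "ennreal (a * (1 + b) * d) = ennreal d * (ennreal a + ennreal (b * a))" if "0 \<le> a" "0 \<le> b" "0 \<le> d" for a b d
                using that by (simp add: ennreal_mult algebra_simps)
              then show ?thesis unfolding e by simp
            qed
            finally show ?thesis using 2 True by (simp add: increment_kernel_def)
          qed (use True in \<open>auto simp: increment_kernel_def\<close>)
        qed
        then have "(\<integral>\<^sup>+s. ?K s x \<partial>lborel) \<le> (\<integral>\<^sup>+s. ennreal (?w x) * (?a s + (?b s + ?c s)) \<partial>lborel)"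
          by (intro nn_integral_mono)
        also have "\<dots> = ennreal (?w x) * ((\<integral>\<^sup>+s. ?a s \<partial>lborel) + ((\<integral>\<^sup>+s. ?b s \<partial>lborel) + (\<integral>\<^sup>+s. ?c s \<partial>lborel)))"
          by (simp add: nn_integral_add nn_integral_cmult)
        also have "\<dots> \<le> ennreal (?w x) * (ennreal ((t - x) powr (- \<alpha>) / \<alpha>) + (ennreal ((t - x) powr (1 - 2 * \<alpha>) / (1 - 2 * \<alpha>))
            + ennreal (2 * (1 / \<alpha> + 1 / (1 - 2 * \<alpha>)) * (t - x) powr (\<alpha> + (1 - 2 * \<alpha>) - 1))))"
          using True \<alpha> integral_powr_right(3)[of x t "1 - 2 * \<alpha>"]
          by (intro mult_left_mono add_mono nn_integral_powr_tail nn_integral_beta_le) auto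
        also have "\<dots> = ennreal (?w x * ((t - x) powr (- \<alpha>) / \<alpha> + ((t - x) powr (1 - 2 * \<alpha>) / (1 - 2 * \<alpha>)
            + 2 * (1 / \<alpha> + 1 / (1 - 2 * \<alpha>)) * (t - x) powr (- \<alpha>))))"
        proof -
          have "ennreal p * (ennreal q + (ennreal u + ennreal v)) = ennreal (p * (q + (u + v)))"
            if "0 \<le> p" "0 \<le> q" "0 \<le> u" "0 \<le> v" for p q u v
            using that by (simp add: ennreal_mult)
          then show ?thesis using \<alpha> by simp
        qed
        also have "\<dots> \<le> ennreal (?w x * ((t - x) powr (- \<alpha>) / \<alpha> + (T powr (1 - \<alpha>) * (t - x) powr (- \<alpha>) / (1 - 2 * \<alpha>)
            + 2 * (1 / \<alpha> + 1 / (1 - 2 * \<alpha>)) * (t - x) powr (- \<alpha>))))"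
          using up[of x "2 * \<alpha> - 1"] True \<alpha>
          by (intro ennreal_leI mult_left_mono add_left_mono add_right_mono divide_right_mono) auto
        also have "\<dots> = ennreal (c2 * (?w x * (t - x) powr (- \<alpha>)))"
          unfolding c2_def by (simp add: algebra_simps)
        also have "\<dots> = ennreal c2 * ?u x"
          using True c2 by (simp add: ennreal_mult)
        finally show ?thesis .
      qed
    qed
    also have "\<dots> = ennreal c2 * (\<integral>\<^sup>+x. ?u x \<partial>lborel)"
      by (rule nn_integral_cmult) measurable
    finally show ?thesis .
  qed
  have u: "ennreal (exp (- l * t)) * (\<integral>\<^sup>+x. ?u x \<partial>lborel) \<le> ennreal (2 * (1 + 1 / (1 - 2 * \<alpha>)) * l powr (2 * \<alpha> - 1))"
  proof -
    have "ennreal (exp (- l * t)) * (\<integral>\<^sup>+x. ?u x \<partial>lborel) = (\<integral>\<^sup>+x. ennreal (exp (- l * t)) * ?u x \<partial>lborel)"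
      by (rule nn_integral_cmult[symmetric]) measurable
    also have "\<dots> = (\<integral>\<^sup>+x\<in>{0<..<t}. ennreal (exp (- l * (t - x)) * x powr (- \<alpha>) * (t - x) powr (- \<alpha>)) \<partial>lborel)"
    proof (intro nn_integral_cong)
      fix x
      have "exp (- l * (t - x)) = exp (- l * t) * exp (l * x)"
        by (simp add: exp_add[symmetric] algebra_simps)
      then show "ennreal (exp (- l * t)) * ?u x = ennreal (exp (- l * (t - x)) * x powr (- \<alpha>) * (t - x) powr (- \<alpha>)) * indicator {0<..<t} x"
        by (auto simp: indicator_def ennreal_mult[symmetric] mult_ac)
    qed
    also have "\<dots> \<le> ennreal (2 * (1 + 1 / (1 - 2 * \<alpha>)) * l powr (2 * \<alpha> - 1))"
      by (rule nn_integral_exp_kernel_le[OF l \<alpha>])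
    finally show ?thesis .
  qed
  have "ennreal (exp (- l * t)) * (kernel_mass \<alpha> l 0 t
      + (\<integral>\<^sup>+s\<in>{0<..<t}. ennreal (1 / (t - s) powr (\<alpha> + 1)) * kernel_mass \<alpha> l s t \<partial>lborel))
    \<le> ennreal (exp (- l * t)) * (ennreal (T powr \<alpha>) * (\<integral>\<^sup>+x. ?u x \<partial>lborel) + ennreal c2 * (\<integral>\<^sup>+x. ?u x \<partial>lborel))"
    by (intro mult_left_mono add_mono first second) auto
  also have "\<dots> = (ennreal (T powr \<alpha>) + ennreal c2) * (ennreal (exp (- l * t)) * (\<integral>\<^sup>+x. ?u x \<partial>lborel))"
    by (simp add: algebra_simps)
  also have "\<dots> \<le> (ennreal (T powr \<alpha>) + ennreal c2) * ennreal (2 * (1 + 1 / (1 - 2 * \<alpha>)) * l powr (2 * \<alpha> - 1))"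
    by (intro mult_left_mono u) auto
  also have "\<dots> = ennreal ((T powr \<alpha> + c2) * (2 * (1 + 1 / (1 - 2 * \<alpha>)) * l powr (2 * \<alpha> - 1)))"
    using c2 \<alpha> by (subst ennreal_mult) auto
  also have "(T powr \<alpha> + c2) * (2 * (1 + 1 / (1 - 2 * \<alpha>)) * l powr (2 * \<alpha> - 1)) = exp_const T \<alpha> * l powr (2 * \<alpha> - 1)"
    unfolding exp_const_def c2_def by simp
  finally show ?thesis .
qed

subsection \<open>Extension of the integrator to the right end point\<close>

lemma increasing_to:
  fixes s t :: real
  assumes "s < t"
  obtains u where "incseq u" "\<And>n. s < u n" "\<And>n. u n < t" "u \<longlonglongrightarrow> t"
proof -
  \<comment> \<open>\<open>Suc (Suc n)\<close> puts already \<open>u 0\<close> strictly to the right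
    of \<open>s\<close>.\<close>
  define u where "u n = t - (t - s) * inverse (real (Suc (Suc n)))" for n
  have "incseq u"
    unfolding incseq_def u_def using assms by (auto intro!: mult_left_mono le_imp_inverse_le)
  moreover have "s < u n" for n
  proof -
    have "(t - s) * inverse (real (Suc (Suc n))) < (t - s) * 1"
      using assms by (intro mult_strict_left_mono) (auto simp: field_simps)
    then show ?thesis by (simp add: u_def)
  qed
  moreover have "u n < t" for n using assms by (simp add: u_def)
  moreover have "u \<longlonglongrightarrow> t - (t - s) * 0"
    unfolding u_def
    by (intro tendsto_diff tendsto_mult tendsto_const LIMSEQ_Suc[OF LIMSEQ_inverse_real_of_nat])
  ultimately show ?thesis by (intro that[of u]) simp_all
qed

lemma nn_integral_le_limit:
  fixes f :: "real \<Rightarrow> ennreal"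
  assumes st: "s < t" and [measurable]: "f \<in> borel_measurable borel"
    and le: "\<And>u. s < u \<Longrightarrow> u < t \<Longrightarrow> (\<integral>\<^sup>+y\<in>{s<..<u}. f y \<partial>lborel) \<le> C"
  shows "(\<integral>\<^sup>+y\<in>{s<..<t}. f y \<partial>lborel) \<le> C"
proof -
  obtain u where u: "incseq u" "\<And>n. s < u n" "\<And>n. u n < t" "u \<longlonglongrightarrow> t"
    using increasing_to[OF st] by blast
  have "(\<lambda>n. \<integral>\<^sup>+y\<in>{s<..<u n}. f y \<partial>lborel) \<longlonglongrightarrow> (\<integral>\<^sup>+y\<in>{s<..<t}. f y \<partial>lborel)"
  proof (rule nn_integral_LIMSEQ)
    show "incseq (\<lambda>n y. f y * indicator {s<..<u n} y)"
      using u(1) by (auto simp: incseq_def le_fun_def indicator_def dest: order.strict_trans2)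
    show "(\<lambda>n. f y * indicator {s<..<u n} y) \<longlonglongrightarrow> f y * indicator {s<..<t} y" for y
    proof (cases "s < y \<and> y < t")
      case True
      then have "eventually (\<lambda>n. y < u n) sequentially"
        using u(4) order_tendstoD(1) by blast
      then have "eventually (\<lambda>n. f y * indicator {s<..<u n} y = f y * indicator {s<..<t} y) sequentially"
        by eventually_elim (use True in auto)
      then show ?thesis by (rule tendsto_eventually)
    next
      case False
      then have "f y * indicator {s<..<u n} y = f y * indicator {s<..<t} y" for n
        using u(3)[of n] by (auto simp: indicator_def)
      then show ?thesis by simp
    qed
  qed measurable
  then show ?thesis by (rule LIMSEQ_le_const2) (use le u in auto)
qed

text \<open>\<open>WT\<close> constrains \<open>g\<close> on the open interval, and the integral
  sees its left limits. The Hoelder bound makes \<open>g\<close> uniformly continuous on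
  \<open>(0,T)\<close>, which gives a limit at \<open>T\<close>; the two bounds then pass to
  \<open>t = T\<close> by continuity and by monotone convergence.\<close>

lemma WT_extension:
  fixes g :: "real \<Rightarrow> real^'m"
  assumes T: "0 < T" and \<alpha>: "0 < \<alpha>" "\<alpha> < 1 / 2" and g: "g \<in> WT T \<alpha>"
  obtains ge C where "0 \<le> C" "ge \<in> borel_measurable borel" "\<And>x. 0 < x \<Longrightarrow> x < T \<Longrightarrow> ge x = g x"
    "\<And>t. 0 < t \<Longrightarrow> t \<le> T \<Longrightarrow> (g \<longlongrightarrow> ge t) (at_left t)"
    "\<And>s t. 0 < s \<Longrightarrow> s < t \<Longrightarrow> t \<le> T \<Longrightarrow> norm (ge t - ge s) \<le> C * (t - s) powr (1 - \<alpha>)"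
    "\<And>s t. 0 < s \<Longrightarrow> s < t \<Longrightarrow> t \<le> T \<Longrightarrow>
      (\<integral>\<^sup>+y\<in>{s<..<t}. ennreal (norm (ge s - ge y) * (y - s) powr (\<alpha> - 2)) \<partial>lborel) \<le> ennreal C"
proof -
  let ?S = "SUP (s, t)\<in>{(s, t). 0 < s \<and> s < t \<and> t < T}.
        ennreal (norm (g t - g s) / (t - s) powr (1 - \<alpha>))
        + (\<integral>\<^sup>+y\<in>{s<..<t}. ennreal (norm (g y - g s) / (y - s) powr (2 - \<alpha>)) \<partial>lborel)"
  define C where "C = enn2real ?S"
  have C: "0 \<le> C" "?S = ennreal C" using g by (auto simp: C_def WT_def)
  have gm: "g \<in> borel_on T" using g by (simp add: WT_def)
  have le: "ennreal (norm (g t - g s) / (t - s) powr (1 - \<alpha>))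
        + (\<integral>\<^sup>+y\<in>{s<..<t}. ennreal (norm (g y - g s) / (y - s) powr (2 - \<alpha>)) \<partial>lborel) \<le> ennreal C"
    if "0 < s" "s < t" "t < T" for s t
    unfolding C(2)[symmetric] using that by (intro SUP_upper2[of "(s, t)"]) auto
  have hol: "norm (g t - g s) \<le> C * (t - s) powr (1 - \<alpha>)" if st: "0 < s" "s < t" "t < T" for s t
  proof -
    have "ennreal (norm (g t - g s) / (t - s) powr (1 - \<alpha>)) \<le> ennreal C"
      using le[OF st] by (rule order_trans[rotated]) simp
    then show ?thesis using C st by (simp add: ennreal_le_iff divide_le_eq)
  qed
  have "uniformly_continuous_on {0<..<T} g"
    unfolding uniformly_continuous_on_def
  proof (intro allI impI)
    fix e :: real assume e: "0 < e"
    \<comment> \<open>Chosen so that \<open>(C + 1) * d powr (1 - \<alpha>) = e\<close>; the added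
      \<open>1\<close> covers \<open>C = 0\<close>.\<close>
    define d where "d = (e / (C + 1)) powr (1 / (1 - \<alpha>))"
    have d: "0 < d" using e C by (simp add: d_def)
    have *: "norm (g y - g x) < e" if "0 < x" "x < y" "y < T" "y - x < d" for x y
    proof -
      have "(y - x) powr (1 - \<alpha>) < d powr (1 - \<alpha>)"
        using that \<alpha> by (intro powr_less_mono2) auto
      also have "d powr (1 - \<alpha>) = e / (C + 1)"
        using e C \<alpha> by (simp add: d_def powr_powr)
      finally have "(C + 1) * (y - x) powr (1 - \<alpha>) < e"
        using C by (simp add: field_simps)
      moreover have "norm (g y - g x) \<le> C * (y - x) powr (1 - \<alpha>)" using hol that by simp
      moreover have "0 \<le> (y - x) powr (1 - \<alpha>)" by simp
      ultimately show ?thesis by (simp only: distrib_right)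
    qed
    show "\<exists>d>0. \<forall>x\<in>{0<..<T}. \<forall>x'\<in>{0<..<T}. dist x' x < d \<longrightarrow> dist (g x') (g x) < e"
    proof (intro exI[of _ d] conjI d ballI impI)
      fix x x' assume "x \<in> {0<..<T}" "x' \<in> {0<..<T}" "dist x' x < d"
      then show "dist (g x') (g x) < e"
        using *[of x x'] *[of x' x] e
        by (cases x x' rule: linorder_cases) (auto simp: dist_norm norm_minus_commute)
    qed
  qed
  then obtain gl where gl: "(g \<longlongrightarrow> gl) (at T within {0<..<T})"
    by (rule uniformly_continuous_on_extension_at_closure[where x = T]) (use T in auto)
  have T_left: "at T within {0<..<T} = at_left T"
    by (rule at_within_nhd[of _ "{0<..}"]) (use T in auto)
  define ge where "ge x = (if 0 < x \<and> x < T then g x else if x = T then gl else 0)" for x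
  have ge: "ge x = g x" if "0 < x" "x < T" for x using that by (simp add: ge_def)
  have left: "(g \<longlongrightarrow> ge t) (at_left t)" if t: "0 < t" "t \<le> T" for t
  proof (cases "t = T")
    case True
    then show ?thesis using gl T by (simp add: T_left ge_def)
  next
    case False
    then have t': "t < T" using t by simp
    have "((\<lambda>s. C * (t - s) powr (1 - \<alpha>)) \<longlongrightarrow> C * 0) (at_left t)"
      using \<alpha> by (intro tendsto_mult tendsto_const)
        (auto intro!: tendsto_eq_intros simp: eventually_at_filter)
    then have "((\<lambda>s. C * (t - s) powr (1 - \<alpha>)) \<longlongrightarrow> 0) (at_left t)" by simp
    moreover have "eventually (\<lambda>s. norm (g s - g t) \<le> C * (t - s) powr (1 - \<alpha>)) (at_left t)"
      using eventually_at_left_real[OF t(1)]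
      by eventually_elim (use hol t' in \<open>auto simp: norm_minus_commute\<close>)
    ultimately have "((\<lambda>s. g s - g t) \<longlongrightarrow> 0) (at_left t)"
      by (rule Lim_null_comparison[rotated])
    then show ?thesis using ge t t' by (simp add: LIM_zero_iff)
  qed
  have ge_meas [measurable]: "ge \<in> borel_measurable borel"
  proof -
    have "(\<lambda>x. indicator {0..T} x *\<^sub>R g x) \<in> borel_measurable borel"
      using gm by (simp add: borel_measurable_restrict_space_iff)
    then have [measurable]: "(\<lambda>x. indicator {0..T} x *\<^sub>R g x) \<in> borel_measurable borel" .
    have "ge = (\<lambda>x. if 0 < x \<and> x < T then indicator {0..T} x *\<^sub>R g x else if x = T then gl else 0)"
      by (auto simp: ge_def fun_eq_iff)
    then show ?thesis by (simp only:) measurable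
  qed
  have ge_hol: "norm (ge t - ge s) \<le> C * (t - s) powr (1 - \<alpha>)" if st: "0 < s" "s < t" "t \<le> T" for s t
  proof (cases "t = T")
    case False
    then show ?thesis using hol ge st by simp
  next
    case True
    have "((\<lambda>u. norm (g u - ge s)) \<longlongrightarrow> norm (ge t - ge s)) (at_left t)"
      using left st by (intro tendsto_intros) auto
    moreover have "((\<lambda>u. C * (u - s) powr (1 - \<alpha>)) \<longlongrightarrow> C * (t - s) powr (1 - \<alpha>)) (at_left t)"
      using st by (intro tendsto_intros) auto
    moreover have "eventually (\<lambda>u. norm (g u - ge s) \<le> C * (u - s) powr (1 - \<alpha>)) (at_left t)"
      using eventually_at_left_real[OF st(2)]
      by eventually_elim (use hol ge st in auto)
    ultimately show ?thesis
      using tendsto_le[OF trivial_limit_at_left_real] by blast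
  qed
  have ge_var: "(\<integral>\<^sup>+y\<in>{s<..<t}. ennreal (norm (ge s - ge y) * (y - s) powr (\<alpha> - 2)) \<partial>lborel) \<le> ennreal C"
    if st: "0 < s" "s < t" "t \<le> T" for s t
  proof (rule nn_integral_le_limit[OF st(2)])
    fix u assume u: "s < u" "u < t"
    have "(\<integral>\<^sup>+y\<in>{s<..<u}. ennreal (norm (ge s - ge y) * (y - s) powr (\<alpha> - 2)) \<partial>lborel)
        = (\<integral>\<^sup>+y\<in>{s<..<u}. ennreal (norm (g y - g s) / (y - s) powr (2 - \<alpha>)) \<partial>lborel)"
    proof (intro nn_integral_cong)
      fix y
      have "(y - s) powr (\<alpha> - 2) = 1 / (y - s) powr (2 - \<alpha>)"
        using powr_minus_divide[of "y - s" "2 - \<alpha>"] by simp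
      then show "ennreal (norm (ge s - ge y) * (y - s) powr (\<alpha> - 2)) * indicator {s<..<u} y
          = ennreal (norm (g y - g s) / (y - s) powr (2 - \<alpha>)) * indicator {s<..<u} y"
        using st u ge by (auto simp: indicator_def norm_minus_commute)
    qed
    also have "\<dots> \<le> ennreal C"
      by (intro order_trans[OF _ le[of s u]]) (use st u in auto)
    finally show "(\<integral>\<^sup>+y\<in>{s<..<u}. ennreal (norm (ge s - ge y) * (y - s) powr (\<alpha> - 2)) \<partial>lborel) \<le> ennreal C" .
  qed measurable
  show ?thesis by (rule that[OF C(1) ge_meas ge left ge_hol ge_var])
qed

text \<open>The integral up to \<open>T\<close> needs the kernel at \<open>T\<close>, which the
  supremum in \<Lambda> does not contain. Along \<open>u n\<close> increasing to \<open>t\<close>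
  the boundary term converges by left continuity and the integral by dominated convergence.\<close>

lemma frac_kernel_bound_at_end:
  fixes g :: "real \<Rightarrow> real"
  assumes st: "s < t" and [measurable]: "g \<in> borel_measurable borel"
    and lim: "(g \<longlongrightarrow> g t) (at_left t)"
    and int: "set_integrable lborel {s<..<t} (\<lambda>y. (g s - g y) * (y - s) powr (\<alpha> - 2))"
    and le: "\<And>u. s < u \<Longrightarrow> u < t \<Longrightarrow> \<bar>frac_kernel \<alpha> g u s\<bar> \<le> L"
  shows "\<bar>frac_kernel \<alpha> g t s\<bar> \<le> L"
proof -
  obtain u where u: "incseq u" "\<And>n. s < u n" "\<And>n. u n < t" "u \<longlonglongrightarrow> t"
    using increasing_to[OF st] by blast
  let ?f = "\<lambda>y. (g s - g y) * (y - s) powr (\<alpha> - 2)"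
  have 1: "(\<lambda>n. LINT y:{s<..<u n}|lborel. ?f y) \<longlonglongrightarrow> (LINT y:{s<..<t}|lborel. ?f y)"
    unfolding set_lebesgue_integral_def
  proof (rule integral_dominated_convergence[where w = "\<lambda>y. norm (indicator {s<..<t} y *\<^sub>R ?f y)"])
    show "integrable lborel (\<lambda>y. norm (indicator {s<..<t} y *\<^sub>R ?f y))"
      using int unfolding set_integrable_def by (rule integrable_norm)
    show "AE y in lborel. (\<lambda>n. indicator {s<..<u n} y *\<^sub>R ?f y) \<longlonglongrightarrow> indicator {s<..<t} y *\<^sub>R ?f y"
    proof (rule AE_I2)
      fix y
      show "(\<lambda>n. indicator {s<..<u n} y *\<^sub>R ?f y) \<longlonglongrightarrow> indicator {s<..<t} y *\<^sub>R ?f y"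
      proof (cases "s < y \<and> y < t")
        case True
        then have "eventually (\<lambda>n. y < u n) sequentially"
          using u(4) order_tendstoD(1) by blast
        then have "eventually (\<lambda>n. indicator {s<..<u n} y *\<^sub>R ?f y = indicator {s<..<t} y *\<^sub>R ?f y) sequentially"
          by eventually_elim (use True in auto)
        then show ?thesis by (rule tendsto_eventually)
      next
        case False
        then have "indicator {s<..<u n} y *\<^sub>R ?f y = indicator {s<..<t} y *\<^sub>R ?f y" for n
          using u(3)[of n] by (auto simp: indicator_def)
        then show ?thesis by (simp only: tendsto_const)
      qed
    qed
    show "AE y in lborel. norm (indicator {s<..<u n} y *\<^sub>R ?f y) \<le> norm (indicator {s<..<t} y *\<^sub>R ?f y)" for n
      using u(3)[of n] by (intro AE_I2) (auto simp: indicator_def)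
  qed measurable
  have "filterlim u (at_left t) sequentially"
    using u(3,4) by (intro tendsto_imp_filterlim_at_left) auto
  then have 2: "(\<lambda>n. g (u n)) \<longlonglongrightarrow> g t" by (rule filterlim_compose[OF lim])
  have "(\<lambda>n. frac_kernel \<alpha> g (u n) s) \<longlonglongrightarrow> frac_kernel \<alpha> g t s"
    unfolding frac_kernel_def
    by (intro tendsto_add tendsto_mult tendsto_diff tendsto_const tendsto_powr 1 2 u(4)) (use st in auto)
  then have "(\<lambda>n. \<bar>frac_kernel \<alpha> g (u n) s\<bar>) \<longlonglongrightarrow> \<bar>frac_kernel \<alpha> g t s\<bar>"
    by (rule tendsto_rabs)
  then show ?thesis by (rule LIMSEQ_le_const2) (use le u in auto)
qed

lemma set_integral_vec_nth:
  fixes f :: "'a \<Rightarrow> real^'m"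
  assumes "set_integrable M A f"
  shows "(LINT x:A|M. f x) $ j = (LINT x:A|M. f x $ j)"
  using integral_bounded_linear[OF bounded_linear_vec_nth assms[unfolded set_integrable_def], of j]
  by (simp add: set_lebesgue_integral_def)

text \<open>\<Lambda> is defined through the vector-valued derivative. Since a component never
  exceeds the norm, the same \<open>L\<close> serves for all components, and the identity for
  \<open>Lambda\<close> also shows that it is finite.\<close>

lemma WT_frac_integrator:
  fixes g :: "real \<Rightarrow> real^'m"
  assumes T: "0 < T" and \<alpha>: "0 < \<alpha>" "\<alpha> < 1 / 2" and g: "g \<in> WT T \<alpha>"
  obtains ge C L where "\<And>j. frac_integrator T \<alpha> C L (\<lambda>x. ge x $ j)"
    and "\<And>j t x. 0 < x \<Longrightarrow> x < t \<Longrightarrow> t \<le> T \<Longrightarrow>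
      frac_deriv_t \<alpha> t (\<lambda>x. g x $ j) x = frac_kernel \<alpha> (\<lambda>x. ge x $ j) t x / Gamma \<alpha>"
    and "0 \<le> L" and "Lambda T \<alpha> g = ennreal (L / (Gamma \<alpha> * Gamma (1 - \<alpha>)))"
proof -
  obtain ge C where C: "0 \<le> C" and gm [measurable]: "ge \<in> borel_measurable borel" and ge: "\<And>x. 0 < x \<Longrightarrow> x < T \<Longrightarrow> ge x = g x"
    and left: "\<And>t. 0 < t \<Longrightarrow> t \<le> T \<Longrightarrow> (g \<longlongrightarrow> ge t) (at_left t)"
    and hol: "\<And>s t. 0 < s \<Longrightarrow> s < t \<Longrightarrow> t \<le> T \<Longrightarrow> norm (ge t - ge s) \<le> C * (t - s) powr (1 - \<alpha>)"
    and var: "\<And>s t. 0 < s \<Longrightarrow> s < t \<Longrightarrow> t \<le> T \<Longrightarrow>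
      (\<integral>\<^sup>+y\<in>{s<..<t}. ennreal (norm (ge s - ge y) * (y - s) powr (\<alpha> - 2)) \<partial>lborel) \<le> ennreal C"
    by (rule WT_extension[OF assms]) blast
  have G: "0 < Gamma \<alpha>" "0 < Gamma (1 - \<alpha>)" using \<alpha> by (auto intro!: Gamma_real_pos)
  have int: "set_integrable lborel {s<..<t} (\<lambda>y. (y - s) powr (\<alpha> - 2) *\<^sub>R (ge s - ge y))"
    if st: "0 < s" "s < t" "t \<le> T" for s t
    unfolding set_integrable_def
  proof (rule integrableI_bounded)
    have "(\<integral>\<^sup>+y. ennreal (norm (indicator {s<..<t} y *\<^sub>R ((y - s) powr (\<alpha> - 2) *\<^sub>R (ge s - ge y)))) \<partial>lborel)
      = (\<integral>\<^sup>+y\<in>{s<..<t}. ennreal (norm (ge s - ge y) * (y - s) powr (\<alpha> - 2)) \<partial>lborel)"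
      by (intro nn_integral_cong) (auto simp: indicator_def mult.commute)
    also have "\<dots> < \<infinity>" by (rule le_less_trans[OF var[OF st]]) simp
    finally show "(\<integral>\<^sup>+y. ennreal (norm (indicator {s<..<t} y *\<^sub>R ((y - s) powr (\<alpha> - 2) *\<^sub>R (ge s - ge y)))) \<partial>lborel) < \<infinity>" .
  qed measurable
  have powr_inv: "inverse (a powr b) = a powr (- b)" for a b :: real
    by (simp add: powr_minus)
  let ?k = "\<lambda>t x. (t - x) powr (\<alpha> - 1) *\<^sub>R (ge x - ge t)
    + (1 - \<alpha>) *\<^sub>R (LINT y:{x<..<t}|lborel. (y - x) powr (\<alpha> - 2) *\<^sub>R (ge x - ge y))"
  have fd: "frac_deriv_t \<alpha> t g x = (1 / Gamma \<alpha>) *\<^sub>R ?k t x" if x: "0 < x" "x < t" "t \<le> T" for t x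
  proof -
    have "Lim (at_left t) g = ge t"
      using x by (intro tendsto_Lim left) auto
    moreover have "(LINT y:{x<..<t}|lborel. (g x - g y) /\<^sub>R (y - x) powr (2 - \<alpha>))
        = (LINT y:{x<..<t}|lborel. (y - x) powr (\<alpha> - 2) *\<^sub>R (ge x - ge y))"
      using x ge by (intro set_lebesgue_integral_cong) (auto simp: powr_inv)
    ultimately show ?thesis
      using x ge[of x] by (simp add: frac_deriv_t_def powr_inv)
  qed
  have kj: "?k t x $ j = frac_kernel \<alpha> (\<lambda>x. ge x $ j) t x" if x: "0 < x" "x < t" "t \<le> T" for t x j
    unfolding vector_add_component vector_scaleR_component set_integral_vec_nth[OF int[OF x]] frac_kernel_def
    by (simp add: mult.commute)
  have fdj: "frac_deriv_t \<alpha> t (\<lambda>x. g x $ j) x = frac_kernel \<alpha> (\<lambda>x. ge x $ j) t x / Gamma \<alpha>"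
    if x: "0 < x" "x < t" "t \<le> T" for t x j
  proof -
    have "Lim (at_left t) (\<lambda>x. g x $ j) = ge t $ j"
      using x by (intro tendsto_Lim tendsto_vec_nth left) auto
    moreover have "(LINT y:{x<..<t}|lborel. (g x $ j - g y $ j) /\<^sub>R (y - x) powr (2 - \<alpha>))
        = (LINT y:{x<..<t}|lborel. (ge x $ j - ge y $ j) * (y - x) powr (\<alpha> - 2))"
      using x ge by (intro set_lebesgue_integral_cong) (auto simp: powr_inv mult.commute)
    ultimately show ?thesis
      using x ge[of x] by (simp add: frac_deriv_t_def frac_kernel_def powr_inv mult.commute)
  qed
  let ?S = "SUP (s, t)\<in>{(s, t). 0 < s \<and> s < t \<and> t < T}. ennreal (norm (frac_deriv_t \<alpha> t g s))"
  \<comment> \<open>The Hoelder bound and the variation bound contribute one \<open>C\<close> each.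
    This only shows that the supremum is finite; \<open>L\<close> is then defined from the supremum
    itself.\<close>
  have "?S \<le> ennreal (1 / Gamma \<alpha> * (C + C))"
  proof (rule SUP_least, clarify)
    fix x t assume "0 < x" "x < t" "t < T"
    then have x: "0 < x" "x < t" "t \<le> T" by auto
    have "norm ((t - x) powr (\<alpha> - 1) *\<^sub>R (ge x - ge t)) \<le> (t - x) powr (\<alpha> - 1) * (C * (t - x) powr (1 - \<alpha>))"
      using hol[OF x] by (simp add: norm_minus_commute mult_left_mono)
    also have "\<dots> = C * (t - x) powr 0" by (simp add: powr_add[symmetric] del: powr_zero_eq_one)
    also have "\<dots> \<le> C" using x by simp
    finally have 1: "norm ((t - x) powr (\<alpha> - 1) *\<^sub>R (ge x - ge t)) \<le> C" .
    have "ennreal (norm (LINT y:{x<..<t}|lborel. (y - x) powr (\<alpha> - 2) *\<^sub>R (ge x - ge y))) \<le> ennreal C"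
      by (rule order_trans[OF ennreal_norm_set_integral_le]) (use var[OF x] in \<open>simp add: mult.commute\<close>)
    then have "norm (LINT y:{x<..<t}|lborel. (y - x) powr (\<alpha> - 2) *\<^sub>R (ge x - ge y)) \<le> C"
      using C by simp
    then have "(1 - \<alpha>) * norm (LINT y:{x<..<t}|lborel. (y - x) powr (\<alpha> - 2) *\<^sub>R (ge x - ge y)) \<le> 1 * C"
      using \<alpha> by (intro mult_mono) auto
    then have "norm (?k t x) \<le> C + C"
      using 1 \<alpha> by (intro norm_triangle_le add_mono) auto
    then show "ennreal (norm (frac_deriv_t \<alpha> t g x)) \<le> ennreal (1 / Gamma \<alpha> * (C + C))"
      unfolding fd[OF x] using G by (intro ennreal_leI) (simp add: divide_right_mono)
  qed
  then have S_fin: "?S < \<infinity>" by (rule le_less_trans) simp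
  define L where "L = Gamma \<alpha> * enn2real ?S"
  have L: "0 \<le> L" using G by (simp add: L_def)
  have S: "?S = ennreal (L / Gamma \<alpha>)" using S_fin G by (simp add: L_def)
  have bound: "\<bar>frac_kernel \<alpha> (\<lambda>x. ge x $ j) t x\<bar> \<le> L" if x: "0 < x" "x < t" "t < T" for t x j
  proof -
    have "ennreal (norm (frac_deriv_t \<alpha> t g x)) \<le> ?S"
      using x by (intro SUP_upper2[of "(x, t)"]) auto
    then have "norm (frac_deriv_t \<alpha> t g x) \<le> L / Gamma \<alpha>"
      unfolding S using L G by simp
    then have "norm (?k t x) \<le> L"
      using fd[of x t] x G by (simp add: divide_le_cancel)
    then have "\<bar>?k t x $ j\<bar> \<le> L"
      using component_le_norm_cart order_trans by blast
    then show ?thesis using kj[of x t j] x by simp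
  qed
  show ?thesis
  proof (rule that[of C L ge])
    fix j
    show "frac_integrator T \<alpha> C L (\<lambda>x. ge x $ j)"
    proof
      show m: "(\<lambda>x. ge x $ j) \<in> borel_measurable borel"
        by (rule measurable_compose[OF gm borel_measurable_continuous_onI[OF
              linear_continuous_on[OF bounded_linear_vec_nth]]])
      show "\<bar>ge t $ j - ge s $ j\<bar> \<le> C * (t - s) powr (1 - \<alpha>)" if st: "0 < s" "s < t" "t \<le> T" for s t
        using component_le_norm_cart[of "ge t - ge s" j] hol[OF st] by simp
      show "(\<integral>\<^sup>+y\<in>{s<..<t}. ennreal (\<bar>ge s $ j - ge y $ j\<bar> * (y - s) powr (\<alpha> - 2)) \<partial>lborel) \<le> ennreal C"
        if st: "0 < s" "s < t" "t \<le> T" for s t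
      proof (rule order_trans[OF nn_integral_mono var[OF st]])
        show "ennreal (\<bar>ge s $ j - ge y $ j\<bar> * (y - s) powr (\<alpha> - 2)) * indicator {s<..<t} y
          \<le> ennreal (norm (ge s - ge y) * (y - s) powr (\<alpha> - 2)) * indicator {s<..<t} y" for y
          using component_le_norm_cart[of "ge s - ge y" j]
          by (intro mult_right_mono ennreal_leI) auto
      qed
      show "\<bar>frac_kernel \<alpha> (\<lambda>x. ge x $ j) t s\<bar> \<le> L" if st: "0 < s" "s < t" "t \<le> T" for s t
      proof (cases "t = T")
        case False
        then show ?thesis using bound st by simp
      next
        case True
        show ?thesis
        proof (rule frac_kernel_bound_at_end[OF st(2) m])
          have "((\<lambda>x. g x $ j) \<longlongrightarrow> ge t $ j) (at_left t)"
            using st by (intro tendsto_vec_nth left) auto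
          moreover have "eventually (\<lambda>x. g x $ j = ge x $ j) (at_left t)"
            using eventually_at_left_real[OF order.strict_trans[OF st(1,2)]]
            by eventually_elim (use ge st in auto)
          ultimately show "((\<lambda>x. ge x $ j) \<longlongrightarrow> ge t $ j) (at_left t)"
            by (rule Lim_transform_eventually)
          have "integrable lborel (\<lambda>y. (indicator {s<..<t} y *\<^sub>R ((y - s) powr (\<alpha> - 2) *\<^sub>R (ge s - ge y))) $ j)"
            using int[OF st] unfolding set_integrable_def
            by (rule integrable_bounded_linear[OF bounded_linear_vec_nth])
          then show "set_integrable lborel {s<..<t} (\<lambda>y. (ge s $ j - ge y $ j) * (y - s) powr (\<alpha> - 2))"
            unfolding set_integrable_def by (simp add: mult_ac)
        qed (use bound st True in auto)
      qed
    qed (use \<alpha> C in auto)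
  next
    show "Lambda T \<alpha> g = ennreal (L / (Gamma \<alpha> * Gamma (1 - \<alpha>)))"
      unfolding Lambda_def S using G L by (simp add: ennreal_mult[symmetric] mult.commute)
  qed (use fdj L in auto)
qed

subsection \<open>Norms of the integral\<close>

lemma frac_var_cong:
  assumes "\<And>y. 0 < y \<Longrightarrow> y \<le> x \<Longrightarrow> F y = G y" "0 < x"
  shows "frac_var \<alpha> F x = frac_var \<alpha> G x"
  unfolding frac_var_def using assms
  by (intro arg_cong2[where f = "(+)"] nn_integral_cong) (auto simp: indicator_def)

lemma frac_deriv_0_cong:
  assumes "\<And>y. 0 < y \<Longrightarrow> y \<le> x \<Longrightarrow> F y = G y" "0 < x"
  shows "frac_deriv_0 \<alpha> F x = frac_deriv_0 \<alpha> G x"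
proof -
  have "(LINT y:{0<..<x}|lborel. (F x - F y) /\<^sub>R (x - y) powr (\<alpha> + 1))
      = (LINT y:{0<..<x}|lborel. (G x - G y) /\<^sub>R (x - y) powr (\<alpha> + 1))"
    using assms by (intro set_lebesgue_integral_cong) auto
  then show ?thesis using assms by (simp add: frac_deriv_0_def)
qed

lemma frac_var_mono:
  assumes "norm (F x) \<le> norm (G x)" "\<And>y. norm (F x - F y) \<le> norm (G x - G y)"
  shows "frac_var \<alpha> F x \<le> frac_var \<alpha> G x"
  unfolding frac_var_def using assms
  by (intro add_mono nn_integral_mono mult_right_mono ennreal_leI divide_right_mono) auto

lemma norm_matrix_component_le: "norm (A $ i $ j) \<le> norm A" for A :: "real^'m^'d"
  using Finite_Cartesian_Product.norm_nth_le[of "A $ i" j] Finite_Cartesian_Product.norm_nth_le[of A i] by linarith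

text \<open>Integrands are measurable on \<open>[0,T]\<close> only. The cut-off makes each entry a
  Borel function on the line, as the one-dimensional lemmas require, without changing fractional
  derivatives at points of \<open>(0,T)\<close>.\<close>

abbreviation component :: "real \<Rightarrow> (real \<Rightarrow> real^'m^'d) \<Rightarrow> 'd \<Rightarrow> 'm \<Rightarrow> real \<Rightarrow> real" where
  "component T F i j x \<equiv> (indicator {0..T} x *\<^sub>R F x) $ i $ j"

lemma component_measurable:
  fixes F :: "real \<Rightarrow> real^'m^'d"
  assumes "F \<in> borel_on T"
  shows "component T F i j \<in> borel_measurable borel"
proof -
  have "(\<lambda>x. indicator {0..T} x *\<^sub>R F x) \<in> borel_measurable borel"
    using assms by (simp add: borel_measurable_restrict_space_iff)
  moreover have "(\<lambda>A::real^'m^'d. A $ i $ j) \<in> borel_measurable borel"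
    by (intro borel_measurable_continuous_onI linear_continuous_on
        bounded_linear_compose[OF bounded_linear_vec_nth bounded_linear_vec_nth])
  ultimately show ?thesis by (rule measurable_compose)
qed

lemma frac_var_component_le:
  fixes F :: "real \<Rightarrow> real^'m^'d"
  assumes "0 < x" "x < T"
  shows "frac_var \<alpha> (component T F i j) x \<le> frac_var \<alpha> F x"
proof -
  have "frac_var \<alpha> (component T F i j) x = frac_var \<alpha> (\<lambda>x. F x $ i $ j) x"
    using assms by (intro frac_var_cong) auto
  also have "\<dots> \<le> frac_var \<alpha> F x"
    by (intro frac_var_mono) (simp_all only: norm_matrix_component_le vector_minus_component[symmetric])
  finally show ?thesis .
qed

lemma frac_dominated_component: "frac_dominated T \<alpha> F \<Longrightarrow> frac_dominated T \<alpha> (component T F i j)"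
  by (erule frac_dominatedE) (blast intro: frac_dominatedI order_trans[OF frac_var_component_le])

lemma component_diff: "component T (\<lambda>y. F y - G y) i j = (\<lambda>y. component T F i j y - component T G i j y)"
  by (auto simp: scaleR_right_diff_distrib)

lemma stieltjes_integral_component:
  fixes F :: "real \<Rightarrow> real^'m^'d"
  assumes r: "r \<le> T"
    and fd: "\<And>x. 0 < x \<Longrightarrow> x < r \<Longrightarrow> frac_deriv_t \<alpha> r \<gamma> x = frac_kernel \<alpha> \<gamma>' r x / Gamma \<alpha>"
  shows "stieltjes_integral \<alpha> r (\<lambda>x. F x $ i $ j) \<gamma>
    = - frac_pairing \<alpha> (component T F i j) \<gamma>' r / Gamma \<alpha>"
proof -
  have "(LINT x:{0<..<r}|lborel. frac_deriv_0 \<alpha> (\<lambda>x. F x $ i $ j) x * frac_deriv_t \<alpha> r \<gamma> x)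
      = (LINT x:{0<..<r}|lborel. (frac_deriv_0 \<alpha> (component T F i j) x * frac_kernel \<alpha> \<gamma>' r x) / Gamma \<alpha>)"
  proof (intro set_lebesgue_integral_cong allI impI)
    fix x assume x: "x \<in> {0<..<r}"
    then have "frac_deriv_0 \<alpha> (\<lambda>x. F x $ i $ j) x = frac_deriv_0 \<alpha> (component T F i j) x"
      using r by (intro frac_deriv_0_cong) auto
    then show "frac_deriv_0 \<alpha> (\<lambda>x. F x $ i $ j) x * frac_deriv_t \<alpha> r \<gamma> x
      = (frac_deriv_0 \<alpha> (component T F i j) x * frac_kernel \<alpha> \<gamma>' r x) / Gamma \<alpha>"
      using fd[of x] x by simp
  qed simp
  then show ?thesis by (simp add: stieltjes_integral_def)
qed

text \<open>Linearity in the integrand holds where both pairings converge, which domination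
  guarantees.\<close>

lemma stieltjes_integral_mat_diff:
  fixes g :: "real \<Rightarrow> real^'m" and F1 F2 :: "real \<Rightarrow> real^'m^'d"
  assumes T: "0 < T" and \<alpha>: "0 < \<alpha>" "\<alpha> < 1 / 2" and g: "g \<in> WT T \<alpha>"
    and m: "F1 \<in> borel_on T" "F2 \<in> borel_on T"
    and t: "0 \<le> t" "t \<le> T" and dom: "frac_dominated T \<alpha> F1" "frac_dominated T \<alpha> F2"
  shows "stieltjes_integral_mat \<alpha> t (\<lambda>s. F1 s - F2 s) g
    = stieltjes_integral_mat \<alpha> t F1 g - stieltjes_integral_mat \<alpha> t F2 g"
proof -
  obtain ge C L where fi: "\<And>j. frac_integrator T \<alpha> C L (\<lambda>x. ge x $ j)"
    and fd: "\<And>j t x. 0 < x \<Longrightarrow> x < t \<Longrightarrow> t \<le> T \<Longrightarrow>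
      frac_deriv_t \<alpha> t (\<lambda>x. g x $ j) x = frac_kernel \<alpha> (\<lambda>x. ge x $ j) t x / Gamma \<alpha>"
    by (rule WT_frac_integrator[OF T \<alpha> g], rule that)
  have "stieltjes_integral \<alpha> t (\<lambda>x. (F1 x - F2 x) $ i $ j) (\<lambda>x. g x $ j)
      = stieltjes_integral \<alpha> t (\<lambda>x. F1 x $ i $ j) (\<lambda>x. g x $ j) - stieltjes_integral \<alpha> t (\<lambda>x. F2 x $ i $ j) (\<lambda>x. g x $ j)"
    for i j
  proof (cases "t = 0")
    case True
    then show ?thesis by (simp add: stieltjes_integral_def set_lebesgue_integral_def)
  next
    case False
    interpret frac_integrator T \<alpha> C L "\<lambda>x. ge x $ j" by (rule fi)
    let ?k = "frac_kernel \<alpha> (\<lambda>x. ge x $ j) t"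
    let ?p = "\<lambda>F x. frac_deriv_0 \<alpha> (component T F i j) x * ?k x"
    note dom' = frac_dominated_component[OF dom(1)] frac_dominated_component[OF dom(2)]
    have int: "set_integrable lborel {0<..<t} (?p F1)" "set_integrable lborel {0<..<t} (?p F2)"
      by (intro fractional_product_integrable component_measurable m dom'; use False t in simp)+
    have "(LINT x:{0<..<t}|lborel. ?p (\<lambda>y. F1 y - F2 y) x) = (LINT x:{0<..<t}|lborel. ?p F1 x - ?p F2 x)"
    proof (intro set_lebesgue_integral_cong allI impI)
      fix x assume "x \<in> {0<..<t}"
      then have x: "0 < x" "x < T" using t by auto
      have "frac_deriv_0 \<alpha> (component T (\<lambda>y. F1 y - F2 y) i j) x
          = frac_deriv_0 \<alpha> (component T F1 i j) x - frac_deriv_0 \<alpha> (component T F2 i j) x"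
        unfolding component_diff
        by (intro frac_deriv_0_diff component_measurable m frac_dominated_finite[OF dom'(1) x] frac_dominated_finite[OF dom'(2) x])
      then show "?p (\<lambda>y. F1 y - F2 y) x = ?p F1 x - ?p F2 x"
        by (simp only: left_diff_distrib)
    qed simp
    also have "\<dots> = (LINT x:{0<..<t}|lborel. ?p F1 x) - (LINT x:{0<..<t}|lborel. ?p F2 x)"
      by (rule set_integral_diff(2)[OF int])
    finally have lin: "(LINT x:{0<..<t}|lborel. ?p (\<lambda>y. F1 y - F2 y) x)
        = (LINT x:{0<..<t}|lborel. ?p F1 x) - (LINT x:{0<..<t}|lborel. ?p F2 x)" .
    have J: "stieltjes_integral \<alpha> t (\<lambda>x. F x $ i $ j) (\<lambda>x. g x $ j) = - (LINT x:{0<..<t}|lborel. ?p F x) / Gamma \<alpha>"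
      for F :: "real \<Rightarrow> real^'m^'d"
      using stieltjes_integral_component[OF t(2), of \<alpha> "\<lambda>x. g x $ j" "\<lambda>x. ge x $ j" F i j] fd[of _ t j] t by simp
    show ?thesis
      using J[of "\<lambda>y. F1 y - F2 y"] unfolding J lin by (simp add: diff_divide_distrib)
  qed
  then show ?thesis
    by (simp add: stieltjes_integral_mat_def vec_eq_iff sum_subtractf)
qed

text \<open>Each entry costs exactly one \<Lambda>: \<open>L\<close> is combined with the
  \<open>1 / Gamma \<alpha>\<close> and \<open>1 / Gamma (1 - \<alpha>)\<close> of the two
  fractional derivatives. The cardinalities count the entries, because the norm is bounded by the
  sum over all of them.\<close>

lemma ennreal_norm_stieltjes_integral_mat_le:
  fixes g :: "real \<Rightarrow> real^'m" and F1 F2 :: "real \<Rightarrow> real^'m^'d"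
  assumes T: "0 < T" and \<alpha>: "0 < \<alpha>" "\<alpha> < 1 / 2" and g: "g \<in> WT T \<alpha>"
    and m: "F1 \<in> borel_on T" "F2 \<in> borel_on T"
    and st: "0 \<le> s" "s < t" "t \<le> T"
    and dom: "frac_dominated T \<alpha> F1" "frac_dominated T \<alpha> F2"
    and F2: "\<And>x. 0 < x \<Longrightarrow> x < T \<Longrightarrow> frac_var \<alpha> F2 x \<le> ennreal (weight \<alpha> l x) * S"
    and F21: "\<And>x. 0 < x \<Longrightarrow> x < T \<Longrightarrow> frac_var \<alpha> (\<lambda>y. F2 y - F1 y) x
      \<le> ennreal ((t - s) powr (1 - \<alpha>) * weight \<alpha> l x) * S"
  shows "ennreal (norm (stieltjes_integral_mat \<alpha> t F2 g - stieltjes_integral_mat \<alpha> s F1 g))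
    \<le> of_nat (CARD('d) * CARD('m)) * (Lambda T \<alpha> g * S * kernel_mass \<alpha> l s t)"
proof -
  obtain ge C L where fi: "\<And>j. frac_integrator T \<alpha> C L (\<lambda>x. ge x $ j)"
    and fd: "\<And>j t x. 0 < x \<Longrightarrow> x < t \<Longrightarrow> t \<le> T \<Longrightarrow>
      frac_deriv_t \<alpha> t (\<lambda>x. g x $ j) x = frac_kernel \<alpha> (\<lambda>x. ge x $ j) t x / Gamma \<alpha>"
    and L: "0 \<le> L" and Lam: "Lambda T \<alpha> g = ennreal (L / (Gamma \<alpha> * Gamma (1 - \<alpha>)))"
    by (rule WT_frac_integrator[OF T \<alpha> g], rule that)
  have G: "0 < Gamma \<alpha>" "0 < Gamma (1 - \<alpha>)" using \<alpha> by (auto intro!: Gamma_real_pos)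
  let ?I = "kernel_mass \<alpha> l s t"
  let ?J = "\<lambda>t F i j. stieltjes_integral \<alpha> t (\<lambda>x. F x $ i $ j) (\<lambda>x. g x $ j)"
  have comp: "ennreal \<bar>?J t F2 i j - ?J s F1 i j\<bar> \<le> Lambda T \<alpha> g * S * ?I" for i j
  proof -
    interpret frac_integrator T \<alpha> C L "\<lambda>x. ge x $ j" by (rule fi)
    let ?c = "\<lambda>F. component T F i j"
    have J: "?J r F i j = - frac_pairing \<alpha> (?c F) (\<lambda>x. ge x $ j) r / Gamma \<alpha>"
      if r: "r \<le> T" for r and F :: "real \<Rightarrow> real^'m^'d"
      using stieltjes_integral_component[OF r, of \<alpha> "\<lambda>x. g x $ j" "\<lambda>x. ge x $ j" F i j] fd[of _ r j] r by simp
    have "\<bar>?J t F2 i j - ?J s F1 i j\<bar>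
        = 1 / Gamma \<alpha> * \<bar>frac_pairing \<alpha> (?c F2) (\<lambda>x. ge x $ j) t - frac_pairing \<alpha> (?c F1) (\<lambda>x. ge x $ j) s\<bar>"
      (is "_ = 1 / Gamma \<alpha> * \<bar>?X - ?Y\<bar>")
    proof -
      have "?J t F2 i j - ?J s F1 i j = - ((1 / Gamma \<alpha>) * (?X - ?Y))"
        using J[of t F2] J[of s F1] st by (simp add: diff_divide_distrib)
      then show ?thesis using G by (simp only: abs_minus_cancel abs_mult) simp
    qed
    then have "ennreal \<bar>?J t F2 i j - ?J s F1 i j\<bar> = ennreal (1 / Gamma \<alpha>) * ennreal \<bar>?X - ?Y\<bar>"
      using G by (simp add: ennreal_mult del: times_divide_eq_left)
    also have "\<dots> \<le> ennreal (1 / Gamma \<alpha>) * (ennreal (L / Gamma (1 - \<alpha>)) * S * ?I)"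
    proof (intro mult_left_mono fractional_product_increment component_measurable frac_dominated_component m dom st)
      fix x assume x: "0 < x" "x < T"
      show "frac_var \<alpha> (?c F2) x \<le> ennreal (weight \<alpha> l x) * S"
        by (rule order_trans[OF frac_var_component_le[OF x] F2[OF x]])
      show "frac_var \<alpha> (\<lambda>y. ?c F2 y - ?c F1 y) x \<le> ennreal ((t - s) powr (1 - \<alpha>) * weight \<alpha> l x) * S"
        unfolding component_diff[symmetric]
        by (rule order_trans[OF frac_var_component_le[OF x] F21[OF x]])
    qed simp
    also have "\<dots> = Lambda T \<alpha> g * S * ?I"
    proof -
      have "ennreal (1 / Gamma \<alpha>) * ennreal (L / Gamma (1 - \<alpha>)) = Lambda T \<alpha> g"
        unfolding Lam using G L by (simp add: ennreal_mult[symmetric])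
      then show ?thesis by (simp add: mult.assoc[symmetric])
    qed
    finally show ?thesis .
  qed
  have "norm (stieltjes_integral_mat \<alpha> t F2 g - stieltjes_integral_mat \<alpha> s F1 g)
      \<le> (\<Sum>i\<in>UNIV. \<bar>(stieltjes_integral_mat \<alpha> t F2 g - stieltjes_integral_mat \<alpha> s F1 g) $ i\<bar>)"
    by (rule norm_le_l1_cart)
  also have "\<dots> \<le> (\<Sum>i\<in>UNIV. \<Sum>j\<in>UNIV. \<bar>?J t F2 i j - ?J s F1 i j\<bar>)"
    by (intro sum_mono) (simp add: stieltjes_integral_mat_def sum_subtractf[symmetric] sum_abs)
  finally have "ennreal (norm (stieltjes_integral_mat \<alpha> t F2 g - stieltjes_integral_mat \<alpha> s F1 g))
      \<le> ennreal (\<Sum>i\<in>UNIV. \<Sum>j\<in>UNIV. \<bar>?J t F2 i j - ?J s F1 i j\<bar>)"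
    by (rule ennreal_leI)
  also have "\<dots> = (\<Sum>i\<in>(UNIV::'d set). \<Sum>j\<in>(UNIV::'m set). ennreal \<bar>?J t F2 i j - ?J s F1 i j\<bar>)"
    by (subst sum_ennreal[symmetric], simp add: sum_nonneg) (intro sum.cong refl sum_ennreal[symmetric], simp)
  also have "\<dots> \<le> (\<Sum>i\<in>(UNIV::'d set). \<Sum>j\<in>(UNIV::'m set). Lambda T \<alpha> g * S * ?I)"
    by (intro sum_mono comp)
  also have "\<dots> = of_nat (CARD('d) * CARD('m)) * (Lambda T \<alpha> g * S * ?I)"
    by (simp add: mult.assoc)
  finally show ?thesis .
qed

lemma stieltjes_integral_mat_0: "stieltjes_integral_mat \<alpha> 0 F g = 0"
  by (simp add: stieltjes_integral_mat_def stieltjes_integral_def set_lebesgue_integral_def vec_eq_iff)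

text \<open>
  The bound \<open>S\<close> may be infinite, and a vanishing \<open>\<Lambda>\<close> then still forces the integral to vanish. This
  is why integrability is a separate assumption.
\<close>

locale integrand_family =
  fixes T \<alpha> l :: real and g :: "real \<Rightarrow> real^'m" and F :: "real \<Rightarrow> real \<Rightarrow> real^'m^'d" and S :: ennreal
  assumes T: "0 < T" and \<alpha>: "0 < \<alpha>" "\<alpha> < 1 / 2" and g: "g \<in> WT T \<alpha>"
    and meas: "\<And>t. 0 \<le> t \<Longrightarrow> t \<le> T \<Longrightarrow> F t \<in> borel_on T"
    and dom: "\<And>t. 0 \<le> t \<Longrightarrow> t \<le> T \<Longrightarrow> frac_dominated T \<alpha> (F t)"
    and var: "\<And>t x. 0 \<le> t \<Longrightarrow> t \<le> T \<Longrightarrow> 0 < x \<Longrightarrow> x < T \<Longrightarrow>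
      frac_var \<alpha> (F t) x \<le> ennreal (weight \<alpha> l x) * S"
    and var_diff: "\<And>s t x. 0 \<le> s \<Longrightarrow> s < t \<Longrightarrow> t \<le> T \<Longrightarrow> 0 < x \<Longrightarrow> x < T \<Longrightarrow>
      frac_var \<alpha> (\<lambda>y. F t y - F s y) x \<le> ennreal ((t - s) powr (1 - \<alpha>) * weight \<alpha> l x) * S"
begin

abbreviation (input) "G t \<equiv> stieltjes_integral_mat \<alpha> t (F t) g"

lemma increment_le:
  assumes "0 \<le> s" "s < t" "t \<le> T"
  shows "ennreal (norm (G t - G s)) \<le> (of_nat (CARD('d) * CARD('m)) * (Lambda T \<alpha> g * S)) * kernel_mass \<alpha> l s t"
proof -
  let ?P = "of_nat (CARD('d) * CARD('m)) * (Lambda T \<alpha> g * S)"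
  have "ennreal (norm (G t - G s))
    \<le> of_nat (CARD('d) * CARD('m)) * (Lambda T \<alpha> g * S * kernel_mass \<alpha> l s t)"
    by (rule ennreal_norm_stieltjes_integral_mat_le[OF T \<alpha> g meas meas assms dom dom var var_diff])
       (use assms in auto)
  then show ?thesis by (simp only: mult.assoc)
qed

lemma value_le:
  assumes "0 \<le> t" "t \<le> T"
  shows "ennreal (norm (G t)) \<le> (of_nat (CARD('d) * CARD('m)) * (Lambda T \<alpha> g * S)) * kernel_mass \<alpha> l 0 t"
proof (cases "t = 0")
  let ?P = "of_nat (CARD('d) * CARD('m)) * (Lambda T \<alpha> g * S)"
  case False
  then show ?thesis using increment_le[of 0 t] assms by (simp add: stieltjes_integral_mat_0)
qed (simp add: stieltjes_integral_mat_0)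

text \<open>After division by \<open>(t - s) powr (\<alpha> + 1)\<close> and integration in
  \<open>s\<close>, the common factor separates, and the rest is the quantity of
  \<open>nn_integral_increment_kernel_exp_le\<close>.\<close>

lemma alpha_lambda_norm_le:
  assumes l: "1 \<le> l"
  shows "alpha_lambda_norm T \<alpha> l G \<le> (of_nat (CARD('d) * CARD('m)) * (Lambda T \<alpha> g * S)) * ennreal (exp_const T \<alpha> * l powr (2 * \<alpha> - 1))"
  unfolding alpha_lambda_norm_def
proof (rule SUP_least)
  let ?P = "of_nat (CARD('d) * CARD('m)) * (Lambda T \<alpha> g * S)"
  fix t assume "t \<in> {0..T}"
  then have t: "0 \<le> t" "t \<le> T" by auto
  let ?I = "\<lambda>s. kernel_mass \<alpha> l s t"
  have [measurable]: "(\<lambda>p. increment_kernel \<alpha> l (fst p) t (snd p)) \<in> borel_measurable (borel \<Otimes>\<^sub>M lborel)"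
    unfolding increment_kernel_def by measurable
  have "frac_int \<alpha> G t
      \<le> (\<integral>\<^sup>+s. ?P * (ennreal (1 / (t - s) powr (\<alpha> + 1)) * ?I s * indicator {0<..<t} s) \<partial>lborel)"
  proof (rule nn_integral_mono)
    fix s
    have "ennreal (norm (G t - G s) / (t - s) powr (\<alpha> + 1)) \<le> ?P * (ennreal (1 / (t - s) powr (\<alpha> + 1)) * ?I s)"
      if s: "0 < s" "s < t"
    proof -
      have "ennreal (norm (G t - G s) / (t - s) powr (\<alpha> + 1)) = ennreal (norm (G t - G s)) * ennreal (1 / (t - s) powr (\<alpha> + 1))"
        by (simp add: ennreal_mult[symmetric])
      also have "\<dots> \<le> ?P * ?I s * ennreal (1 / (t - s) powr (\<alpha> + 1))"
        using increment_le[of s t] s t by (intro mult_right_mono) auto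
      finally show ?thesis by (simp only: mult_ac)
    qed
    then show "ennreal (norm (G t - G s) / (t - s) powr (\<alpha> + 1)) * indicator {0<..<t} s
        \<le> ?P * (ennreal (1 / (t - s) powr (\<alpha> + 1)) * ?I s * indicator {0<..<t} s)"
      by (auto simp: indicator_def)
  qed
  also have "\<dots> = ?P * (\<integral>\<^sup>+s\<in>{0<..<t}. ennreal (1 / (t - s) powr (\<alpha> + 1)) * ?I s \<partial>lborel)"
    by (rule nn_integral_cmult) measurable
  finally have "ennreal (exp (- l * t)) * (ennreal (norm (G t))
      + frac_int \<alpha> G t)
    \<le> ennreal (exp (- l * t)) * (?P * ?I 0 + ?P * (\<integral>\<^sup>+s\<in>{0<..<t}. ennreal (1 / (t - s) powr (\<alpha> + 1)) * ?I s \<partial>lborel))"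
    using value_le[OF t] by (intro mult_left_mono add_mono) auto
  also have "\<dots> = ?P * (ennreal (exp (- l * t)) * (?I 0 + (\<integral>\<^sup>+s\<in>{0<..<t}. ennreal (1 / (t - s) powr (\<alpha> + 1)) * ?I s \<partial>lborel)))"
    by (simp only: distrib_left mult_ac)
  also have "\<dots> \<le> ?P * ennreal (exp_const T \<alpha> * l powr (2 * \<alpha> - 1))"
    by (intro mult_left_mono nn_integral_increment_kernel_exp_le \<alpha> t l) auto
  finally show "ennreal (exp (- l * t)) * (ennreal (norm (G t))
      + frac_int \<alpha> G t)
    \<le> ?P * ennreal (exp_const T \<alpha> * l powr (2 * \<alpha> - 1))" .
qed

text \<open>The Hoelder norm carries no exponential weight, hence the family with
  \<open>l = 0\<close>.\<close>

lemma holder_norm_le: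
  assumes l: "l = 0"
  shows "holder_norm T (1 - \<alpha>) G \<le> (of_nat (CARD('d) * CARD('m)) * (Lambda T \<alpha> g * S)) * ennreal (holder_const T \<alpha>)"
proof -
  let ?P = "of_nat (CARD('d) * CARD('m)) * (Lambda T \<alpha> g * S)"
  define C where "C = increment_const T \<alpha>"
  have C0: "0 \<le> C" unfolding C_def by (intro less_imp_le increment_const_pos T \<alpha>)
  have I: "kernel_mass \<alpha> l s t \<le> ennreal (C * (t - s) powr (1 - \<alpha>))"
    if "0 \<le> s" "s < t" "t \<le> T" for s t
    unfolding l C_def by (rule nn_integral_increment_kernel_0_le[OF \<alpha> that])
  have sup: "sup_norm T G \<le> ?P * ennreal (C * T powr (1 - \<alpha>))"
    unfolding sup_norm_def
  proof (rule SUP_least)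
    fix t assume "t \<in> {0..T}"
    then have t: "0 \<le> t" "t \<le> T" by auto
    show "ennreal (norm (G t)) \<le> ?P * ennreal (C * T powr (1 - \<alpha>))"
    proof (cases "t = 0")
      case False
      have "ennreal (norm (G t)) \<le> ?P * kernel_mass \<alpha> l 0 t"
        by (rule value_le[OF t])
      also have "\<dots> \<le> ?P * ennreal (C * (t - 0) powr (1 - \<alpha>))"
        using False t by (intro mult_left_mono I) auto
      also have "\<dots> \<le> ?P * ennreal (C * T powr (1 - \<alpha>))"
        using C0 t \<alpha> by (intro mult_left_mono ennreal_leI powr_mono2) auto
      finally show ?thesis .
    qed (simp add: stieltjes_integral_mat_0)
  qed
  have quotient: "(SUP (s, t)\<in>{(s, t). 0 \<le> s \<and> s < t \<and> t \<le> T}.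
          ennreal (norm (G t - G s) / (t - s) powr (1 - \<alpha>))) \<le> ?P * ennreal C"
  proof (rule SUP_least, clarify)
    fix s t assume st: "0 \<le> s" "s < t" "t \<le> T"
    have "ennreal (norm (G t - G s) / (t - s) powr (1 - \<alpha>)) = ennreal (norm (G t - G s)) * ennreal (1 / (t - s) powr (1 - \<alpha>))"
      by (simp add: ennreal_mult[symmetric])
    also have "\<dots> \<le> (?P * ennreal (C * (t - s) powr (1 - \<alpha>))) * ennreal (1 / (t - s) powr (1 - \<alpha>))"
      by (intro mult_right_mono order_trans[OF increment_le[OF st]] mult_left_mono I st) auto
    also have "\<dots> = ?P * ennreal C"
    proof -
      have "ennreal (C * (t - s) powr (1 - \<alpha>)) * ennreal (1 / (t - s) powr (1 - \<alpha>)) = ennreal C"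
        using st C0 by (subst ennreal_mult[symmetric]) auto
      then show ?thesis by (simp only: mult.assoc)
    qed
    finally show "ennreal (norm (G t - G s) / (t - s) powr (1 - \<alpha>)) \<le> ?P * ennreal C" .
  qed
  have split: "ennreal (holder_const T \<alpha>) = ennreal (C * T powr (1 - \<alpha>)) + ennreal C"
    using C0 by (simp add: holder_const_def C_def[symmetric] distrib_left)
  show ?thesis
    unfolding holder_norm_def split unfolding distrib_left by (rule add_mono[OF sup quotient])
qed

end

subsection \<open>Estimates for the coefficient\<close>

lemma vector_mean_value_bound:
  fixes f :: "real \<Rightarrow> 'e::real_normed_vector"
  assumes "convex S" "\<And>r. r \<in> S \<Longrightarrow> (f has_vector_derivative f' r) (at r within S)"
    and "\<And>r. r \<in> S \<Longrightarrow> norm (f' r) \<le> B" and "a \<in> S" "b \<in> S"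
  shows "norm (f a - f b) \<le> B * \<bar>a - b\<bar>"
proof -
  have "norm (f a - f b) \<le> B * norm (a - b)"
  proof (rule differentiable_bound[where f' = "\<lambda>r h. h *\<^sub>R f' r" and S = S])
    fix r assume r: "r \<in> S"
    show "(f has_derivative (\<lambda>h. h *\<^sub>R f' r)) (at r within S)"
      using assms(2)[OF r] by (simp add: has_vector_derivative_def)
    have "0 \<le> B" by (rule order_trans[OF norm_ge_zero assms(3)[OF r]])
    show "onorm (\<lambda>h. h *\<^sub>R f' r) \<le> B"
    proof (rule onorm_bound[OF \<open>0 \<le> B\<close>])
      show "norm (h *\<^sub>R f' r) \<le> B * norm h" for h
        using mult_left_mono[OF assms(3)[OF r], of "\<bar>h\<bar>"] by (simp add: mult.commute)
    qed
  qed (use assms in auto)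
  then show ?thesis by simp
qed

text \<open>Only partial derivatives are given, so the way from \<open>x\<close> to
  \<open>x + w\<close> is taken one coordinate at a time, \<open>S\<close> being the set of
  coordinates already moved. Each move costs at most \<open>B * norm w\<close>, which explains the
  factor \<open>CARD('d)\<close>.\<close>

lemma partial_derivatives_bound:
  fixes Q :: "real^'d \<Rightarrow> 'e::real_normed_vector"
  assumes der: "\<And>z i. ((\<lambda>r. Q (z + r *\<^sub>R axis i 1)) has_vector_derivative Q' i z) (at 0)"
    and bound: "\<And>z i. norm z \<le> R \<Longrightarrow> norm (Q' i z) \<le> B"
    and xw: "norm x + norm w \<le> R"
  shows "norm (Q (x + w) - Q x) \<le> real CARD('d) * B * norm w"
proof -
  have B: "0 \<le> B"
  proof -
    have "norm x \<le> R" using xw norm_ge_zero[of w] by linarith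
    then show ?thesis by (rule order_trans[OF norm_ge_zero bound])
  qed
  let ?p = "\<lambda>S. \<Sum>i\<in>S. w $ i *\<^sub>R axis i 1 :: real^'d"
  have p: "?p S $ k = (if k \<in> S then w $ k else 0)" for S k
    by (auto simp: axis_def if_distrib[of "\<lambda>u. _ * u"] sum.delta cong: if_cong)
  have step: "norm (Q (x + ?p S + w $ j *\<^sub>R axis j 1) - Q (x + ?p S)) \<le> B * norm w" if j: "j \<notin> S" for S j
  proof -
    let ?f = "\<lambda>r. Q (x + ?p S + r *\<^sub>R axis j 1)"
    let ?I = "closed_segment 0 (w $ j)"
    have "norm (?f (w $ j) - ?f 0) \<le> B * \<bar>w $ j - 0\<bar>"
    proof (rule vector_mean_value_bound[where S = ?I and f' = "\<lambda>r. Q' j (x + ?p S + r *\<^sub>R axis j 1)"])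
      fix r assume r: "r \<in> ?I"
      \<comment> \<open>The hypothesis differentiates at \<open>0\<close> along a line through any
        base point; the shift by \<open>r\<close> carries this over to any point of the
        segment.\<close>
      have "((\<lambda>h. h - r) has_vector_derivative 1) (at r)"
        by (auto intro!: derivative_eq_intros)
      from vector_diff_chain_at[OF this, of "\<lambda>h. Q (x + ?p S + r *\<^sub>R axis j 1 + h *\<^sub>R axis j 1)"]
      have "((\<lambda>h. Q (x + ?p S + r *\<^sub>R axis j 1 + (h - r) *\<^sub>R axis j 1)) has_vector_derivative
          Q' j (x + ?p S + r *\<^sub>R axis j 1)) (at r)"
        using der by (simp add: o_def)
      then show "(?f has_vector_derivative Q' j (x + ?p S + r *\<^sub>R axis j 1)) (at r within ?I)"
        by (simp add: algebra_simps has_vector_derivative_at_within)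
      \<comment> \<open>The displacement from \<open>x\<close> is bounded by \<open>w\<close> in
        every coordinate: equal on \<open>S\<close>, shortened at \<open>j\<close>, zero elsewhere.
        So the path stays in the ball of radius \<open>R\<close>.\<close>
      have "\<bar>r\<bar> \<le> \<bar>w $ j\<bar>" using r by (auto simp: closed_segment_eq_real_ivl split: if_splits)
      then have "norm (?p S + r *\<^sub>R axis j 1) \<le> norm w"
        using j by (intro norm_le_componentwise_cart) (unfold vector_add_component p, auto simp: axis_def)
      then have "norm (x + ?p S + r *\<^sub>R axis j 1) \<le> R"
        using xw norm_triangle_ineq[of x "?p S + r *\<^sub>R axis j 1"] by (simp add: add.assoc)
      then show "norm (Q' j (x + ?p S + r *\<^sub>R axis j 1)) \<le> B" by (rule bound)
    qed auto
    also have "\<dots> \<le> B * norm w"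
      using B component_le_norm_cart[of w j] by (intro mult_left_mono) auto
    finally show ?thesis by simp
  qed
  have "norm (Q (x + ?p S) - Q x) \<le> real (card S) * (B * norm w)" for S
  proof (induction S rule: finite_induct[OF finite])
    case (2 j S)
    have split: "Q (x + ?p (insert j S)) - Q x = (Q (x + ?p S + w $ j *\<^sub>R axis j 1) - Q (x + ?p S)) + (Q (x + ?p S) - Q x)"
      using 2 by (simp add: algebra_simps)
    have "norm (Q (x + ?p (insert j S)) - Q x) \<le> B * norm w + real (card S) * (B * norm w)"
      unfolding split by (rule norm_triangle_le[OF add_mono[OF step[OF 2(2)] 2(3)]])
    then show ?case using 2 by (simp add: algebra_simps)
  qed simp
  from this[of UNIV] have "norm (Q (x + ?p UNIV) - Q x) \<le> real CARD('d) * B * norm w"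
    by (simp add: mult.assoc)
  moreover have "?p UNIV = w" unfolding vec_eq_iff p by simp
  ultimately show ?thesis by simp
qed

text \<open>
  Split the left-hand side by means of \<open>\<psi> a - \<psi> b\<close> and of \<open>\<psi> (c - (a - b))\<close>. The point
  \<open>c - (a - b)\<close> may leave the ball of radius \<open>N\<close>, whence the larger ball in the hypothesis.
\<close>

lemma four_point_bound:
  fixes \<phi> \<psi> :: "real^'d \<Rightarrow> 'e::real_normed_vector"
  assumes \<phi>: "\<And>z i. ((\<lambda>r. \<phi> (z + r *\<^sub>R axis i 1)) has_vector_derivative \<phi>' i z) (at 0)"
    and \<psi>: "\<And>z i. ((\<lambda>r. \<psi> (z + r *\<^sub>R axis i 1)) has_vector_derivative \<psi>' i z) (at 0)"
    and lip: "\<And>x y. norm (\<psi> x - \<psi> y) \<le> K * norm (x - y)"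
    and hol: "\<And>x y i. norm x \<le> 5 * N \<Longrightarrow> norm y \<le> 5 * N \<Longrightarrow> norm (\<psi>' i x - \<psi>' i y) \<le> H * norm (x - y) powr \<delta>"
    and cross: "\<And>x i. norm (\<phi>' i x - \<psi>' i x) \<le> B"
    and N: "norm a \<le> N" "norm b \<le> N" "norm c \<le> N"
  shows "norm (\<phi> a - \<phi> b - (\<psi> c - \<psi> e)) \<le> K * norm ((a - b) - (c - e))
    + real CARD('d) * B * norm (a - b) + real CARD('d) * (H * norm (a - c) powr \<delta>) * norm (a - b)"
proof -
  \<comment> \<open>The coordinate path from \<open>b\<close> to \<open>a\<close> stays in the ball
    of radius \<open>3 * N\<close>, and the shift by \<open>c - a\<close> adds at most
    \<open>2 * N\<close>; this is the origin of \<open>5 * N\<close>. The point \<open>e\<close>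
    enters only through the global Lipschitz bound of \<open>\<psi>\<close>.\<close>
  have ab: "norm b + norm (a - b) \<le> 3 * N"
    using N norm_triangle_ineq4[of a b] by linarith
  let ?Q = "\<lambda>z. \<phi> z - \<psi> z"
  have 1: "norm (?Q (b + (a - b)) - ?Q b) \<le> real CARD('d) * B * norm (a - b)"
    by (rule partial_derivatives_bound[where R = "3 * N" and Q' = "\<lambda>i z. \<phi>' i z - \<psi>' i z"])
       (use cross ab in \<open>auto intro!: has_vector_derivative_diff \<phi> \<psi>\<close>)
  let ?P = "\<lambda>z. \<psi> z - \<psi> (z + (c - a))"
  have 2: "norm (?P (b + (a - b)) - ?P b) \<le> real CARD('d) * (H * norm (a - c) powr \<delta>) * norm (a - b)"
  proof (rule partial_derivatives_bound[where R = "3 * N" and Q' = "\<lambda>i z. \<psi>' i z - \<psi>' i (z + (c - a))"])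
    show "((\<lambda>r. ?P (z + r *\<^sub>R axis i 1)) has_vector_derivative \<psi>' i z - \<psi>' i (z + (c - a))) (at 0)" for z i
      using has_vector_derivative_diff[OF \<psi>[of z i] \<psi>[of "z + (c - a)" i]] by (simp add: algebra_simps)
    fix z :: "real^'d" and i assume z: "norm z \<le> 3 * N"
    have "norm (z + (c - a)) \<le> norm z + (norm c + norm a)"
      using norm_triangle_ineq[of z "c - a"] norm_triangle_ineq4[of c a] by linarith
    then have "norm (z + (c - a)) \<le> 5 * N" "norm z \<le> 5 * N"
      using z N norm_ge_zero[of z] by linarith+
    from hol[OF this(2,1), of i] show "norm (\<psi>' i z - \<psi>' i (z + (c - a))) \<le> H * norm (a - c) powr \<delta>"
      by simp
  qed (rule ab)
  have 3: "norm (\<psi> (c - (a - b)) - \<psi> e) \<le> K * norm ((a - b) - (c - e))"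
    using lip[of "c - (a - b)" e] norm_minus_commute[of "a - b" "c - e"] by (simp add: algebra_simps)
  have eq: "\<phi> a - \<phi> b - (\<psi> c - \<psi> e) = (\<psi> e - \<psi> (c - (a - b)))
      + (?Q (b + (a - b)) - ?Q b) + (?P (b + (a - b)) - ?P b)"
    by (simp add: algebra_simps)
  have "norm (\<phi> a - \<phi> b - (\<psi> c - \<psi> e)) \<le> norm (\<psi> e - \<psi> (c - (a - b))) + norm (?Q (b + (a - b)) - ?Q b) + norm (?P (b + (a - b)) - ?P b)"
    unfolding eq by (intro order_trans[OF norm_triangle_ineq] add_right_mono norm_triangle_ineq)
  also have "\<dots> \<le> K * norm ((a - b) - (c - e))
    + real CARD('d) * B * norm (a - b) + real CARD('d) * (H * norm (a - c) powr \<delta>) * norm (a - b)"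
    using 1 2 3 norm_minus_commute[of "\<psi> e"] by (intro add_mono) auto
  finally show ?thesis .
qed

section \<open>The fractional variation of a function with controlled increments\<close>

definition alpha_density :: "real \<Rightarrow> (real \<Rightarrow> 'a::real_normed_vector) \<Rightarrow> real \<Rightarrow> ennreal" where
  "alpha_density \<alpha> f x = ennreal (norm (f x))
     + frac_int \<alpha> f x"

text \<open>\<open>alpha_density\<close> is the expression under the supremum in the norm, so
  dividing by the weight \<open>exp (- l * x)\<close> bounds it at each point.\<close>

lemma alpha_density_le:
  assumes "0 \<le> x" "x \<le> T"
  shows "alpha_density \<alpha> f x \<le> ennreal (exp (l * x)) * alpha_lambda_norm T \<alpha> l f"
proof -
  have "ennreal (exp (l * x)) * ennreal (exp (- l * x)) = 1"
    by (simp add: ennreal_mult[symmetric] exp_add[symmetric])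
  then have "alpha_density \<alpha> f x = ennreal (exp (l * x)) * (ennreal (exp (- l * x)) * alpha_density \<alpha> f x)"
    by (simp add: mult.assoc[symmetric])
  also have "\<dots> \<le> ennreal (exp (l * x)) * alpha_lambda_norm T \<alpha> l f"
    unfolding alpha_lambda_norm_def alpha_density_def using assms
    by (intro mult_left_mono SUP_upper) auto
  finally show ?thesis .
qed

text \<open>Lets \<open>l = 0\<close> stand for the unweighted norm in the common estimates.\<close>

lemma alpha_norm_eq: "alpha_norm T \<alpha> f = alpha_lambda_norm T \<alpha> 0 f"
  by (simp add: alpha_norm_def alpha_lambda_norm_def)

lemma nn_integral_add_restrict:
  fixes p q :: "real \<Rightarrow> ennreal"
  assumes "p \<in> borel_on T" "q \<in> borel_on T"
    and "x \<le> T"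
  shows "(\<integral>\<^sup>+y\<in>{0<..<x}. p y + q y \<partial>lborel) = (\<integral>\<^sup>+y\<in>{0<..<x}. p y \<partial>lborel) + (\<integral>\<^sup>+y\<in>{0<..<x}. q y \<partial>lborel)"
proof -
  have [measurable]: "(\<lambda>y. p y * indicator {0..T} y) \<in> borel_measurable borel" "(\<lambda>y. q y * indicator {0..T} y) \<in> borel_measurable borel"
    using assms by (simp_all add: borel_measurable_restrict_space_iff_ennreal)
  have eq: "r y * indicator {0<..<x} y = (r y * indicator {0..T} y) * indicator {0<..<x} y" for r :: "real \<Rightarrow> ennreal" and y
    using assms(3) by (auto simp: indicator_def)
  have "(\<integral>\<^sup>+y\<in>{0<..<x}. p y + q y \<partial>lborel)
      = (\<integral>\<^sup>+y. (p y * indicator {0..T} y) * indicator {0<..<x} y + (q y * indicator {0..T} y) * indicator {0<..<x} y \<partial>lborel)"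
    using assms(3) by (intro nn_integral_cong) (auto simp: indicator_def)
  also have "\<dots> = (\<integral>\<^sup>+y. (p y * indicator {0..T} y) * indicator {0<..<x} y \<partial>lborel)
      + (\<integral>\<^sup>+y. (q y * indicator {0..T} y) * indicator {0<..<x} y \<partial>lborel)"
    by (rule nn_integral_add) measurable
  finally show ?thesis by (simp only: eq[symmetric])
qed

lemma frac_integrand_measurable:
  fixes f :: "real \<Rightarrow> 'a::euclidean_space"
  assumes [measurable]: "f \<in> borel_on T"
  shows "(\<lambda>y. ennreal (norm (f x - f y) powr \<delta> / (x - y) powr (\<alpha> + 1))) \<in> borel_on T"
    and "(\<lambda>y. ennreal (norm (f x - f y) / (x - y) powr (\<alpha> + 1))) \<in> borel_on T"
proof -
  have [measurable]: "(\<lambda>y. y) \<in> borel_on T"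
    by (rule measurable_restrict_space1) simp
  show "(\<lambda>y. ennreal (norm (f x - f y) powr \<delta> / (x - y) powr (\<alpha> + 1))) \<in> borel_on T"
    and "(\<lambda>y. ennreal (norm (f x - f y) / (x - y) powr (\<alpha> + 1))) \<in> borel_on T"
    by measurable
qed

lemma frac_var_diff_le:
  fixes F G :: "real \<Rightarrow> 'a::euclidean_space"
  assumes F: "F \<in> borel_on T" and G: "G \<in> borel_on T"
    and x: "x \<le> T"
  shows "frac_var \<alpha> (\<lambda>y. F y - G y) x \<le> frac_var \<alpha> F x + frac_var \<alpha> G x"
proof -
  let ?k = "\<lambda>F y. ennreal (norm (F x - F y) / (x - y) powr (\<alpha> + 1))"
  have "ennreal (norm (F x - G x) * x powr (- \<alpha>)) \<le> ennreal (norm (F x) * x powr (- \<alpha>)) + ennreal (norm (G x) * x powr (- \<alpha>))"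
  proof -
    have "norm (F x - G x) * x powr (- \<alpha>) \<le> (norm (F x) + norm (G x)) * x powr (- \<alpha>)"
      by (intro mult_right_mono norm_triangle_ineq4) simp
    then have "ennreal (norm (F x - G x) * x powr (- \<alpha>)) \<le> ennreal (norm (F x) * x powr (- \<alpha>) + norm (G x) * x powr (- \<alpha>))"
      by (intro ennreal_leI) (simp only: distrib_right)
    then show ?thesis by (simp only: ennreal_plus mult_nonneg_nonneg norm_ge_zero powr_ge_zero)
  qed
  moreover have "(\<integral>\<^sup>+y\<in>{0<..<x}. ennreal (norm (F x - G x - (F y - G y)) / (x - y) powr (\<alpha> + 1)) \<partial>lborel)
      \<le> (\<integral>\<^sup>+y\<in>{0<..<x}. ?k F y + ?k G y \<partial>lborel)"
  proof (intro nn_integral_mono mult_right_mono)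
    fix y
    have "norm (F x - G x - (F y - G y)) \<le> norm (F x - F y) + norm (G x - G y)"
      using norm_triangle_ineq4[of "F x - F y" "G x - G y"] by (simp add: algebra_simps)
    then have "norm (F x - G x - (F y - G y)) / (x - y) powr (\<alpha> + 1)
        \<le> norm (F x - F y) / (x - y) powr (\<alpha> + 1) + norm (G x - G y) / (x - y) powr (\<alpha> + 1)"
      unfolding add_divide_distrib[symmetric] by (rule divide_right_mono) simp
    then have "ennreal (norm (F x - G x - (F y - G y)) / (x - y) powr (\<alpha> + 1))
        \<le> ennreal (norm (F x - F y) / (x - y) powr (\<alpha> + 1) + norm (G x - G y) / (x - y) powr (\<alpha> + 1))"
      by (rule ennreal_leI)
    then show "ennreal (norm (F x - G x - (F y - G y)) / (x - y) powr (\<alpha> + 1)) \<le> ?k F y + ?k G y"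
      by simp
  qed simp
  moreover have "(\<integral>\<^sup>+y\<in>{0<..<x}. ?k F y + ?k G y \<partial>lborel) = (\<integral>\<^sup>+y\<in>{0<..<x}. ?k F y \<partial>lborel) + (\<integral>\<^sup>+y\<in>{0<..<x}. ?k G y \<partial>lborel)"
    by (rule nn_integral_add_restrict[OF frac_integrand_measurable(2)[OF F] frac_integrand_measurable(2)[OF G] x])
  ultimately have "frac_var \<alpha> (\<lambda>y. F y - G y) x
      \<le> (ennreal (norm (F x) * x powr (- \<alpha>)) + ennreal (norm (G x) * x powr (- \<alpha>)))
        + ((\<integral>\<^sup>+y\<in>{0<..<x}. ?k F y \<partial>lborel) + (\<integral>\<^sup>+y\<in>{0<..<x}. ?k G y \<partial>lborel))"
    unfolding frac_var_def by (intro add_mono) simp_all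
  also have "\<dots> = frac_var \<alpha> F x + frac_var \<alpha> G x"
    unfolding frac_var_def by (simp only: ac_simps)
  finally show ?thesis .
qed

lemma frac_dominated_diff:
  fixes F G :: "real \<Rightarrow> 'a::euclidean_space"
  assumes "F \<in> borel_on T" "G \<in> borel_on T" "frac_dominated T \<alpha> F" "frac_dominated T \<alpha> G"
  shows "frac_dominated T \<alpha> (\<lambda>y. F y - G y)"
proof -
  obtain c where c: "0 \<le> c" "\<And>x. 0 < x \<Longrightarrow> x < T \<Longrightarrow> frac_var \<alpha> F x \<le> ennreal (c * x powr (- \<alpha>))"
    using assms(3) by (rule frac_dominatedE) (rule that)
  obtain d where d: "0 \<le> d" "\<And>x. 0 < x \<Longrightarrow> x < T \<Longrightarrow> frac_var \<alpha> G x \<le> ennreal (d * x powr (- \<alpha>))"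
    using assms(4) by (rule frac_dominatedE) (rule that)
  show ?thesis
  proof (rule frac_dominatedI)
    fix x assume x: "0 < x" "x < T"
    have "frac_var \<alpha> (\<lambda>y. F y - G y) x \<le> ennreal (c * x powr (- \<alpha>)) + ennreal (d * x powr (- \<alpha>))"
      by (rule order_trans[OF frac_var_diff_le[OF assms(1,2)] add_mono[OF c(2)[OF x] d(2)[OF x]]]) (use x in simp)
    also have "\<dots> = ennreal ((c + d) * x powr (- \<alpha>))"
      unfolding distrib_right by (rule ennreal_plus[symmetric]) (use c d in auto)
    finally show "frac_var \<alpha> (\<lambda>y. F y - G y) x \<le> ennreal ((c + d) * x powr (- \<alpha>))" .
  qed (use c d in simp)
qed

text \<open>The shape of the increments covers both parts: the function \<open>u\<close> whose norm
  appears in the result, a local size \<open>p\<close>, the regularity in time of order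
  \<open>\<beta>\<close>, and a further increment \<open>q\<close>. The time term integrates to
  \<open>x powr (\<beta> - \<alpha>) / (\<beta> - \<alpha>)\<close>, which requires \<alpha> <
  \<beta>.\<close>

lemma frac_var_le:
  fixes F :: "real \<Rightarrow> 'b::real_normed_vector" and u f :: "real \<Rightarrow> 'a::euclidean_space"
  assumes \<alpha>: "0 < \<alpha>" "\<alpha> < \<beta>" and x: "0 < x" "x < T"
    and ab: "0 \<le> a" "0 \<le> b" "0 \<le> p"
    and u: "u \<in> borel_on T"
    and q: "(\<lambda>y. ennreal (q y / (x - y) powr (\<alpha> + 1))) \<in> borel_on T" "\<And>y. 0 \<le> q y"
    and F: "norm (F x) \<le> a * p"
    and dF: "\<And>y. 0 < y \<Longrightarrow> y < x \<Longrightarrow> norm (F x - F y) \<le> b * (norm (u x - u y) + p * ((x - y) powr \<beta> + q y))"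
  shows "frac_var \<alpha> F x \<le> ennreal ((a + b * (T powr \<alpha> + T powr \<beta> / (\<beta> - \<alpha>))) * x powr (- \<alpha>))
    * (ennreal p * (1 + (\<integral>\<^sup>+y\<in>{0<..<x}. ennreal (q y / (x - y) powr (\<alpha> + 1)) \<partial>lborel))
       + frac_int \<alpha> u x)"
proof -
  let ?I = "\<integral>\<^sup>+y\<in>{0<..<x}. ennreal (norm (u x - u y) / (x - y) powr (\<alpha> + 1)) \<partial>lborel"
  let ?Q = "\<integral>\<^sup>+y\<in>{0<..<x}. ennreal (q y / (x - y) powr (\<alpha> + 1)) \<partial>lborel"
  let ?k1 = "\<lambda>y. ennreal (norm (u x - u y) / (x - y) powr (\<alpha> + 1))"
  let ?k2 = "\<lambda>y. ennreal ((x - y) powr ((\<beta> - \<alpha>) - 1))"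
  let ?k3 = "\<lambda>y. ennreal (q y / (x - y) powr (\<alpha> + 1))"
  have k1: "?k1 \<in> borel_on T"
    by (rule frac_integrand_measurable(2)[OF u])
  have k2: "?k2 \<in> borel_on T"
    by (rule measurable_restrict_space1) measurable
  have cm: "(\<integral>\<^sup>+y\<in>{0<..<x}. c * k y \<partial>lborel) = c * (\<integral>\<^sup>+y\<in>{0<..<x}. k y \<partial>lborel)"
    if "k \<in> borel_on T" for c and k :: "real \<Rightarrow> ennreal"
  proof -
    define k' where "k' y = k y * indicator {0..T} y" for y
    have [measurable]: "k' \<in> borel_measurable borel"
      using that unfolding k'_def by (simp add: borel_measurable_restrict_space_iff_ennreal)
    have k': "k y * indicator {0<..<x} y = k' y * indicator {0<..<x} y" for y
      using x by (auto simp: indicator_def k'_def)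
    have "(\<integral>\<^sup>+y\<in>{0<..<x}. c * k y \<partial>lborel) = (\<integral>\<^sup>+y. c * (k' y * indicator {0<..<x} y) \<partial>lborel)"
      by (simp only: mult.assoc k')
    also have "\<dots> = c * (\<integral>\<^sup>+y. k' y * indicator {0<..<x} y \<partial>lborel)"
      by (rule nn_integral_cmult) measurable
    also have "\<dots> = c * (\<integral>\<^sup>+y\<in>{0<..<x}. k y \<partial>lborel)"
      by (simp only: k')
    finally show ?thesis .
  qed
  have "frac_int \<alpha> F x
      \<le> (\<integral>\<^sup>+y\<in>{0<..<x}. ennreal b * ?k1 y + ennreal (b * p) * (?k2 y + ?k3 y) \<partial>lborel)"
  proof (intro nn_integral_mono)
    fix y
    show "ennreal (norm (F x - F y) / (x - y) powr (\<alpha> + 1)) * indicator {0<..<x} y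
      \<le> (ennreal b * ?k1 y + ennreal (b * p) * (?k2 y + ?k3 y)) * indicator {0<..<x} y"
    proof (cases "0 < y \<and> y < x")
      case True
      let ?w = "(x - y) powr (\<alpha> + 1)"
      have "norm (F x - F y) / ?w \<le> b * (norm (u x - u y) + p * ((x - y) powr \<beta> + q y)) / ?w"
        using dF True by (intro divide_right_mono) auto
      also have "\<dots> = b * (norm (u x - u y) / ?w) + b * p * ((x - y) powr \<beta> / ?w + q y / ?w)"
        by (simp add: add_divide_distrib distrib_left)
      also have "(x - y) powr \<beta> / ?w = (x - y) powr ((\<beta> - \<alpha>) - 1)"
        by (simp add: powr_diff[symmetric] diff_diff_eq)
      finally have "ennreal (norm (F x - F y) / ?w)
          \<le> ennreal (b * (norm (u x - u y) / ?w) + b * p * ((x - y) powr ((\<beta> - \<alpha>) - 1) + q y / ?w))"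
        by (rule ennreal_leI)
      also have "\<dots> = ennreal b * ?k1 y + ennreal (b * p) * (?k2 y + ?k3 y)"
      proof -
        have distr: "ennreal (b * r + b * p * (v + w)) = ennreal b * ennreal r + ennreal (b * p) * (ennreal v + ennreal w)"
          if "0 \<le> r" "0 \<le> v" "0 \<le> w" for r v w
          using that ab by (subst ennreal_mult_add_mult) auto
        show ?thesis by (rule distr) (use q(2) in auto)
      qed
      finally show ?thesis using True by simp
    qed simp
  qed
  also have "\<dots> = ennreal b * ?I + ennreal (b * p) * ((\<integral>\<^sup>+y\<in>{0<..<x}. ?k2 y \<partial>lborel) + ?Q)"
  proof -
    have "(\<integral>\<^sup>+y\<in>{0<..<x}. ennreal b * ?k1 y + ennreal (b * p) * (?k2 y + ?k3 y) \<partial>lborel)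
        = (\<integral>\<^sup>+y\<in>{0<..<x}. ennreal b * ?k1 y \<partial>lborel) + (\<integral>\<^sup>+y\<in>{0<..<x}. ennreal (b * p) * (?k2 y + ?k3 y) \<partial>lborel)"
      by (intro nn_integral_add_restrict[where T = T]) (use x k1 k2 q(1) in simp_all)
    moreover have "(\<integral>\<^sup>+y\<in>{0<..<x}. ennreal b * ?k1 y \<partial>lborel) = ennreal b * ?I"
      by (rule cm[OF k1])
    moreover have "(\<integral>\<^sup>+y\<in>{0<..<x}. ennreal (b * p) * (?k2 y + ?k3 y) \<partial>lborel)
        = ennreal (b * p) * (\<integral>\<^sup>+y\<in>{0<..<x}. ?k2 y + ?k3 y \<partial>lborel)"
      by (rule cm) (use k2 q(1) in simp)
    moreover have "(\<integral>\<^sup>+y\<in>{0<..<x}. ?k2 y + ?k3 y \<partial>lborel) = (\<integral>\<^sup>+y\<in>{0<..<x}. ?k2 y \<partial>lborel) + ?Q"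
      using x by (intro nn_integral_add_restrict[OF k2 q(1)]) simp
    ultimately show ?thesis by (simp only:)
  qed
  also have "(\<integral>\<^sup>+y\<in>{0<..<x}. ?k2 y \<partial>lborel) = ennreal (x powr (\<beta> - \<alpha>) / (\<beta> - \<alpha>))"
    using integral_powr_right(3)[of 0 x "\<beta> - \<alpha>"] x \<alpha> by simp
  finally have int: "frac_int \<alpha> F x
      \<le> ennreal b * ?I + ennreal (b * p) * (ennreal (x powr (\<beta> - \<alpha>) / (\<beta> - \<alpha>)) + ?Q)" .
  define X where "X = x powr (- \<alpha>)"
  \<comment> \<open>\<open>X1\<close> and \<open>X2\<close> bring terms without a singularity at
    \<open>0\<close> to the common factor \<open>x powr (- \<alpha>)\<close>, at the price of powers
    of \<open>T\<close>.\<close>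
  have X1: "1 \<le> T powr \<alpha> * X"
  proof -
    have "1 = x powr \<alpha> * X" using x by (simp add: X_def powr_add[symmetric])
    also have "\<dots> \<le> T powr \<alpha> * X" using x \<alpha> by (intro mult_right_mono powr_mono2) (auto simp: X_def)
    finally show ?thesis .
  qed
  have X2: "x powr (\<beta> - \<alpha>) \<le> T powr \<beta> * X"
  proof -
    have "x powr (\<beta> - \<alpha>) = x powr \<beta> * X" by (simp add: X_def powr_add[symmetric])
    also have "\<dots> \<le> T powr \<beta> * X" using x \<alpha> by (intro mult_right_mono powr_mono2) (auto simp: X_def)
    finally show ?thesis .
  qed
  have X0: "0 \<le> X" by (simp add: X_def)
  define \<kappa> where "\<kappa> = a + b * (T powr \<alpha> + T powr \<beta> / (\<beta> - \<alpha>))"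
  have \<kappa>0: "0 \<le> \<kappa>" using ab \<alpha> by (simp add: \<kappa>_def)
  define c1 c2 where "c1 = b * T powr \<alpha>" and "c2 = b * (T powr \<beta> / (\<beta> - \<alpha>))"
  have c: "0 \<le> c1" "0 \<le> c2" using ab \<alpha> by (simp_all add: c1_def c2_def)
  have \<kappa>: "\<kappa> = a + c1 + c2" unfolding \<kappa>_def c1_def c2_def by (simp only: distrib_left add.assoc)
  have bX: "b \<le> \<kappa> * X"
  proof -
    have "b * 1 \<le> b * (T powr \<alpha> * X)" by (rule mult_left_mono[OF X1 ab(2)])
    also have "\<dots> = c1 * X" by (simp add: c1_def)
    also have "\<dots> \<le> \<kappa> * X" using c ab X0 unfolding \<kappa> by (intro mult_right_mono) auto
    finally show ?thesis by simp
  qed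
  have ax: "a * p * X + b * p * (x powr (\<beta> - \<alpha>) / (\<beta> - \<alpha>)) \<le> \<kappa> * X * p"
  proof -
    have "b * p * (x powr (\<beta> - \<alpha>) / (\<beta> - \<alpha>)) \<le> b * p * (T powr \<beta> * X / (\<beta> - \<alpha>))"
      using X2 ab \<alpha> by (intro mult_left_mono divide_right_mono) auto
    also have "\<dots> = c2 * (X * p)" by (simp add: c2_def)
    finally have "a * p * X + b * p * (x powr (\<beta> - \<alpha>) / (\<beta> - \<alpha>)) \<le> a * p * X + c2 * (X * p)"
      by (rule add_left_mono)
    also have "\<dots> = (a + c2) * (X * p)" by (simp add: algebra_simps)
    also have "\<dots> \<le> \<kappa> * (X * p)" using c ab X0 unfolding \<kappa> by (intro mult_right_mono) auto
    finally show ?thesis by (simp only: mult.assoc)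
  qed
  have "frac_var \<alpha> F x \<le> ennreal (a * p * X) + (ennreal b * ?I + ennreal (b * p) * (ennreal (x powr (\<beta> - \<alpha>) / (\<beta> - \<alpha>)) + ?Q))"
    unfolding frac_var_def X_def[symmetric]
    by (intro add_mono ennreal_leI mult_right_mono F int X0)
  also have "\<dots> = ennreal (a * p * X + b * p * (x powr (\<beta> - \<alpha>) / (\<beta> - \<alpha>))) + ennreal b * ?I + ennreal b * (ennreal p * ?Q)"
  proof -
    have "ennreal (a * p * X + b * p * (x powr (\<beta> - \<alpha>) / (\<beta> - \<alpha>)))
        = ennreal (a * p * X) + ennreal (b * p) * ennreal (x powr (\<beta> - \<alpha>) / (\<beta> - \<alpha>))"
      using ab \<alpha> X0 by (subst ennreal_plus) (auto simp: ennreal_mult[symmetric])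
    moreover have "ennreal (b * p) = ennreal b * ennreal p" using ab by (simp add: ennreal_mult)
    ultimately show ?thesis by (simp only: distrib_left ac_simps)
  qed
  also have "\<dots> \<le> ennreal (\<kappa> * X * p) + ennreal (\<kappa> * X) * ?I + ennreal (\<kappa> * X) * (ennreal p * ?Q)"
    by (intro add_mono ennreal_leI mult_right_mono bX ax) auto
  also have "\<dots> = ennreal (\<kappa> * X) * (ennreal p * (1 + ?Q) + ?I)"
  proof -
    have "ennreal (\<kappa> * X * p) = ennreal (\<kappa> * X) * ennreal p"
      using \<kappa>0 X0 ab by (intro ennreal_mult) auto
    then show ?thesis by (simp only: distrib_left mult_1_right mult_1_left ac_simps)
  qed
  finally show ?thesis unfolding \<kappa>_def X_def .
qed

section \<open>Consequences of (H1) for differences of the coefficient\<close>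

lemma H1_measurable:
  assumes H: "H1 T \<beta> \<mu> \<delta> K KN \<sigma>" and t: "0 \<le> t" "t \<le> T"
    and f: "f \<in> borel_on T"
  shows "(\<lambda>s. \<sigma> t s (f s)) \<in> borel_on T"
proof -
  have [measurable]: "(\<lambda>s. s) \<in> borel_on T"
    by (rule measurable_restrict_space1) simp
  note f[measurable]
  have "(\<lambda>s. (t, s, f s)) \<in> measurable (restrict_space borel {0..T}) (restrict_space borel ({0..T} \<times> {0..T} \<times> UNIV))"
  proof (rule measurable_restrict_space2)
    show "(\<lambda>s. (t, s, f s)) \<in> borel_on T"
      by measurable
  qed (use t in \<open>auto simp: space_restrict_space\<close>)
  moreover have "(\<lambda>(t, s, x). \<sigma> t s x) \<in> borel_measurable (restrict_space borel ({0..T} \<times> {0..T} \<times> UNIV))"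
    using H unfolding H1_def by blast
  ultimately have "(\<lambda>s. (\<lambda>(t, s, x). \<sigma> t s x) (t, s, f s)) \<in> borel_on T"
    by (rule measurable_compose)
  then show ?thesis by simp
qed

text \<open>Names the derivatives whose existence \<open>H1\<close> asserts and separates its
  estimates.\<close>

locale volterra_coefficient =
  fixes T \<beta> \<mu> \<delta> K :: real and KN :: "real \<Rightarrow> real" and \<sigma> \<sigma>t :: "real \<Rightarrow> real \<Rightarrow> real^'d \<Rightarrow> real^'m^'d"
    and \<sigma>x \<sigma>xt :: "'d \<Rightarrow> real \<Rightarrow> real \<Rightarrow> real^'d \<Rightarrow> real^'m^'d"
  assumes K_pos: "0 < K" and KN_pos: "\<And>N. 0 \<le> N \<Longrightarrow> 0 < KN N"
    and dt: "\<And>t s x. t \<in> {0..T} \<Longrightarrow> s \<in> {0..T} \<Longrightarrow> ((\<lambda>r. \<sigma> r s x) has_vector_derivative \<sigma>t t s x) (at t within {0..T})"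
    and dx: "\<And>t s x i. t \<in> {0..T} \<Longrightarrow> s \<in> {0..T} \<Longrightarrow>
      ((\<lambda>r. \<sigma> t s (x + r *\<^sub>R axis i 1)) has_vector_derivative \<sigma>x i t s x) (at 0)"
    and dxt: "\<And>t s x i. t \<in> {0..T} \<Longrightarrow> s \<in> {0..T} \<Longrightarrow>
      ((\<lambda>r. \<sigma>t t s (x + r *\<^sub>R axis i 1)) has_vector_derivative \<sigma>xt i t s x) (at 0)"
    and h1: "\<And>t s x y. t \<in> {0..T} \<Longrightarrow> s \<in> {0..T} \<Longrightarrow>
      norm (\<sigma> t s x - \<sigma> t s y) + norm (\<sigma>t t s x - \<sigma>t t s y) \<le> K * norm (x - y)"
    and h2: "\<And>N t s x y i. 0 \<le> N \<Longrightarrow> t \<in> {0..T} \<Longrightarrow> s \<in> {0..T} \<Longrightarrow> norm x \<le> N \<Longrightarrow> norm y \<le> N \<Longrightarrow>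
      norm (\<sigma>x i t s x - \<sigma>x i t s y) + norm (\<sigma>xt i t s x - \<sigma>xt i t s y) \<le> KN N * norm (x - y) powr \<delta>"
    and h3: "\<And>t1 t2 s x i. t1 \<in> {0..T} \<Longrightarrow> t2 \<in> {0..T} \<Longrightarrow> s \<in> {0..T} \<Longrightarrow>
      norm (\<sigma> t1 s x - \<sigma> t2 s x) + norm (\<sigma>x i t1 s x - \<sigma>x i t2 s x) \<le> K * \<bar>t1 - t2\<bar> powr \<mu>"
    and h4: "\<And>t s1 s2 x. t \<in> {0..T} \<Longrightarrow> s1 \<in> {0..T} \<Longrightarrow> s2 \<in> {0..T} \<Longrightarrow>
      norm (\<sigma> t s1 x - \<sigma> t s2 x) + norm (\<sigma>t t s1 x - \<sigma>t t s2 x) \<le> K * \<bar>s1 - s2\<bar> powr \<beta>"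
    and h5: "\<And>t s1 s2 x i. t \<in> {0..T} \<Longrightarrow> s1 \<in> {0..T} \<Longrightarrow> s2 \<in> {0..T} \<Longrightarrow>
      norm (\<sigma>xt i t s1 x - \<sigma>xt i t s2 x) + norm (\<sigma>x i t s1 x - \<sigma>x i t s2 x) \<le> K * \<bar>s1 - s2\<bar> powr \<beta>"
begin

lemma first_le: "p + q \<le> r \<Longrightarrow> 0 \<le> q \<Longrightarrow> p \<le> r" and second_le: "p + q \<le> r \<Longrightarrow> 0 \<le> p \<Longrightarrow> q \<le> r" for p q r :: real
  by linarith+

lemma mean_value_time:
  fixes Z :: "real \<Rightarrow> real^'m^'d"
  assumes "\<And>r. r \<in> {0..T} \<Longrightarrow> (Z has_vector_derivative Z' r) (at r within {0..T})"
    and "\<And>r. r \<in> {0..T} \<Longrightarrow> norm (Z' r) \<le> B" "t \<in> {0..T}" "s \<in> {0..T}"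
  shows "norm (Z t - Z s) \<le> B * \<bar>t - s\<bar>"
  by (rule vector_mean_value_bound[OF _ assms]) simp_all

lemma lipschitz:
  assumes "t \<in> {0..T}" "x \<in> {0..T}"
  shows "norm (\<sigma> t x v - \<sigma> t x w) \<le> K * norm (v - w)" "norm (\<sigma>t t x v - \<sigma>t t x w) \<le> K * norm (v - w)"
  by (rule first_le[OF h1] second_le[OF h1]; use assms in simp)+

lemma time_holder:
  assumes "t \<in> {0..T}" "s \<in> {0..T}" "x \<in> {0..T}"
  shows "norm (\<sigma> t x v - \<sigma> s x v) \<le> K * \<bar>t - s\<bar> powr \<mu>"
  by (rule first_le[OF h3]) (use assms in auto)

lemma increment:
  assumes t: "t \<in> {0..T}" "x \<in> {0..T}" "y \<in> {0..T}"
  shows "norm (\<sigma> t x v - \<sigma> t y w) \<le> K * (norm (v - w) + \<bar>x - y\<bar> powr \<beta>)"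
    and "norm (\<sigma>t t x v - \<sigma>t t y w) \<le> K * (norm (v - w) + \<bar>x - y\<bar> powr \<beta>)"
proof -
  have "norm (\<sigma> t x w - \<sigma> t y w) \<le> K * \<bar>x - y\<bar> powr \<beta>" "norm (\<sigma>t t x w - \<sigma>t t y w) \<le> K * \<bar>x - y\<bar> powr \<beta>"
    by (rule first_le[OF h4] second_le[OF h4]; use t in simp)+
  then show "norm (\<sigma> t x v - \<sigma> t y w) \<le> K * (norm (v - w) + \<bar>x - y\<bar> powr \<beta>)"
    and "norm (\<sigma>t t x v - \<sigma>t t y w) \<le> K * (norm (v - w) + \<bar>x - y\<bar> powr \<beta>)"
    using lipschitz[of t x v w] t norm_triangle_ineq[of "\<sigma> t x v - \<sigma> t x w" "\<sigma> t x w - \<sigma> t y w"]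
      norm_triangle_ineq[of "\<sigma>t t x v - \<sigma>t t x w" "\<sigma>t t x w - \<sigma>t t y w"]
    by (simp_all add: distrib_left)
qed

text \<open>The two points \<open>(x,v)\<close> and \<open>(y,w)\<close> are fixed and the mean
  value inequality is applied in time; \<open>increment\<close> for \<open>\<sigma>t\<close> bounds
  the derivative. A double difference thus gains the full factor
  \<open>\<bar>t - s\<bar>\<close>.\<close>

lemma increment_time:
  assumes t: "t \<in> {0..T}" "s \<in> {0..T}" "x \<in> {0..T}" "y \<in> {0..T}"
  shows "norm (\<sigma> t x v - \<sigma> s x v - (\<sigma> t y w - \<sigma> s y w)) \<le> K * \<bar>t - s\<bar> * (norm (v - w) + \<bar>x - y\<bar> powr \<beta>)"
  using mean_value_time[of "\<lambda>r. \<sigma> r x v - \<sigma> r y w" "\<lambda>r. \<sigma>t r x v - \<sigma>t r y w" "K * (norm (v - w) + \<bar>x - y\<bar> powr \<beta>)" t s]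
    dt increment(2) t by (simp add: has_vector_derivative_diff algebra_simps)

lemma lipschitz_time:
  assumes t: "t \<in> {0..T}" "s \<in> {0..T}" "x \<in> {0..T}"
  shows "norm (\<sigma> t x v - \<sigma> t x w - (\<sigma> s x v - \<sigma> s x w)) \<le> K * \<bar>t - s\<bar> * norm (v - w)"
  using mean_value_time[of "\<lambda>r. \<sigma> r x v - \<sigma> r x w" "\<lambda>r. \<sigma>t r x v - \<sigma>t r x w" "K * norm (v - w)" t s]
    dt lipschitz(2) t by (simp add: has_vector_derivative_diff algebra_simps)

text \<open>Lipschitz constant in \<open>x\<close>, Hoelder constant in \<open>s\<close> of the
  partial derivatives, and their local Hoelder constant in \<open>x\<close> on the enlarged ball of
  \<open>four_point_bound\<close>.\<close>

definition four_point_const :: "real \<Rightarrow> real" where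
  "four_point_const N = K + real CARD('d) * K + real CARD('d) * KN (5 * N)"

lemma four_point_combine:
  assumes "0 \<le> N" "0 \<le> n1" "0 \<le> n2" "0 \<le> X" "0 \<le> Y"
  shows "K * n1 + real CARD('d) * (K * X) * n2 + real CARD('d) * (KN (5 * N) * Y) * n2
    \<le> four_point_const N * (n1 + n2 * (X + Y))"
proof -
  let ?B = "four_point_const N"
  have b: "K \<le> ?B" "real CARD('d) * K \<le> ?B" "real CARD('d) * KN (5 * N) \<le> ?B"
    using K_pos KN_pos[of "5 * N"] assms by (auto simp: four_point_const_def)
  have "K * n1 + real CARD('d) * K * (n2 * X) + real CARD('d) * KN (5 * N) * (n2 * Y)
      \<le> ?B * n1 + ?B * (n2 * X) + ?B * (n2 * Y)"
    using assms by (intro add_mono mult_right_mono b) auto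
  also have "\<dots> = ?B * (n1 + n2 * (X + Y))" by (simp only: distrib_left add.assoc)
  finally show ?thesis by (simp only: mult_ac)
qed

text \<open>The two functions compared in \<open>four_point_bound\<close> are
  \<open>\<sigma> t x\<close> and \<open>\<sigma> t y\<close>, whose partial derivatives differ by
  at most \<open>K * \<bar>x - y\<bar> powr \<beta>\<close>. The second estimate is the same for
  \<open>\<sigma>t\<close> with the mixed derivatives; it is the bound on the derivative in
  \<open>four_point_time\<close>.\<close>

lemma four_point:
  assumes N: "0 \<le> N" and t: "t \<in> {0..T}" "x \<in> {0..T}" "y \<in> {0..T}" and n: "norm a \<le> N" "norm b \<le> N" "norm c \<le> N"
  shows "norm (\<sigma> t x a - \<sigma> t x b - (\<sigma> t y c - \<sigma> t y e))
      \<le> four_point_const N * (norm ((a - b) - (c - e)) + norm (a - b) * (\<bar>x - y\<bar> powr \<beta> + norm (a - c) powr \<delta>))"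
    and "norm (\<sigma>t t x a - \<sigma>t t x b - (\<sigma>t t y c - \<sigma>t t y e))
      \<le> four_point_const N * (norm ((a - b) - (c - e)) + norm (a - b) * (\<bar>x - y\<bar> powr \<beta> + norm (a - c) powr \<delta>))"
  by (rule order_trans[OF four_point_bound[OF dx[OF t(1,2)] dx[OF t(1,3)] lipschitz(1)[OF t(1,3)] _ _ n] four_point_combine]
        order_trans[OF four_point_bound[OF dxt[OF t(1,2)] dxt[OF t(1,3)] lipschitz(2)[OF t(1,3)] _ _ n] four_point_combine];
      use N t in \<open>auto intro!: first_le[OF h2] second_le[OF h5] second_le[OF h2] first_le[OF h5]\<close>)+

lemma four_point_time:
  assumes N: "0 \<le> N" and t: "t \<in> {0..T}" "s \<in> {0..T}" "x \<in> {0..T}" "y \<in> {0..T}"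
    and n: "norm a \<le> N" "norm b \<le> N" "norm c \<le> N"
  shows "norm (\<sigma> t x a - \<sigma> t x b - (\<sigma> t y c - \<sigma> t y e) - (\<sigma> s x a - \<sigma> s x b - (\<sigma> s y c - \<sigma> s y e)))
    \<le> four_point_const N * \<bar>t - s\<bar> * (norm ((a - b) - (c - e)) + norm (a - b) * (\<bar>x - y\<bar> powr \<beta> + norm (a - c) powr \<delta>))"
proof -
  have "norm (\<sigma> t x a - \<sigma> t x b - (\<sigma> t y c - \<sigma> t y e) - (\<sigma> s x a - \<sigma> s x b - (\<sigma> s y c - \<sigma> s y e)))
    \<le> four_point_const N * (norm ((a - b) - (c - e)) + norm (a - b) * (\<bar>x - y\<bar> powr \<beta> + norm (a - c) powr \<delta>)) * \<bar>t - s\<bar>"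
    by (rule mean_value_time[where Z' = "\<lambda>r. \<sigma>t r x a - \<sigma>t r x b - (\<sigma>t r y c - \<sigma>t r y e)"])
       (intro has_vector_derivative_diff dt four_point(2) t n N; assumption)+
  then show ?thesis by (simp only: mult_ac)
qed

end

lemma H1_volterra_coefficient:
  fixes \<sigma> :: "real \<Rightarrow> real \<Rightarrow> real^'d \<Rightarrow> real^'m^'d"
  assumes "H1 T \<beta> \<mu> \<delta> K KN \<sigma>"
  obtains \<sigma>t \<sigma>x \<sigma>xt where "volterra_coefficient T \<beta> \<mu> \<delta> K KN \<sigma> \<sigma>t \<sigma>x \<sigma>xt"
  using assms unfolding H1_def
proof (elim conjE exE, goal_cases)
  case (1 \<sigma>t \<sigma>x \<sigma>xt)
  note K = 1(8) and KN = 1(9) and D = 1(11-)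
  show thesis
  proof (rule that[of \<sigma>t \<sigma>x \<sigma>xt], unfold_locales, goal_cases)
    case 1 show ?case by (rule K)
  next
    case 2 then show ?case using KN by blast
  next
    case 3 then show ?case using D(1) by blast
  next
    case 4 then show ?case using D(1) by blast
  next
    case 5 then show ?case using D(1) by blast
  next
    case 6 then show ?case using D(2) by blast
  next
    case 7 then show ?case using D(3) by blast
  next
    case 8 then show ?case using D(4) by blast
  next
    case 9 then show ?case using D(5) by blast
  next
    case 10 then show ?case using D(6) by blast
  qed
qed

subsection \<open>Proof of the proposition\<close>

definition kappa :: "real \<Rightarrow> real \<Rightarrow> real \<Rightarrow> real \<Rightarrow> real \<Rightarrow> real" where
  "kappa T \<alpha> \<beta> a b = a + b * (T powr \<alpha> + T powr \<beta> / (\<beta> - \<alpha>))"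

lemma kappa_nonneg: "\<alpha> < \<beta> \<Longrightarrow> 0 \<le> a \<Longrightarrow> 0 \<le> b \<Longrightarrow> 0 \<le> kappa T \<alpha> \<beta> a b"
  by (simp add: kappa_def)

text \<open>Homogeneity lets the factor \<open>(t - s) powr (1 - \<alpha>)\<close> of a time
  increment leave the constant.\<close>

lemma kappa_scale: "kappa T \<alpha> \<beta> (a * c) (b * c) = c * kappa T \<alpha> \<beta> a b"
  by (simp add: kappa_def algebra_simps)

lemma powr_shift_le:
  fixes r T p q :: real
  assumes "0 < r" "r \<le> T" "p \<le> q"
  shows "r powr q \<le> T powr (q - p) * r powr p"
proof -
  have "r powr q = r powr (q - p) * r powr p" by (simp add: powr_add[symmetric])
  also have "\<dots> \<le> T powr (q - p) * r powr p"
    using assms by (intro mult_right_mono powr_mono2) auto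
  finally show ?thesis .
qed

lemma one_plus_alpha_density_le:
  assumes "0 \<le> l" "0 \<le> x" "x \<le> T"
  shows "1 + alpha_density \<alpha> f x \<le> ennreal (exp (l * x)) * (1 + alpha_lambda_norm T \<alpha> l f)"
proof -
  have "1 \<le> ennreal (exp (l * x))" using assms by simp
  then have "1 + alpha_density \<alpha> f x \<le> ennreal (exp (l * x)) + ennreal (exp (l * x)) * alpha_lambda_norm T \<alpha> l f"
    using alpha_density_le[OF assms(2,3)] by (rule add_mono)
  then show ?thesis by (simp add: distrib_left)
qed

lemma weight_bound:
  fixes P Q A :: ennreal
  assumes "P \<le> ennreal (r * V * x powr (- \<alpha>)) * Q" "Q \<le> ennreal (exp (l * x)) * A" "0 \<le> r" "0 \<le> V" "V \<le> V'"
  shows "P \<le> ennreal (r * weight \<alpha> l x) * (ennreal V' * A)"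
proof -
  have "P \<le> ennreal (r * V * x powr (- \<alpha>)) * (ennreal (exp (l * x)) * A)"
    using assms by (intro order_trans[OF assms(1)] mult_left_mono) auto
  also have "\<dots> = ennreal (r * weight \<alpha> l x) * (ennreal V * A)"
  proof -
    have "ennreal (r * V * x powr (- \<alpha>)) * ennreal (exp (l * x)) = ennreal (r * weight \<alpha> l x) * ennreal V"
      using assms by (subst (1 2) ennreal_mult[symmetric]) (auto simp: mult_ac)
    then show ?thesis by (simp only: mult.assoc[symmetric])
  qed
  also have "\<dots> \<le> ennreal (r * weight \<alpha> l x) * (ennreal V' * A)"
    using assms by (intro mult_left_mono mult_right_mono ennreal_leI) auto
  finally show ?thesis .
qed

lemma W0_measurable: "f \<in> W0 T \<alpha> \<Longrightarrow> f \<in> borel_on T"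
  and W0_finite: "f \<in> W0 T \<alpha> \<Longrightarrow> alpha_norm T \<alpha> f < \<infinity>"
  by (simp_all add: W0_def)

text \<open>Common ground of both parts: \<open>a\<close>, \<open>b\<close> control a single
  \<open>F t\<close>, the primed constants the increments in \<open>t\<close>. The alternative in
  \<open>dom\<close> reflects the nature of \<open>A\<close>. If \<open>A\<close> is finite,
  domination follows from the estimate; in the second part \<open>A\<close> contains
  \<open>Delta\<close> and may be infinite, so domination has to come from elsewhere.\<close>

lemma integrand_familyI:
  fixes F :: "real \<Rightarrow> real \<Rightarrow> real^'m^'d" and u :: "real \<Rightarrow> 'a::euclidean_space" and p :: "real \<Rightarrow> real"
  assumes T: "0 < T" and \<alpha>: "0 < \<alpha>" "\<alpha> < 1 / 2" and \<beta>: "\<alpha> < \<beta>" and g: "g \<in> WT T \<alpha>" and l: "0 \<le> l"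
    and F: "\<And>t. 0 \<le> t \<Longrightarrow> t \<le> T \<Longrightarrow> F t \<in> borel_on T" and u: "u \<in> borel_on T"
    and q: "\<And>x. (\<lambda>y. ennreal (q x y / (x - y) powr (\<alpha> + 1))) \<in> borel_on T" "\<And>x y. 0 \<le> q x y"
    and nonneg: "0 \<le> a" "0 \<le> b" "0 \<le> a'" "0 \<le> b'" "\<And>x. 0 \<le> p x"
    and val: "\<And>t x. 0 \<le> t \<Longrightarrow> t \<le> T \<Longrightarrow> 0 < x \<Longrightarrow> x < T \<Longrightarrow> norm (F t x) \<le> a * p x"
    and incr: "\<And>t x y. 0 \<le> t \<Longrightarrow> t \<le> T \<Longrightarrow> 0 < y \<Longrightarrow> y < x \<Longrightarrow> x < T \<Longrightarrow>
      norm (F t x - F t y) \<le> b * (norm (u x - u y) + p x * ((x - y) powr \<beta> + q x y))"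
    and val': "\<And>s t x. 0 \<le> s \<Longrightarrow> s < t \<Longrightarrow> t \<le> T \<Longrightarrow> 0 < x \<Longrightarrow> x < T \<Longrightarrow>
      norm (F t x - F s x) \<le> a' * (t - s) powr (1 - \<alpha>) * p x"
    and incr': "\<And>s t x y. 0 \<le> s \<Longrightarrow> s < t \<Longrightarrow> t \<le> T \<Longrightarrow> 0 < y \<Longrightarrow> y < x \<Longrightarrow> x < T \<Longrightarrow>
      norm (F t x - F s x - (F t y - F s y))
        \<le> b' * (t - s) powr (1 - \<alpha>) * (norm (u x - u y) + p x * ((x - y) powr \<beta> + q x y))"
    and R: "\<And>x. 0 < x \<Longrightarrow> x < T \<Longrightarrow>
      ennreal (p x) * (1 + (\<integral>\<^sup>+y\<in>{0<..<x}. ennreal (q x y / (x - y) powr (\<alpha> + 1)) \<partial>lborel)) + frac_int \<alpha> u x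
        \<le> ennreal (exp (l * x)) * A"
    and dom: "A < \<infinity> \<or> (\<forall>t. 0 \<le> t \<longrightarrow> t \<le> T \<longrightarrow> frac_dominated T \<alpha> (F t))"
    and V: "kappa T \<alpha> \<beta> a b + kappa T \<alpha> \<beta> a' b' \<le> V"
  shows "integrand_family T \<alpha> l g F (ennreal V * A)"
proof -
  have \<kappa>: "0 \<le> kappa T \<alpha> \<beta> a b" "0 \<le> kappa T \<alpha> \<beta> a' b'"
    using nonneg \<beta> by (auto intro: kappa_nonneg)
  have var: "frac_var \<alpha> (F t) x \<le> ennreal (weight \<alpha> l x) * (ennreal V * A)"
    if tx: "0 \<le> t" "t \<le> T" "0 < x" "x < T" for t x
  proof -
    have "frac_var \<alpha> (F t) x \<le> ennreal (1 * kappa T \<alpha> \<beta> a b * x powr (- \<alpha>))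
      * (ennreal (p x) * (1 + (\<integral>\<^sup>+y\<in>{0<..<x}. ennreal (q x y / (x - y) powr (\<alpha> + 1)) \<partial>lborel)) + frac_int \<alpha> u x)"
      unfolding kappa_def mult_1_left
      using tx by (intro frac_var_le \<alpha> \<beta> nonneg u q val incr) auto
    from weight_bound[OF this R[OF tx(3,4)], of V] \<kappa> V show ?thesis by simp
  qed
  show ?thesis
  proof
    show "frac_dominated T \<alpha> (F t)" if t: "0 \<le> t" "t \<le> T" for t
    proof (cases "A < \<infinity>")
      case True
      define c where "c = exp (l * T) * (V * enn2real A)"
      have A: "A = ennreal (enn2real A)" using True by simp
      have V0: "0 \<le> V" using \<kappa> V by linarith
      show ?thesis
      proof (rule frac_dominatedI)
        show "0 \<le> c" using V0 by (simp add: c_def)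
        fix x assume x: "0 < x" "x < T"
        have "frac_var \<alpha> (F t) x \<le> ennreal (weight \<alpha> l x * (V * enn2real A))"
          using var[OF t x] V0 by (subst (asm) A) (simp add: ennreal_mult)
        also have "\<dots> \<le> ennreal (c * x powr (- \<alpha>))"
        proof (rule ennreal_leI)
          have "exp (l * x) \<le> exp (l * T)" using l x by (simp add: mult_left_mono)
          then have "exp (l * x) * (V * enn2real A * x powr (- \<alpha>)) \<le> exp (l * T) * (V * enn2real A * x powr (- \<alpha>))"
            using V0 by (intro mult_right_mono) auto
          then show "weight \<alpha> l x * (V * enn2real A) \<le> c * x powr (- \<alpha>)" by (simp add: c_def mult_ac)
        qed
        finally show "frac_var \<alpha> (F t) x \<le> ennreal (c * x powr (- \<alpha>))" .
      qed
    qed (use dom t in blast)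
    show "frac_var \<alpha> (\<lambda>y. F t y - F s y) x \<le> ennreal ((t - s) powr (1 - \<alpha>) * weight \<alpha> l x) * (ennreal V * A)"
      if tx: "0 \<le> s" "s < t" "t \<le> T" "0 < x" "x < T" for s t x
    proof -
      have "frac_var \<alpha> (\<lambda>y. F t y - F s y) x \<le> ennreal ((t - s) powr (1 - \<alpha>) * kappa T \<alpha> \<beta> a' b' * x powr (- \<alpha>))
        * (ennreal (p x) * (1 + (\<integral>\<^sup>+y\<in>{0<..<x}. ennreal (q x y / (x - y) powr (\<alpha> + 1)) \<partial>lborel)) + frac_int \<alpha> u x)"
        unfolding kappa_scale[symmetric] unfolding kappa_def
        using tx by (intro frac_var_le \<alpha> \<beta> nonneg u q val' incr' mult_nonneg_nonneg) auto
      from weight_bound[OF this R[OF tx(4,5)], of V] \<kappa> V show ?thesis by simp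
    qed
  qed (use T \<alpha> g F var in auto)
qed

text \<open>The first argument of the first \<open>kappa\<close> is the growth constant of the
  coefficient. Those of the second come from \<open>\<bar>t - s\<bar> powr \<mu>\<close> and
  \<open>\<bar>t - s\<bar>\<close>, both reduced to \<open>(t - s) powr (1 - \<alpha>)\<close> by
  powers of \<open>T\<close>; the former requires \<mu> > 1 - \<alpha>.\<close>

definition value_const :: "real \<Rightarrow> real \<Rightarrow> real \<Rightarrow> real \<Rightarrow> real \<Rightarrow> real \<Rightarrow> real" where
  "value_const T \<alpha> \<beta> \<mu> K M = kappa T \<alpha> \<beta> (M + K * T powr \<mu> + K * T powr \<beta> + K) K
     + kappa T \<alpha> \<beta> (K * T powr (\<mu> - (1 - \<alpha>))) (K * T powr \<alpha>)"

lemma integrand_family_values: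
  fixes \<sigma> :: "real \<Rightarrow> real \<Rightarrow> real^'d \<Rightarrow> real^'m^'d"
  assumes T: "0 < T" and \<alpha>: "0 < \<alpha>" "\<alpha> < 1 / 2" and \<beta>: "\<alpha> < \<beta>" and \<mu>: "1 - \<mu> < \<alpha>"
    and H: "H1 T \<beta> \<mu> \<delta> K KN \<sigma>" and M: "norm (\<sigma> 0 0 0) \<le> M"
    and g: "g \<in> WT T \<alpha>" and f: "f \<in> W0 T \<alpha>" and l: "0 \<le> l"
  shows "integrand_family T \<alpha> l g (\<lambda>t s. \<sigma> t s (f s))
    (ennreal (value_const T \<alpha> \<beta> \<mu> K M) * (1 + alpha_lambda_norm T \<alpha> l f))"
proof -
  have K: "0 < K" and b0: "0 < \<beta>" and m0: "0 < \<mu>" using H by (simp_all add: H1_def)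
  have M0: "0 \<le> M" using M norm_ge_zero[of "\<sigma> 0 0 0"] by linarith
  obtain \<sigma>t \<sigma>x \<sigma>xt where "volterra_coefficient T \<beta> \<mu> \<delta> K KN \<sigma> \<sigma>t \<sigma>x \<sigma>xt"
    using H by (rule H1_volterra_coefficient)
  then interpret volterra_coefficient T \<beta> \<mu> \<delta> K KN \<sigma> \<sigma>t \<sigma>x \<sigma>xt .
  define a where "a = M + K * T powr \<mu> + K * T powr \<beta> + K"
  \<comment> \<open>(H1) bounds differences only, so the value is traced back to
    \<open>\<sigma> 0 0 0\<close> by way of \<open>\<sigma> t 0 0\<close>.\<close>
  have growth: "norm (\<sigma> t x v) \<le> a * (1 + norm v)" if tx: "0 \<le> t" "t \<le> T" "0 < x" "x < T" for t x v
  proof -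
    have "norm (\<sigma> t x v - \<sigma> t 0 0) \<le> K * (norm (v - 0) + \<bar>x - 0\<bar> powr \<beta>)"
      by (rule increment(1)) (use tx T in auto)
    moreover have "norm (\<sigma> t 0 0 - \<sigma> 0 0 0) \<le> K * \<bar>t - 0\<bar> powr \<mu>"
      by (rule time_holder) (use tx T in auto)
    moreover have "K * x powr \<beta> \<le> K * T powr \<beta>" "K * t powr \<mu> \<le> K * T powr \<mu>"
      using tx K b0 m0 by (auto intro!: mult_left_mono powr_mono2)
    moreover have "norm (\<sigma> t x v) \<le> norm (\<sigma> t x v - \<sigma> t 0 0) + (norm (\<sigma> t 0 0 - \<sigma> 0 0 0) + norm (\<sigma> 0 0 0))"
      using norm_triangle_sub[of "\<sigma> t x v" "\<sigma> t 0 0"] norm_triangle_sub[of "\<sigma> t 0 0" "\<sigma> 0 0 0"] by linarith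
    ultimately have "norm (\<sigma> t x v) \<le> M + K * T powr \<mu> + K * T powr \<beta> + K * norm v"
      using M tx by (simp add: distrib_left)
    also have "\<dots> \<le> a + a * norm v"
      using K M0 by (intro add_mono mult_right_mono) (auto simp: a_def)
    finally show ?thesis by (simp add: distrib_left)
  qed
  have le: "norm (f x - f y) + \<bar>x - y\<bar> powr \<beta> \<le> norm (f x - f y) + (1 + norm (f x)) * ((x - y) powr \<beta> + 0)"
    if "y < x" for x y
    using that by (simp add: distrib_right)
  show ?thesis
  proof (rule integrand_familyI[where u = f and p = "\<lambda>x. 1 + norm (f x)" and q = "\<lambda>x y. 0" and \<beta> = \<beta>
        and a = a and b = K and a' = "K * T powr (\<mu> - (1 - \<alpha>))" and b' = "K * T powr \<alpha>"])
    show "(\<lambda>s. \<sigma> t s (f s)) \<in> borel_on T" if "0 \<le> t" "t \<le> T" for t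
      by (rule H1_measurable[OF H that W0_measurable[OF f]])
    show "norm (\<sigma> t x (f x)) \<le> a * (1 + norm (f x))" if "0 \<le> t" "t \<le> T" "0 < x" "x < T" for t x
      by (rule growth[OF that])
    show "norm (\<sigma> t x (f x) - \<sigma> t y (f y)) \<le> K * (norm (f x - f y) + (1 + norm (f x)) * ((x - y) powr \<beta> + 0))"
      if "0 \<le> t" "t \<le> T" "0 < y" "y < x" "x < T" for t x y
      by (rule order_trans[OF increment(1) mult_left_mono[OF le]]) (use that K in auto)
    show "norm (\<sigma> t x (f x) - \<sigma> s x (f x)) \<le> K * T powr (\<mu> - (1 - \<alpha>)) * (t - s) powr (1 - \<alpha>) * (1 + norm (f x))"
      if tx: "0 \<le> s" "s < t" "t \<le> T" "0 < x" "x < T" for s t x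
    proof -
      have "norm (\<sigma> t x (f x) - \<sigma> s x (f x)) \<le> K * \<bar>t - s\<bar> powr \<mu>"
        by (rule time_holder) (use tx in auto)
      also have "\<dots> \<le> K * (T powr (\<mu> - (1 - \<alpha>)) * (t - s) powr (1 - \<alpha>))"
        using tx K \<mu> powr_shift_le[of "t - s" T "1 - \<alpha>" \<mu>] by (intro mult_left_mono) auto
      also have "\<dots> \<le> K * (T powr (\<mu> - (1 - \<alpha>)) * (t - s) powr (1 - \<alpha>)) * (1 + norm (f x))"
        using K by (simp add: distrib_left)
      finally show ?thesis by (simp only: mult.assoc)
    qed
    show "norm (\<sigma> t x (f x) - \<sigma> s x (f x) - (\<sigma> t y (f y) - \<sigma> s y (f y)))
        \<le> K * T powr \<alpha> * (t - s) powr (1 - \<alpha>) * (norm (f x - f y) + (1 + norm (f x)) * ((x - y) powr \<beta> + 0))"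
      if tx: "0 \<le> s" "s < t" "t \<le> T" "0 < y" "y < x" "x < T" for s t x y
    proof -
      have ts: "K * \<bar>t - s\<bar> \<le> K * T powr \<alpha> * (t - s) powr (1 - \<alpha>)"
        using tx K \<alpha> powr_shift_le[of "t - s" T "1 - \<alpha>" 1] by (simp add: mult.assoc)
      show ?thesis
        by (rule order_trans[OF increment_time mult_mono[OF ts le]]) (use tx K in auto)
    qed
    show "ennreal (1 + norm (f x)) * (1 + (\<integral>\<^sup>+y\<in>{0<..<x}. ennreal (0 / (x - y) powr (\<alpha> + 1)) \<partial>lborel)) + frac_int \<alpha> f x
        \<le> ennreal (exp (l * x)) * (1 + alpha_lambda_norm T \<alpha> l f)" if "0 < x" "x < T" for x
      using one_plus_alpha_density_le[of l x T \<alpha> f] that l by (simp add: alpha_density_def add.assoc)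
    \<comment> \<open>For \<open>l \<ge> 0\<close> the weight is at most \<open>1\<close>, so the
      weighted norm is finite on \<open>W0\<close>; this is the first alternative of the domination
      condition.\<close>
    have "alpha_lambda_norm T \<alpha> l f \<le> alpha_norm T \<alpha> f"
      unfolding alpha_lambda_norm_def alpha_norm_def
    proof (rule SUP_mono)
      fix t assume t: "t \<in> {0..T}"
      have "ennreal (exp (- l * t)) * alpha_density \<alpha> f t \<le> 1 * alpha_density \<alpha> f t"
        using l t by (intro mult_right_mono) (auto simp flip: ennreal_1 intro!: ennreal_leI)
      then show "\<exists>m\<in>{0..T}. ennreal (exp (- l * t)) * (ennreal (norm (f t)) + frac_int \<alpha> f t) \<le> ennreal (norm (f m)) + frac_int \<alpha> f m"
        using t by (auto simp: alpha_density_def)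
    qed
    then show "1 + alpha_lambda_norm T \<alpha> l f < \<infinity> \<or> (\<forall>t. 0 \<le> t \<longrightarrow> t \<le> T \<longrightarrow> frac_dominated T \<alpha> (\<lambda>s. \<sigma> t s (f s)))"
      using W0_finite[OF f] by (simp add: le_less_trans)
  qed (use T \<alpha> \<beta> g l K M0 W0_measurable[OF f] in \<open>auto simp: a_def value_const_def\<close>)
qed

definition lipschitz_const :: "real \<Rightarrow> real \<Rightarrow> real \<Rightarrow> real \<Rightarrow> real \<Rightarrow> real" where
  "lipschitz_const T \<alpha> \<beta> K b = kappa T \<alpha> \<beta> K b + kappa T \<alpha> \<beta> (K * T powr \<alpha>) (b * T powr \<alpha>)"

text \<open>The local size is now \<open>norm (f x - h x)\<close>, and the further increment
  \<open>norm (f x - f y) powr \<delta>\<close> stems from the Hoelder continuity of the partial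
  derivatives in the four-point bound; its integral is at most \<open>Delta\<close>.\<close>

lemma integrand_family_differences:
  fixes \<sigma> :: "real \<Rightarrow> real \<Rightarrow> real^'d \<Rightarrow> real^'m^'d"
  assumes T: "0 < T" and \<alpha>: "0 < \<alpha>" "\<alpha> < 1 / 2" and \<beta>: "\<alpha> < \<beta>" and \<mu>: "1 - \<mu> < \<alpha>"
    and H: "H1 T \<beta> \<mu> \<delta> K KN \<sigma>"
    and g: "g \<in> WT T \<alpha>" and f: "f \<in> W0 T \<alpha>" and h: "h \<in> W0 T \<alpha>" and N: "0 \<le> N" and l: "0 \<le> l"
    and fN: "\<And>s. 0 \<le> s \<Longrightarrow> s \<le> T \<Longrightarrow> norm (f s) \<le> N" and hN: "\<And>s. 0 \<le> s \<Longrightarrow> s \<le> T \<Longrightarrow> norm (h s) \<le> N"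
    and b: "b = K + real CARD('d) * K + real CARD('d) * KN (5 * N)"
  shows "integrand_family T \<alpha> l g (\<lambda>t s. \<sigma> t s (f s) - \<sigma> t s (h s))
    (ennreal (lipschitz_const T \<alpha> \<beta> K b) * ((1 + Delta T \<alpha> \<delta> f + Delta T \<alpha> \<delta> h)
      * alpha_lambda_norm T \<alpha> l (\<lambda>t. f t - h t)))"
proof -
  have K: "0 < K" and KN: "0 \<le> KN (5 * N)" using H N by (auto simp: H1_def intro: less_imp_le)
  obtain \<sigma>t \<sigma>x \<sigma>xt where "volterra_coefficient T \<beta> \<mu> \<delta> K KN \<sigma> \<sigma>t \<sigma>x \<sigma>xt"
    using H by (rule H1_volterra_coefficient)
  then interpret volterra_coefficient T \<beta> \<mu> \<delta> K KN \<sigma> \<sigma>t \<sigma>x \<sigma>xt .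
  have b': "b = four_point_const N" unfolding four_point_const_def by (rule b)
  have b0: "0 \<le> b" using K KN unfolding b by (intro add_nonneg_nonneg) auto
  note fm = W0_measurable[OF f] and hm = W0_measurable[OF h]
  let ?u = "\<lambda>t. f t - h t" and ?D = "1 + Delta T \<alpha> \<delta> f + Delta T \<alpha> \<delta> h"
  \<comment> \<open>The families of \<open>f\<close> and of \<open>h\<close> separately provide
    measurability and domination of the difference, also when \<open>Delta\<close> is
    infinite.\<close>
  interpret Ff: integrand_family T \<alpha> l g "\<lambda>t s. \<sigma> t s (f s)"
    "ennreal (value_const T \<alpha> \<beta> \<mu> K (norm (\<sigma> 0 0 0))) * (1 + alpha_lambda_norm T \<alpha> l f)"
    by (rule integrand_family_values[OF T \<alpha> \<beta> \<mu> H order_refl g f l])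
  interpret Fh: integrand_family T \<alpha> l g "\<lambda>t s. \<sigma> t s (h s)"
    "ennreal (value_const T \<alpha> \<beta> \<mu> K (norm (\<sigma> 0 0 0))) * (1 + alpha_lambda_norm T \<alpha> l h)"
    by (rule integrand_family_values[OF T \<alpha> \<beta> \<mu> H order_refl g h l])
  have ts: "c * \<bar>t - s\<bar> \<le> c * T powr \<alpha> * (t - s) powr (1 - \<alpha>)" if "0 \<le> c" "0 \<le> s" "s < t" "t \<le> T" for c s t
    using that \<alpha> powr_shift_le[of "t - s" T "1 - \<alpha>" 1] by (simp add: mult.assoc mult_left_mono)
  show ?thesis
  proof (rule integrand_familyI[where u = ?u and p = "\<lambda>x. norm (?u x)" and q = "\<lambda>x y. norm (f x - f y) powr \<delta>" and \<beta> = \<beta>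
        and a = K and b = b and a' = "K * T powr \<alpha>" and b' = "b * T powr \<alpha>"])
    show "(\<lambda>s. \<sigma> t s (f s) - \<sigma> t s (h s)) \<in> borel_on T" if "0 \<le> t" "t \<le> T" for t
      using Ff.meas[OF that] Fh.meas[OF that] by (rule borel_measurable_diff)
    show "?u \<in> borel_on T" using fm hm by (rule borel_measurable_diff)
    show "(\<lambda>y. ennreal (norm (f x - f y) powr \<delta> / (x - y) powr (\<alpha> + 1))) \<in> borel_on T" for x
      by (rule frac_integrand_measurable(1)[OF fm])
    show "norm (\<sigma> t x (f x) - \<sigma> t x (h x)) \<le> K * norm (?u x)" if "0 \<le> t" "t \<le> T" "0 < x" "x < T" for t x
      by (rule lipschitz(1)) (use that in auto)
    show "norm (\<sigma> t x (f x) - \<sigma> t x (h x) - (\<sigma> t y (f y) - \<sigma> t y (h y)))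
        \<le> b * (norm (?u x - ?u y) + norm (?u x) * ((x - y) powr \<beta> + norm (f x - f y) powr \<delta>))"
      if "0 \<le> t" "t \<le> T" "0 < y" "y < x" "x < T" for t x y
      using four_point(1)[OF N, of t x y "f x" "h x" "f y" "h y"] that fN hN unfolding b' by simp
    show "norm (\<sigma> t x (f x) - \<sigma> t x (h x) - (\<sigma> s x (f x) - \<sigma> s x (h x))) \<le> K * T powr \<alpha> * (t - s) powr (1 - \<alpha>) * norm (?u x)"
      if "0 \<le> s" "s < t" "t \<le> T" "0 < x" "x < T" for s t x
      by (rule order_trans[OF lipschitz_time mult_right_mono[OF ts]]) (use that K in auto)
    show "norm (\<sigma> t x (f x) - \<sigma> t x (h x) - (\<sigma> s x (f x) - \<sigma> s x (h x))
          - (\<sigma> t y (f y) - \<sigma> t y (h y) - (\<sigma> s y (f y) - \<sigma> s y (h y))))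
        \<le> b * T powr \<alpha> * (t - s) powr (1 - \<alpha>) * (norm (?u x - ?u y) + norm (?u x) * ((x - y) powr \<beta> + norm (f x - f y) powr \<delta>))"
      (is "norm ?l \<le> _ * ?e")
      if tx: "0 \<le> s" "s < t" "t \<le> T" "0 < y" "y < x" "x < T" for s t x y
    proof -
      \<comment> \<open>\<open>four_point_time\<close> takes the time difference outermost, the goal
        the difference in \<open>x\<close> and \<open>y\<close>; the double difference is the
        same.\<close>
      have "norm (\<sigma> t x (f x) - \<sigma> t x (h x) - (\<sigma> t y (f y) - \<sigma> t y (h y))
          - (\<sigma> s x (f x) - \<sigma> s x (h x) - (\<sigma> s y (f y) - \<sigma> s y (h y)))) \<le> b * \<bar>t - s\<bar> * ?e"
        using four_point_time[OF N, of t s x y "f x" "h x" "f y" "h y"] tx fN hN unfolding b' by simp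
      also have "\<dots> \<le> b * T powr \<alpha> * (t - s) powr (1 - \<alpha>) * ?e"
        by (intro mult_right_mono ts b0) (use tx in auto)
      finally show ?thesis by (simp add: algebra_simps)
    qed
    show "ennreal (norm (?u x)) * (1 + (\<integral>\<^sup>+y\<in>{0<..<x}. ennreal (norm (f x - f y) powr \<delta> / (x - y) powr (\<alpha> + 1)) \<partial>lborel))
         + frac_int \<alpha> ?u x \<le> ennreal (exp (l * x)) * (?D * alpha_lambda_norm T \<alpha> l ?u)" (is "?R \<le> _")
      if x: "0 < x" "x < T" for x
    proof -
      have "(\<integral>\<^sup>+y\<in>{0<..<x}. ennreal (norm (f x - f y) powr \<delta> / (x - y) powr (\<alpha> + 1)) \<partial>lborel) \<le> Delta T \<alpha> \<delta> f"
        unfolding Delta_def using x by (intro SUP_upper) auto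
      then have Q: "1 + (\<integral>\<^sup>+y\<in>{0<..<x}. ennreal (norm (f x - f y) powr \<delta> / (x - y) powr (\<alpha> + 1)) \<partial>lborel) \<le> ?D"
        by (simp add: add.assoc add_increasing2)
      have "1 \<le> ?D" by (simp add: add.assoc)
      from mult_right_mono[OF this] have DI: "I \<le> ?D * I" for I by (metis mult_1_left zero_le)
      have "?R \<le> ennreal (norm (?u x)) * ?D + ?D * frac_int \<alpha> ?u x"
        by (intro add_mono mult_left_mono Q DI) simp
      also have "\<dots> = ?D * alpha_density \<alpha> ?u x"
        unfolding alpha_density_def by (simp only: distrib_left mult.commute)
      also have "\<dots> \<le> ?D * (ennreal (exp (l * x)) * alpha_lambda_norm T \<alpha> l ?u)"
        using x by (intro mult_left_mono alpha_density_le) auto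
      finally show ?thesis by (simp only: mult_ac)
    qed
    show "?D * alpha_lambda_norm T \<alpha> l ?u < \<infinity> \<or> (\<forall>t. 0 \<le> t \<longrightarrow> t \<le> T \<longrightarrow> frac_dominated T \<alpha> (\<lambda>s. \<sigma> t s (f s) - \<sigma> t s (h s)))"
      using frac_dominated_diff[OF Ff.meas Fh.meas Ff.dom Fh.dom] by blast
  qed (use T \<alpha> \<beta> g l K b0 in \<open>auto simp: lipschitz_const_def\<close>)
qed

text \<open>Dividing a Hoelder increment of order \<open>1 - \<alpha>\<close> by
  \<open>(t - s) powr (\<alpha> + 1)\<close> leaves \<open>(t - s) powr (- 2 * \<alpha>)\<close>,
  integrable as \<alpha> < 1/2. Measurability comes from continuity.\<close>

lemma holder_space_subset_W0:
  assumes T: "0 < T" and \<alpha>: "0 < \<alpha>" "\<alpha> < 1 / 2"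
  shows "(holder_space T (1 - \<alpha>) :: (real \<Rightarrow> 'a::real_normed_vector) set) \<subseteq> W0 T \<alpha>"
proof
  fix f :: "real \<Rightarrow> 'a" assume f: "f \<in> holder_space T (1 - \<alpha>)"
  let ?q = "SUP (s, t)\<in>{(s, t). 0 \<le> s \<and> s < t \<and> t \<le> T}. ennreal (norm (f t - f s) / (t - s) powr (1 - \<alpha>))"
  have fin: "sup_norm T f < \<infinity>" "?q < \<infinity>"
    using f by (simp_all add: holder_space_def holder_norm_def)
  define C where "C = enn2real ?q"
  have C: "0 \<le> C" "?q = ennreal C" using fin by (simp_all add: C_def)
  have hol: "norm (f t - f s) \<le> C * (t - s) powr (1 - \<alpha>)" if st: "0 \<le> s" "s < t" "t \<le> T" for s t
  proof -
    have "ennreal (norm (f t - f s) / (t - s) powr (1 - \<alpha>)) \<le> ennreal C"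
      unfolding C(2)[symmetric] using st by (intro SUP_upper2[of "(s, t)"]) auto
    then show ?thesis using C st by (simp add: ennreal_le_iff divide_le_eq)
  qed
  have "continuous_on {0..T} f"
    unfolding continuous_on_def
  proof
    fix t assume t: "t \<in> {0..T}"
    have "((\<lambda>s. C * \<bar>s - t\<bar> powr (1 - \<alpha>)) \<longlongrightarrow> C * 0) (at t within {0..T})"
      using \<alpha> by (intro tendsto_mult tendsto_const)
        (auto intro!: tendsto_eq_intros simp: eventually_at_filter)
    then have "((\<lambda>s. C * \<bar>s - t\<bar> powr (1 - \<alpha>)) \<longlongrightarrow> 0) (at t within {0..T})" by simp
    moreover have "eventually (\<lambda>s. norm (f s - f t) \<le> C * \<bar>s - t\<bar> powr (1 - \<alpha>)) (at t within {0..T})"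
      unfolding eventually_at_filter
    proof (intro always_eventually allI impI)
      fix s assume "s \<noteq> t" "s \<in> {0..T}"
      then show "norm (f s - f t) \<le> C * \<bar>s - t\<bar> powr (1 - \<alpha>)"
        using hol[of s t] hol[of t s] t by (cases "s < t") (auto simp: norm_minus_commute abs_minus_commute)
    qed
    ultimately have "((\<lambda>s. f s - f t) \<longlongrightarrow> 0) (at t within {0..T})"
      by (rule Lim_null_comparison[rotated])
    then show "(f \<longlongrightarrow> f t) (at t within {0..T})" by (simp add: LIM_zero_iff)
  qed
  then have meas: "f \<in> borel_on T"
    by (rule borel_measurable_continuous_on_restrict)
  have "alpha_norm T \<alpha> f \<le> sup_norm T f + ennreal (C * (T powr (1 - 2 * \<alpha>) / (1 - 2 * \<alpha>)))"
    unfolding alpha_norm_def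
  proof (rule SUP_least)
    fix t assume t: "t \<in> {0..T}"
    have "frac_int \<alpha> f t
        \<le> (\<integral>\<^sup>+s. ennreal C * (ennreal ((t - s) powr ((1 - 2 * \<alpha>) - 1)) * indicator {0<..<t} s) \<partial>lborel)"
    proof (rule nn_integral_mono)
      fix s
      show "ennreal (norm (f t - f s) / (t - s) powr (\<alpha> + 1)) * indicator {0<..<t} s
          \<le> ennreal C * (ennreal ((t - s) powr ((1 - 2 * \<alpha>) - 1)) * indicator {0<..<t} s)"
      proof (cases "0 < s \<and> s < t")
        case True
        have "norm (f t - f s) / (t - s) powr (\<alpha> + 1) \<le> C * (t - s) powr (1 - \<alpha>) / (t - s) powr (\<alpha> + 1)"
          using True t by (intro divide_right_mono hol) auto
        also have "\<dots> = C * ((t - s) powr ((1 - 2 * \<alpha>) - 1))"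
          using powr_diff[of "t - s" "1 - \<alpha>" "\<alpha> + 1"] by simp
        finally show ?thesis using True C by (simp add: ennreal_mult[symmetric] ennreal_leI)
      qed simp
    qed
    also have "\<dots> = ennreal C * (\<integral>\<^sup>+s\<in>{0<..<t}. ennreal ((t - s) powr ((1 - 2 * \<alpha>) - 1)) \<partial>lborel)"
      by (rule nn_integral_cmult) measurable
    also have "\<dots> \<le> ennreal C * ennreal (T powr (1 - 2 * \<alpha>) / (1 - 2 * \<alpha>))"
    proof (cases "t = 0")
      case False
      then have "(\<integral>\<^sup>+s\<in>{0<..<t}. ennreal ((t - s) powr ((1 - 2 * \<alpha>) - 1)) \<partial>lborel) = ennreal ((t - 0) powr (1 - 2 * \<alpha>) / (1 - 2 * \<alpha>))"
        using t \<alpha> by (intro integral_powr_right(3)) auto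
      also have "\<dots> \<le> ennreal (T powr (1 - 2 * \<alpha>) / (1 - 2 * \<alpha>))"
        using t \<alpha> by (intro ennreal_leI divide_right_mono powr_mono2) auto
      finally show ?thesis by (rule mult_left_mono) simp
    qed simp
    also have "\<dots> = ennreal (C * (T powr (1 - 2 * \<alpha>) / (1 - 2 * \<alpha>)))"
      by (rule ennreal_mult[symmetric]) (use C \<alpha> in auto)
    finally have "frac_int \<alpha> f t
        \<le> ennreal (C * (T powr (1 - 2 * \<alpha>) / (1 - 2 * \<alpha>)))" .
    moreover have "ennreal (norm (f t)) \<le> sup_norm T f"
      unfolding sup_norm_def using t by (intro SUP_upper)
    ultimately show "ennreal (norm (f t)) + frac_int \<alpha> f t
        \<le> sup_norm T f + ennreal (C * (T powr (1 - 2 * \<alpha>) / (1 - 2 * \<alpha>)))"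
      by (intro add_mono)
  qed
  also have "\<dots> < \<infinity>" using fin(1) by simp
  finally show "f \<in> W0 T \<alpha>" using meas by (simp add: W0_def)
qed

text \<open>The integral is formally total; this places the integrands in the class where it is
  defined as intended.\<close>

lemma stieltjes_integrandI:
  fixes F :: "real \<Rightarrow> 'a::real_normed_vector"
  assumes T: "0 < T" and \<alpha>: "\<alpha> < 1" and F: "F \<in> borel_on T" and dom: "frac_dominated T \<alpha> F"
  shows "stieltjes_integrand T \<alpha> F"
proof -
  obtain c where c: "0 \<le> c" and fin: "\<And>x. 0 < x \<Longrightarrow> x < T \<Longrightarrow> frac_var \<alpha> F x \<le> ennreal (c * x powr (- \<alpha>))"
    using dom by (rule frac_dominatedE) (rule that)
  have le: "(\<integral>\<^sup>+s\<in>{0<..<T}. p s \<partial>lborel) \<le> ennreal c * ennreal (T powr (1 - \<alpha>) / (1 - \<alpha>))"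
    if p: "\<And>s. 0 < s \<Longrightarrow> s < T \<Longrightarrow> p s \<le> frac_var \<alpha> F s" for p
  proof -
    have "(\<integral>\<^sup>+s\<in>{0<..<T}. p s \<partial>lborel) \<le> (\<integral>\<^sup>+s. ennreal c * (ennreal ((s - 0) powr ((1 - \<alpha>) - 1)) * indicator {0<..<T} s) \<partial>lborel)"
      using order_trans[OF p fin] c
      by (intro nn_integral_mono) (auto simp: indicator_def ennreal_mult[symmetric])
    also have "\<dots> = ennreal c * (\<integral>\<^sup>+s\<in>{0<..<T}. ennreal ((s - 0) powr ((1 - \<alpha>) - 1)) \<partial>lborel)"
      by (rule nn_integral_cmult) measurable
    also have "(\<integral>\<^sup>+s\<in>{0<..<T}. ennreal ((s - 0) powr ((1 - \<alpha>) - 1)) \<partial>lborel) = ennreal (T powr (1 - \<alpha>) / (1 - \<alpha>))"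
      using integral_powr_left(3)[of 0 T "1 - \<alpha>"] T \<alpha> by simp
    finally show ?thesis by simp
  qed
  have "(\<integral>\<^sup>+s\<in>{0<..<T}. ennreal (norm (F s) / s powr \<alpha>) \<partial>lborel)
     + (\<integral>\<^sup>+s\<in>{0<..<T}. frac_int \<alpha> F s \<partial>lborel)
    \<le> ennreal c * ennreal (T powr (1 - \<alpha>) / (1 - \<alpha>)) + ennreal c * ennreal (T powr (1 - \<alpha>) / (1 - \<alpha>))"
    by (intro add_mono le) (simp_all add: frac_var_def powr_minus divide_inverse)
  also have "\<dots> < \<infinity>" by (simp add: ennreal_mult_less_top)
  finally show ?thesis using F by (simp add: stieltjes_integrand_def)
qed

lemma Lambda_finite:
  fixes g :: "real \<Rightarrow> real^'m"
  assumes "0 < T" "0 < \<alpha>" "\<alpha> < 1 / 2" "g \<in> WT T \<alpha>"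
  shows "Lambda T \<alpha> g < \<infinity>"
  by (rule WT_frac_integrator[OF assms]) simp

lemma alpha_lambda_norm_cong:
  assumes "\<And>t. 0 \<le> t \<Longrightarrow> t \<le> T \<Longrightarrow> f t = h t"
  shows "alpha_lambda_norm T \<alpha> l f = alpha_lambda_norm T \<alpha> l h"
  unfolding alpha_lambda_norm_def
proof (intro SUP_cong refl)
  fix t assume t: "t \<in> {0..T}"
  have "frac_int \<alpha> f t
      = frac_int \<alpha> h t"
    using t by (intro nn_integral_cong) (auto simp: indicator_def assms)
  then show "ennreal (exp (- l * t)) * (ennreal (norm (f t)) + frac_int \<alpha> f t)
    = ennreal (exp (- l * t)) * (ennreal (norm (h t)) + frac_int \<alpha> h t)"
    using t by (simp add: assms)
qed

lemma mult_const_le: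
  fixes A B :: ennreal
  assumes "0 \<le> c" "0 \<le> e" "0 \<le> r" "real n * c * e \<le> d"
  shows "of_nat n * (A * (ennreal c * B)) * ennreal (e * r) \<le> A * ennreal (d * r) * B"
proof -
  have "of_nat n * (A * (ennreal c * B)) * ennreal (e * r) = A * (ennreal (real n) * ennreal c * ennreal (e * r)) * B"
    by (simp add: ennreal_of_nat_eq_real_of_nat mult_ac)
  also have "ennreal (real n) * ennreal c * ennreal (e * r) = ennreal (real n * c * e * r)"
    using assms by (simp add: ennreal_mult mult.assoc)
  also have "A * ennreal (real n * c * e * r) * B \<le> A * ennreal (d * r) * B"
    using assms by (intro mult_left_mono mult_right_mono ennreal_leI) auto
  finally show ?thesis .
qed

lemma divide_powr_eq: "d / l powr (1 - 2 * \<alpha>) = d * l powr (2 * \<alpha> - 1)" for d l :: real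
proof -
  have "l powr (2 * \<alpha> - 1) = inverse (l powr (1 - 2 * \<alpha>))"
    using powr_minus[of l "1 - 2 * \<alpha>"] by simp
  then show ?thesis by (simp add: divide_inverse)
qed

lemma value_const_nonneg:
  "0 \<le> M \<Longrightarrow> 0 \<le> K \<Longrightarrow> \<alpha> < \<beta> \<Longrightarrow> 0 \<le> value_const T \<alpha> \<beta> \<mu> K M"
  unfolding value_const_def by (intro add_nonneg_nonneg kappa_nonneg mult_nonneg_nonneg) auto

lemma lipschitz_const_nonneg:
  "0 \<le> K \<Longrightarrow> 0 \<le> b \<Longrightarrow> \<alpha> < \<beta> \<Longrightarrow> 0 \<le> lipschitz_const T \<alpha> \<beta> K b"
  unfolding lipschitz_const_def by (intro add_nonneg_nonneg kappa_nonneg mult_nonneg_nonneg) auto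

text \<open>The bound of the family depends on \<open>l\<close>, so it is instantiated twice: with
  \<open>l = 0\<close> for the Hoelder norm and with the given \<open>l\<close> for the weighted
  norm. Its factor \<open>value_const\<close> is the same in both.\<close>

lemma G_op_bounds:
  fixes \<sigma> :: "real \<Rightarrow> real \<Rightarrow> real^'d \<Rightarrow> real^'m^'d"
  assumes T: "0 < T" and \<alpha>: "0 < \<alpha>" "\<alpha> < 1 / 2" and \<beta>: "\<alpha> < \<beta>" and \<mu>: "1 - \<mu> < \<alpha>"
    and H: "H1 T \<beta> \<mu> \<delta> K KN \<sigma>" and M: "norm (\<sigma> 0 0 0) \<le> M" and g: "g \<in> WT T \<alpha>" and f: "f \<in> W0 T \<alpha>"
    and d3: "real (CARD('d) * CARD('m)) * value_const T \<alpha> \<beta> \<mu> K M * holder_const T \<alpha> \<le> d3"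
    and d4: "real (CARD('d) * CARD('m)) * value_const T \<alpha> \<beta> \<mu> K M * exp_const T \<alpha> \<le> d4"
  shows "t \<in> {0..T} \<Longrightarrow> stieltjes_integrand T \<alpha> (\<lambda>s. \<sigma> t s (f s))"
    and "holder_norm T (1 - \<alpha>) (G_op \<alpha> g \<sigma> f) \<le> Lambda T \<alpha> g * ennreal d3 * (1 + alpha_norm T \<alpha> f)"
    and "G_op \<alpha> g \<sigma> f \<in> holder_space T (1 - \<alpha>)"
    and "1 \<le> l \<Longrightarrow> alpha_lambda_norm T \<alpha> l (G_op \<alpha> g \<sigma> f)
      \<le> Lambda T \<alpha> g * ennreal (d4 / l powr (1 - 2 * \<alpha>)) * (1 + alpha_lambda_norm T \<alpha> l f)"
proof -
  let ?n = "CARD('d) * CARD('m)" and ?V = "value_const T \<alpha> \<beta> \<mu> K M"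
  have "0 \<le> M" using M norm_ge_zero[of "\<sigma> 0 0 0"] by linarith
  moreover have "0 < K" using H by (simp add: H1_def)
  ultimately have V: "0 \<le> ?V" using \<beta> by (intro value_const_nonneg) auto
  note family = integrand_family_values[OF T \<alpha> \<beta> \<mu> H M g f]
  have G: "G_op \<alpha> g \<sigma> f = (\<lambda>t. stieltjes_integral_mat \<alpha> t (\<lambda>s. \<sigma> t s (f s)) g)"
    by (simp add: G_op_def fun_eq_iff)
  interpret F: integrand_family T \<alpha> 0 g "\<lambda>t s. \<sigma> t s (f s)" "ennreal ?V * (1 + alpha_lambda_norm T \<alpha> 0 f)"
    by (rule family) simp
  show "stieltjes_integrand T \<alpha> (\<lambda>s. \<sigma> t s (f s))" if "t \<in> {0..T}"
    by (rule stieltjes_integrandI[OF T _ F.meas F.dom]) (use \<alpha> that in auto)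
  have "holder_norm T (1 - \<alpha>) (G_op \<alpha> g \<sigma> f)
    \<le> of_nat ?n * (Lambda T \<alpha> g * (ennreal ?V * (1 + alpha_norm T \<alpha> f))) * ennreal (holder_const T \<alpha> * 1)"
    unfolding G alpha_norm_eq mult_1_right by (rule F.holder_norm_le[OF refl])
  also have "\<dots> \<le> Lambda T \<alpha> g * ennreal (d3 * 1) * (1 + alpha_norm T \<alpha> f)"
    using V d3 holder_const_pos[OF T \<alpha>] by (intro mult_const_le) auto
  finally show hn: "holder_norm T (1 - \<alpha>) (G_op \<alpha> g \<sigma> f) \<le> Lambda T \<alpha> g * ennreal d3 * (1 + alpha_norm T \<alpha> f)"
    by simp
  also have "\<dots> < \<infinity>"
    using Lambda_finite[OF T \<alpha> g] W0_finite[OF f] by (simp add: ennreal_mult_less_top)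
  finally show "G_op \<alpha> g \<sigma> f \<in> holder_space T (1 - \<alpha>)" by (simp add: holder_space_def)
  assume l: "1 \<le> l"
  interpret F': integrand_family T \<alpha> l g "\<lambda>t s. \<sigma> t s (f s)" "ennreal ?V * (1 + alpha_lambda_norm T \<alpha> l f)"
    by (rule family) (use l in simp)
  have "alpha_lambda_norm T \<alpha> l (G_op \<alpha> g \<sigma> f)
    \<le> of_nat ?n * (Lambda T \<alpha> g * (ennreal ?V * (1 + alpha_lambda_norm T \<alpha> l f))) * ennreal (exp_const T \<alpha> * l powr (2 * \<alpha> - 1))"
    unfolding G by (rule F'.alpha_lambda_norm_le[OF l])
  also have "\<dots> \<le> Lambda T \<alpha> g * ennreal (d4 * l powr (2 * \<alpha> - 1)) * (1 + alpha_lambda_norm T \<alpha> l f)"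
    using V d4 exp_const_pos[OF T \<alpha>] by (intro mult_const_le) auto
  finally show "alpha_lambda_norm T \<alpha> l (G_op \<alpha> g \<sigma> f)
    \<le> Lambda T \<alpha> g * ennreal (d4 / l powr (1 - 2 * \<alpha>)) * (1 + alpha_lambda_norm T \<alpha> l f)"
    by (simp only: divide_powr_eq)
qed

text \<open>Linearity turns the difference of the integrals into the integral of a difference for
  times in \<open>[0,T]\<close>, which is all that the norm sees.\<close>

lemma G_op_diff_bound:
  fixes \<sigma> :: "real \<Rightarrow> real \<Rightarrow> real^'d \<Rightarrow> real^'m^'d"
  assumes T: "0 < T" and \<alpha>: "0 < \<alpha>" "\<alpha> < 1 / 2" and \<beta>: "\<alpha> < \<beta>" and \<mu>: "1 - \<mu> < \<alpha>"
    and H: "H1 T \<beta> \<mu> \<delta> K KN \<sigma>" and g: "g \<in> WT T \<alpha>" and f: "f \<in> W0 T \<alpha>" and h: "h \<in> W0 T \<alpha>"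
    and N: "0 \<le> N" "sup_norm T f \<le> ennreal N" "sup_norm T h \<le> ennreal N" and l: "1 \<le> l"
    and b: "b = K + real CARD('d) * K + real CARD('d) * KN (5 * N)"
    and dN: "real (CARD('d) * CARD('m)) * lipschitz_const T \<alpha> \<beta> K b * exp_const T \<alpha> \<le> dN"
  shows "alpha_lambda_norm T \<alpha> l (\<lambda>t. G_op \<alpha> g \<sigma> f t - G_op \<alpha> g \<sigma> h t)
    \<le> Lambda T \<alpha> g * ennreal (dN / l powr (1 - 2 * \<alpha>)) * (1 + Delta T \<alpha> \<delta> f + Delta T \<alpha> \<delta> h)
      * alpha_lambda_norm T \<alpha> l (\<lambda>t. f t - h t)"
proof -
  let ?n = "CARD('d) * CARD('m)" and ?V = "lipschitz_const T \<alpha> \<beta> K b"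
  let ?D = "1 + Delta T \<alpha> \<delta> f + Delta T \<alpha> \<delta> h" and ?u = "\<lambda>t. f t - h t"
  have sup: "norm (k s) \<le> N" if "sup_norm T k \<le> ennreal N" "0 \<le> s" "s \<le> T" for k :: "real \<Rightarrow> real^'d" and s
  proof -
    have "ennreal (norm (k s)) \<le> sup_norm T k"
      unfolding sup_norm_def using that by (intro SUP_upper) auto
    from order_trans[OF this that(1)] show ?thesis using N by simp
  qed
  have "0 < K" "0 < KN (5 * N)" using H N by (auto simp: H1_def)
  then have V: "0 \<le> ?V" using \<beta> by (intro lipschitz_const_nonneg) (auto simp: b)
  have l0: "0 \<le> l" using l by simp
  interpret F: integrand_family T \<alpha> l g "\<lambda>t s. \<sigma> t s (f s) - \<sigma> t s (h s)" "ennreal ?V * (?D * alpha_lambda_norm T \<alpha> l ?u)"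
    by (rule integrand_family_differences[OF T \<alpha> \<beta> \<mu> H g f h N(1) l0 sup[OF N(2)] sup[OF N(3)] b])
  note family = integrand_family_values[OF T \<alpha> \<beta> \<mu> H order_refl g _ l0]
  have G: "G_op \<alpha> g \<sigma> f t - G_op \<alpha> g \<sigma> h t = stieltjes_integral_mat \<alpha> t (\<lambda>s. \<sigma> t s (f s) - \<sigma> t s (h s)) g"
    if t: "0 \<le> t" "t \<le> T" for t
    unfolding G_op_def
    by (rule stieltjes_integral_mat_diff[OF T \<alpha> g integrand_family.meas[OF family[OF f] t] integrand_family.meas[OF family[OF h] t]
          t integrand_family.dom[OF family[OF f] t] integrand_family.dom[OF family[OF h] t], symmetric])
  have "alpha_lambda_norm T \<alpha> l (\<lambda>t. G_op \<alpha> g \<sigma> f t - G_op \<alpha> g \<sigma> h t)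
    = alpha_lambda_norm T \<alpha> l (\<lambda>t. stieltjes_integral_mat \<alpha> t (\<lambda>s. \<sigma> t s (f s) - \<sigma> t s (h s)) g)"
    by (rule alpha_lambda_norm_cong) (rule G)
  also have "\<dots> \<le> of_nat ?n * (Lambda T \<alpha> g * (ennreal ?V * (?D * alpha_lambda_norm T \<alpha> l ?u))) * ennreal (exp_const T \<alpha> * l powr (2 * \<alpha> - 1))"
    by (rule F.alpha_lambda_norm_le[OF l])
  also have "\<dots> \<le> Lambda T \<alpha> g * ennreal (dN * l powr (2 * \<alpha> - 1)) * (?D * alpha_lambda_norm T \<alpha> l ?u)"
    using V dN exp_const_pos[OF T \<alpha>] by (intro mult_const_le) auto
  finally show ?thesis
    by (simp only: divide_powr_eq mult.assoc)
qed

text \<open>Dependence of the constants is expressed by the order of quantifiers. A constant matrix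
  satisfies (H1) whatever its size, so \<open>d3\<close> and \<open>d4\<close> need the bound
  \<open>M\<close> on one value of the coefficient. \<open>dN\<close> is chosen after
  \<open>KN\<close>, since it involves \<open>KN (5 * N)\<close>, but before
  \<open>\<delta>\<close>, the coefficient and the functions.\<close>

theorem proposition3p2:
  fixes T \<alpha> \<beta> \<mu> K :: real
  assumes "0 < T" and "0 < \<alpha>" and "\<alpha> < 1 / 2"
    and "\<alpha> < \<beta>" and "1 - \<mu> < \<alpha>"
  shows "(holder_space T (1 - \<alpha>) :: (real \<Rightarrow> real^'d) set) \<subseteq> W0 T \<alpha>
    \<and> (\<forall>M\<ge>0. \<exists>d3 d4. 0 < d3 \<and> 0 < d4 \<and>
        (\<forall>\<delta> KN (\<sigma> :: real \<Rightarrow> real \<Rightarrow> real^'d \<Rightarrow> real^'m^'d) (g :: real \<Rightarrow> real^'m) f.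
           H1 T \<beta> \<mu> \<delta> K KN \<sigma> \<longrightarrow> norm (\<sigma> 0 0 0) \<le> M \<longrightarrow> g \<in> WT T \<alpha> \<longrightarrow> f \<in> W0 T \<alpha> \<longrightarrow>
           (\<forall>t\<in>{0..T}. stieltjes_integrand T \<alpha> (\<lambda>s. \<sigma> t s (f s))) \<and>
           G_op \<alpha> g \<sigma> f \<in> holder_space T (1 - \<alpha>) \<and>
           holder_norm T (1 - \<alpha>) (G_op \<alpha> g \<sigma> f)
             \<le> Lambda T \<alpha> g * ennreal d3 * (1 + alpha_norm T \<alpha> f) \<and>
           (\<forall>l\<ge>1. alpha_lambda_norm T \<alpha> l (G_op \<alpha> g \<sigma> f)
             \<le> Lambda T \<alpha> g * ennreal (d4 / l powr (1 - 2 * \<alpha>)) * (1 + alpha_lambda_norm T \<alpha> l f))))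
    \<and> (\<forall>N\<ge>0. \<forall>KN. \<exists>dN. 0 < dN \<and>
        (\<forall>\<delta> (\<sigma> :: real \<Rightarrow> real \<Rightarrow> real^'d \<Rightarrow> real^'m^'d) (g :: real \<Rightarrow> real^'m) f h.
           H1 T \<beta> \<mu> \<delta> K KN \<sigma> \<longrightarrow> g \<in> WT T \<alpha> \<longrightarrow> f \<in> W0 T \<alpha> \<longrightarrow> h \<in> W0 T \<alpha> \<longrightarrow>
           sup_norm T f \<le> ennreal N \<longrightarrow> sup_norm T h \<le> ennreal N \<longrightarrow>
           (\<forall>l\<ge>1. alpha_lambda_norm T \<alpha> l (\<lambda>t. G_op \<alpha> g \<sigma> f t - G_op \<alpha> g \<sigma> h t)
             \<le> Lambda T \<alpha> g * ennreal (dN / l powr (1 - 2 * \<alpha>))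
                 * (1 + Delta T \<alpha> \<delta> f + Delta T \<alpha> \<delta> h)
                 * alpha_lambda_norm T \<alpha> l (\<lambda>t. f t - h t))))"
proof (intro conjI allI impI, goal_cases)
  case 1
  show ?case by (rule holder_space_subset_W0[OF assms(1-3)])
next
  case (2 M)
  let ?c = "real (CARD('d) * CARD('m)) * value_const T \<alpha> \<beta> \<mu> K M"
  \<comment> \<open>The maximum with \<open>1\<close> makes the constants strictly positive.\<close>
  define d3 d4 where "d3 = max 1 (?c * holder_const T \<alpha>)" and "d4 = max 1 (?c * exp_const T \<alpha>)"
  have d: "0 < d3" "0 < d4" and le: "?c * holder_const T \<alpha> \<le> d3" "?c * exp_const T \<alpha> \<le> d4"
    by (auto simp: d3_def d4_def)
  show ?case
    by (rule exI[of _ d3], rule exI[of _ d4], intro conjI d allI impI ballI G_op_bounds[OF assms _ _ _ _ le])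
next
  case (3 N KN)
  define b where "b = K + real CARD('d) * K + real CARD('d) * KN (5 * N)"
  let ?c = "real (CARD('d) * CARD('m)) * lipschitz_const T \<alpha> \<beta> K b * exp_const T \<alpha>"
  have d: "0 < max 1 ?c" and le: "?c \<le> max 1 ?c" by auto
  show ?case
    by (rule exI[of _ "max 1 ?c"], intro conjI d allI impI G_op_diff_bound[where K = K and KN = KN and N = N and b = b, OF assms _ _ _ _ 3 _ _ _ b_def le])
qed

end
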